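(* Let $(M,F)$ be a Finsler space of dimension $n$ with fundamental tensor components $g_{ij}(x,y)$, let $|\psi|^2:TM\setminus\{0\}\to\mathbb{R}^+$ be a positive smooth weight function that is homogeneous of degree zero in $y$, and let $\langle\cdot\rangle_\psi$ be the corresponding average over the indicatrices. Put $h_{ij}(\psi,x):=\langle g_{ij}(x,y)\rangle_\psi$ for $x\in M$, $i,j=1,\dots,n$. Then $\{h_{ij}(\psi,x)\}_{i,j=1}^n$ are the components of a Riemannian metric $h_\psi(x)=h_{ij}(\psi,x)\,dx^i\otimes dx^j$ on $M$.
   Context: The summation convention is used. $M$ is an $n$-dimensional smooth manifold, $N=TM\setminus\{0\}$ is the slit tangent bundle, and local coordinates $(x^i)$ on $M$ induce natural coordinates $(x^i,y^i)$ on $TM$. A Finsler space $(M,F)$ is a manifold $M$ with a function $F:TM\to[0,\infty)$ that is smooth on $N$, satisfies $F(x,\lambda y)=\lambda F(x,y)$ for all $\lambda\ge 0$, and for which the matrix $g_{ij}(x,y):=\frac12\frac{\partial^2F^2(x,y)}{\partial y^i\partial y^j}$ is positive definite on $N$. The $g_{ij}$ are the components of the fundamental tensor. The indicatrix at $x$ is $I_x=\{y\in T_xM: F(x,y)=1\}$, a compact submanifold of $T_xM$. It carries the volume form $dvol_x$ obtained by pulling back to $I_x$ the contraction of $\sqrt{\det g(x,y)}\,\frac{\delta y^1}{F}\wedge\cdots\wedge\frac{\delta y^n}{F}$ with the vector field $l=\frac{y^i}{F}\frac{\partial}{\partial y^i}$. Here $\delta y^i$ restricts to $dy^i$ on the fiber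 $T_xM\setminus\{0\}$, and $I_x$ is oriented so that $dvol_x$ is positive. With weight $|\psi|^2$, put $vol(I_x)=\int_{I_x}|\psi|^2(x,y)\,dvol_x$, and for a function $f$ define $\langle f\rangle_\psi(x)=\frac{1}{vol(I_x)}\int_{I_x}|\psi|^2(x,y)f(x,y)\,dvol_x$. *)

theory Defs
  imports "HOL-Analysis.Analysis"
begin

primrec Ck_on :: "nat \<Rightarrow> 'a::euclidean_space set \<Rightarrow> ('a \<Rightarrow> 'b::real_normed_vector) \<Rightarrow> bool" where
  "Ck_on 0 S f \<longleftrightarrow> continuous_on S f"
| "Ck_on (Suc k) S f \<longleftrightarrow>
     (\<forall>x\<in>S. f differentiable (at x)) \<and> (\<forall>v. Ck_on k S (\<lambda>x. frechet_derivative f (at x) v))"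

definition smooth_on :: "'a::euclidean_space set \<Rightarrow> ('a \<Rightarrow> 'b::real_normed_vector) \<Rightarrow> bool" where
  "smooth_on S f \<longleftrightarrow> open S \<and> (\<forall>k. Ck_on k S f)"

definition partial :: "'n \<Rightarrow> (real^'n \<Rightarrow> 'b::real_normed_vector) \<Rightarrow> real^'n::finite \<Rightarrow> 'b" where
  "partial i f x = frechet_derivative f (at x) (axis i 1)"

text \<open>A chart is a pair of its domain and its coordinate map; the values of the coordinate map
  outside the domain are irrelevant.\<close>

type_synonym ('m, 'n) chart = "'m set \<times> ('m \<Rightarrow> real^'n)"

abbreviation dom_of :: "('m, 'n::finite) chart \<Rightarrow> 'm set" where
  "dom_of c \<equiv> fst c"

abbreviation coord :: "('m, 'n::finite) chart \<Rightarrow> 'm \<Rightarrow> real^'n" where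
  "coord c \<equiv> snd c"

abbreviation img_of :: "('m, 'n::finite) chart \<Rightarrow> (real^'n) set" where
  "img_of c \<equiv> coord c ` dom_of c"

definition point :: "('m, 'n::finite) chart \<Rightarrow> real^'n \<Rightarrow> 'm" where
  "point c = inv_into (dom_of c) (coord c)"

definition trans_map :: "('m, 'n::finite) chart \<Rightarrow> ('m, 'n) chart \<Rightarrow> real^'n \<Rightarrow> real^'n" where
  "trans_map c d = coord d \<circ> point c"

definition is_chart :: "'m topology \<Rightarrow> ('m, 'n::finite) chart \<Rightarrow> bool" where
  "is_chart X c \<longleftrightarrow> openin X (dom_of c) \<and> open (img_of c) \<and>
     homeomorphic_map (subtopology X (dom_of c)) (top_of_set (img_of c)) (coord c)"

text \<open>The atlas need not be maximal; a maximal one is allowed.\<close>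

definition smooth_manifold :: "'m topology \<Rightarrow> ('m, 'n::finite) chart set \<Rightarrow> bool" where
  "smooth_manifold X A \<longleftrightarrow>
     Hausdorff_space X \<and> second_countable X \<and>
     (\<forall>c\<in>A. is_chart X c) \<and> (\<Union>c\<in>A. dom_of c) = topspace X \<and>
     (\<forall>c\<in>A. \<forall>d\<in>A. smooth_on (coord c ` (dom_of c \<inter> dom_of d)) (trans_map c d))"

text \<open>A tangent vector at \<open>p\<close> is the family of its coordinate vectors with respect to all charts
  at \<open>p\<close>, related by the Jacobians of the transition maps. Indices that are not charts at \<open>p\<close>
  get the value 0, so that equal vectors are equal families.\<close>

type_synonym ('m, 'n) tvector = "('m, 'n) chart \<Rightarrow> real^'n"

definition tangent_space :: "('m, 'n::finite) chart set \<Rightarrow> 'm \<Rightarrow> ('m, 'n) tvector set" where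
  "tangent_space A p = {v.
     (\<forall>c. c \<notin> A \<or> p \<notin> dom_of c \<longrightarrow> v c = 0) \<and>
     (\<forall>c\<in>A. \<forall>d\<in>A. p \<in> dom_of c \<inter> dom_of d \<longrightarrow>
        v d = frechet_derivative (trans_map c d) (at (coord c p)) (v c))}"

definition tzero :: "('m, 'n::finite) tvector" where
  "tzero = (\<lambda>c. 0)"

definition tadd :: "('m, 'n::finite) tvector \<Rightarrow> ('m, 'n) tvector \<Rightarrow> ('m, 'n) tvector" where
  "tadd u v = (\<lambda>c. u c + v c)"

definition tscale :: "real \<Rightarrow> ('m, 'n::finite) tvector \<Rightarrow> ('m, 'n) tvector" where
  "tscale a v = (\<lambda>c. a *\<^sub>R v c)"

text \<open>The tangent vector \<open>y\<^sup>i \<partial>/\<partial>x\<^sup>i\<close> at \<open>p\<close>, for the coordinates \<open>x\<^sup>i\<close> of the chart \<open>c\<close>.\<close>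

definition tvec :: "('m, 'n::finite) chart set \<Rightarrow> ('m, 'n) chart \<Rightarrow> 'm \<Rightarrow> real^'n \<Rightarrow> ('m, 'n) tvector" where
  "tvec A c p y = (\<lambda>d. if d \<in> A \<and> p \<in> dom_of d
     then frechet_derivative (trans_map c d) (at (coord c p)) y else 0)"

text \<open>Real functions on \<open>TM\<close> or on the slit tangent bundle \<open>N\<close> are curried. Smoothness on \<open>N\<close> is
  smoothness in the natural coordinates \<open>(x, y)\<close>.\<close>

definition smooth_on_slit :: "('m, 'n::finite) chart set \<Rightarrow> ('m \<Rightarrow> ('m, 'n) tvector \<Rightarrow> real) \<Rightarrow> bool" where
  "smooth_on_slit A f \<longleftrightarrow>
     (\<forall>c\<in>A. smooth_on (img_of c \<times> (UNIV - {0}))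
        (\<lambda>(x, y). f (point c x) (tvec A c (point c x) y)))"

definition riemannian_metric ::
  "'m topology \<Rightarrow> ('m, 'n::finite) chart set \<Rightarrow> ('m \<Rightarrow> ('m, 'n) tvector \<Rightarrow> ('m, 'n) tvector \<Rightarrow> real) \<Rightarrow> bool" where
  "riemannian_metric X A h \<longleftrightarrow>
     (\<forall>p\<in>topspace X. \<forall>u\<in>tangent_space A p. \<forall>v\<in>tangent_space A p.
        h p u v = h p v u \<and>
        (\<forall>w\<in>tangent_space A p. h p (tadd u v) w = h p u w + h p v w) \<and>
        (\<forall>a. h p (tscale a u) v = a * h p u v)) \<and>
     (\<forall>p\<in>topspace X. \<forall>u\<in>tangent_space A p. u \<noteq> tzero \<longrightarrow> h p u u > 0) \<and>
     (\<forall>c\<in>A. \<forall>i j. smooth_on (img_of c)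
        (\<lambda>x. h (point c x) (tvec A c (point c x) (axis i 1)) (tvec A c (point c x) (axis j 1))))"

definition finsler_coord ::
  "('m, 'n::finite) chart set \<Rightarrow> ('m \<Rightarrow> ('m, 'n) tvector \<Rightarrow> real) \<Rightarrow> ('m, 'n) chart \<Rightarrow> 'm \<Rightarrow> real^'n \<Rightarrow> real" where
  "finsler_coord A F c p y = F p (tvec A c p y)"

definition fundamental_tensor ::
  "('m, 'n::finite) chart set \<Rightarrow> ('m \<Rightarrow> ('m, 'n) tvector \<Rightarrow> real) \<Rightarrow> ('m, 'n) chart \<Rightarrow> 'm \<Rightarrow> real^'n \<Rightarrow> real^'n^'n" where
  "fundamental_tensor A F c p y =
     (\<chi> i j. 1/2 * partial i (partial j (\<lambda>z. (finsler_coord A F c p z)\<^sup>2)) y)"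

definition finsler_space ::
  "'m topology \<Rightarrow> ('m, 'n::finite) chart set \<Rightarrow> ('m \<Rightarrow> ('m, 'n) tvector \<Rightarrow> real) \<Rightarrow> bool" where
  "finsler_space X A F \<longleftrightarrow>
     smooth_manifold X A \<and>
     (\<forall>p\<in>topspace X. \<forall>v\<in>tangent_space A p. F p v \<ge> 0) \<and>
     smooth_on_slit A F \<and>
     (\<forall>p\<in>topspace X. \<forall>v\<in>tangent_space A p. \<forall>a\<ge>0. F p (tscale a v) = a * F p v) \<and>
     (\<forall>c\<in>A. \<forall>p\<in>dom_of c. \<forall>y. y \<noteq> 0 \<longrightarrow>
        (\<forall>w. w \<noteq> 0 \<longrightarrow> w \<bullet> (fundamental_tensor A F c p y *v w) > 0))"

definition weight_function ::
  "'m topology \<Rightarrow> ('m, 'n::finite) chart set \<Rightarrow> ('m \<Rightarrow> ('m, 'n) tvector \<Rightarrow> real) \<Rightarrow> bool" where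
  "weight_function X A W \<longleftrightarrow>
     (\<forall>p\<in>topspace X. \<forall>v\<in>tangent_space A p. v \<noteq> tzero \<longrightarrow> W p v > 0) \<and>
     smooth_on_slit A W \<and>
     (\<forall>p\<in>topspace X. \<forall>v\<in>tangent_space A p. v \<noteq> tzero \<longrightarrow> (\<forall>a>0. W p (tscale a v) = W p v))"

text \<open>\<open>\<real>\<^sup>n\<^sup>-\<^sup>1\<close> is realised as the coordinate hyperplane \<open>u\<^sub>k = 0\<close> of \<open>\<real>\<^sup>n\<close> (this includes \<open>n = 1\<close>),
  with the Lebesgue measure in the remaining coordinates.\<close>

definition hyperplane :: "'n \<Rightarrow> (real^'n::finite) set" where
  "hyperplane k = {u. u $ k = 0}"

definition hyperproj :: "'n \<Rightarrow> real^'n::finite \<Rightarrow> real^'n" where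
  "hyperproj k u = (\<chi> i. if i = k then 0 else u $ i)"

definition hyperplane_measure :: "'n \<Rightarrow> (real^'n::finite) measure" where
  "hyperplane_measure k =
     distr (Pi\<^sub>M (UNIV - {k}) (\<lambda>_. lborel)) borel (\<lambda>z. \<chi> i. if i = k then 0 else z i)"

text \<open>Local parametrisations of \<open>S\<close>: smooth immersions of an open \<open>V \<subseteq> \<real>\<^sup>n\<^sup>-\<^sup>1\<close> that are
  homeomorphisms onto an open subset of \<open>S\<close>. A map on \<open>V\<close> is extended to be constant in the
  direction of the \<open>k\<close>-th axis in order to differentiate it.\<close>

definition local_param :: "(real^'n::finite) set \<Rightarrow> 'n \<Rightarrow> (real^'n) set \<Rightarrow> (real^'n \<Rightarrow> real^'n) \<Rightarrow> bool" where
  "local_param S k V s \<longleftrightarrow>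
     openin (top_of_set (hyperplane k)) V \<and>
     openin (top_of_set S) (s ` V) \<and>
     homeomorphism V (s ` V) s (inv_into V s) \<and>
     smooth_on (hyperproj k -` V) (s \<circ> hyperproj k) \<and>
     (\<forall>u\<in>V. \<forall>w\<in>hyperplane k.
        frechet_derivative (s \<circ> hyperproj k) (at u) w = 0 \<longrightarrow> w = 0)"

text \<open>The \<open>n\<close>-form \<open>\<alpha>\<close> at \<open>y\<close> takes an \<open>n\<close>-tuple of vectors. The measure on the hypersurface \<open>S\<close>
  induced by the contraction of \<open>\<alpha>\<close> with the vector field \<open>l\<close>: inserting \<open>l\<close> in the \<open>k\<close>-th
  slot and the coordinate vectors \<open>\<partial>s/\<partial>u\<^sub>i\<close>, \<open>i \<noteq> k\<close>, in the other ones gives, up to sign, the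
  coefficient of the pullback of the contraction by \<open>s\<close>. As \<open>S\<close> is oriented so that the
  contracted form is positive on it, that coefficient is taken in absolute value.\<close>

definition hypersurface_measure ::
  "(real^'n::finite) set \<Rightarrow> (real^'n \<Rightarrow> ('n \<Rightarrow> real^'n) \<Rightarrow> real) \<Rightarrow> (real^'n \<Rightarrow> real^'n) \<Rightarrow> (real^'n) measure" where
  "hypersurface_measure S \<alpha> l = (THE \<mu>.
     space \<mu> = S \<and> sets \<mu> = sets (restrict_space borel S) \<and>
     (\<forall>k V s. local_param S k V s \<longrightarrow>
        (\<forall>B\<in>sets \<mu>. B \<subseteq> s ` V \<longrightarrow>
           emeasure \<mu> B =
             (\<integral>\<^sup>+ u. indicator V u * indicator B (s u) *
                ennreal \<bar>\<alpha> (s u) ((\<lambda>i. partial i (s \<circ> hyperproj k) u)(k := l (s u)))\<bar>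
              \<partial>hyperplane_measure k))))"

definition indicatrix ::
  "('m, 'n::finite) chart set \<Rightarrow> ('m \<Rightarrow> ('m, 'n) tvector \<Rightarrow> real) \<Rightarrow> ('m, 'n) chart \<Rightarrow> 'm \<Rightarrow> (real^'n) set" where
  "indicatrix A F c p = {y. finsler_coord A F c p y = 1}"

text \<open>\<open>\<surd>(det g) dy\<^sup>1/F \<and> \<dots> \<and> dy\<^sup>n/F\<close>, evaluated on \<open>w\<^sub>1, \<dots>, w\<^sub>n\<close>.\<close>

definition fibre_form ::
  "('m, 'n::finite) chart set \<Rightarrow> ('m \<Rightarrow> ('m, 'n) tvector \<Rightarrow> real) \<Rightarrow> ('m, 'n) chart \<Rightarrow> 'm \<Rightarrow>
   real^'n \<Rightarrow> ('n \<Rightarrow> real^'n) \<Rightarrow> real" where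
  "fibre_form A F c p y w =
     sqrt (det (fundamental_tensor A F c p y)) * det (\<chi> i j. w j $ i / finsler_coord A F c p y)"

definition dvol ::
  "('m, 'n::finite) chart set \<Rightarrow> ('m \<Rightarrow> ('m, 'n) tvector \<Rightarrow> real) \<Rightarrow> ('m, 'n) chart \<Rightarrow> 'm \<Rightarrow> (real^'n) measure" where
  "dvol A F c p = hypersurface_measure (indicatrix A F c p) (fibre_form A F c p)
     (\<lambda>y. (1 / finsler_coord A F c p y) *\<^sub>R y)"

definition vol ::
  "('m, 'n::finite) chart set \<Rightarrow> ('m \<Rightarrow> ('m, 'n) tvector \<Rightarrow> real) \<Rightarrow> ('m \<Rightarrow> ('m, 'n) tvector \<Rightarrow> real) \<Rightarrow>
   ('m, 'n) chart \<Rightarrow> 'm \<Rightarrow> real" where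
  "vol A F W c p = (\<integral>y. W p (tvec A c p y) \<partial>dvol A F c p)"

definition average ::
  "('m, 'n::finite) chart set \<Rightarrow> ('m \<Rightarrow> ('m, 'n) tvector \<Rightarrow> real) \<Rightarrow> ('m \<Rightarrow> ('m, 'n) tvector \<Rightarrow> real) \<Rightarrow>
   ('m, 'n) chart \<Rightarrow> 'm \<Rightarrow> (real^'n \<Rightarrow> real) \<Rightarrow> real" where
  "average A F W c p f =
     1 / vol A F W c p * (\<integral>y. W p (tvec A c p y) * f y \<partial>dvol A F c p)"

definition averaged_metric ::
  "('m, 'n::finite) chart set \<Rightarrow> ('m \<Rightarrow> ('m, 'n) tvector \<Rightarrow> real) \<Rightarrow> ('m \<Rightarrow> ('m, 'n) tvector \<Rightarrow> real) \<Rightarrow>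
   ('m, 'n) chart \<Rightarrow> 'm \<Rightarrow> 'n \<Rightarrow> 'n \<Rightarrow> real" where
  "averaged_metric A F W c p i j =
     average A F W c p (\<lambda>y. fundamental_tensor A F c p y $ i $ j)"

end

theory Submission
  imports Defs
begin

text \<open>The functions \<open>h\<^sub>i\<^sub>j\<close> are to be smooth, symmetric, positive definite, and to transform as a tensor.
Symmetry and, as the weight is positive, definiteness are inherited pointwise from \<open>g\<^sub>i\<^sub>j\<close>; the
substance lies in smoothness and in independence of the chart, because the indicatrix, over which
one integrates, moves with the base point and with the chart. Both follow from one observation that
trades the indicatrix for a fixed domain of integration.

Fix a fibre, with Minkowski norm \<open>f\<close> and \<open>\<rho> = \<surd>(det g)\<close>, which is homogeneous of degree zero. The function
\<open>H = \<rho> / f^n\<close> is homogeneous of degree \<open>-n\<close>. In the polar coordinates \<open>y = e^r s(u)\<close>, where \<open>s\<close>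
parametrises the indicatrix, Lebesgue measure times \<open>H\<close> becomes \<open>dr\<close> times the contracted volume
form. Hence, for every \<open>a \<ge> 0\<close> on the fibre with \<open>\<integral> a(e^r y) dr = 1\<close> for all \<open>y \<noteq> 0\<close> and every \<open>q\<close> that is
homogeneous of degree zero, the integral of \<open>q\<close> over the indicatrix equals \<open>\<integral> q H a dy\<close>.
That the right-hand side is the same for all such radial densities \<open>a\<close> is a consequence of Fubini's
theorem and scaling alone (\<open>nn_integral_homogeneous_radial\<close>). It is applied to three densities:

  \<^item> The indicator of the shell \<open>1 \<le> f \<le> e\<close> makes polar coordinates give the prescribed
    coefficient in every local parametrisation (\<open>emeasure_\<mu>_local_param\<close>). As finitely many radial
    graphs over coordinate hyperplanes cover the indicatrix, the measure is the only one with this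
    property, and \<open>dvol\<close> is identified (\<open>hypersurface_measure_eq\<close>).

  \<^item> The tent function of \<open>ln \<bar>y\<bar>\<close> depends neither on \<open>f\<close> nor on the base point and has compact support
    away from the origin. With it, the average is an integral of a function that is smooth in \<open>(x, y)\<close>
    over a fixed compact set, and one may differentiate under the integral sign
    (\<open>smooth_on_integral_tent\<close>).

  \<^item> The tent function composed with a linear isomorphism \<open>L\<close> is again a radial density. If \<open>L\<close> is the
    derivative of a change of charts, then \<open>H\<close> picks up the factor \<open>\<bar>det L\<bar>\<close>, so the linear change of
    variables shows that the averages do not depend on the chart (\<open>fibre_integral_chart\<close>).

The remaining ingredients are Euler's relations for homogeneous functions, which turn positive
definiteness of \<open>g\<close> into \<open>f > 0\<close> off the origin, and the symmetry of second derivatives.\<close>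

section \<open>Calculus of smooth functions\<close>

lemma frechet_derivative_cong_open:
  assumes "open S" "x \<in> S" "\<And>y. y \<in> S \<Longrightarrow> f y = g y"
  shows "frechet_derivative f (at x) = frechet_derivative g (at x)"
proof -
  have "(f has_derivative D) (at x) \<longleftrightarrow> (g has_derivative D) (at x)" for D
    using assms has_derivative_transform_within_open[of f D x UNIV S g]
      has_derivative_transform_within_open[of g D x UNIV S f] by auto
  then show ?thesis unfolding frechet_derivative_def by simp
qed

lemma differentiable_cong_open:
  assumes "open S" "x \<in> S" "\<And>y. y \<in> S \<Longrightarrow> f y = g y"
  shows "f differentiable (at x) \<longleftrightarrow> g differentiable (at x)"
  using assms has_derivative_transform_within_open[of f _ x UNIV S g]
    has_derivative_transform_within_open[of g _ x UNIV S f] unfolding differentiable_def by auto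

lemma frechet_derivative_eq:
  "(f has_derivative D) (at x) \<Longrightarrow> frechet_derivative f (at x) = D"
  by (simp add: frechet_derivative_at[symmetric])

text \<open>The recursion equation would let the simplifier unfold the order of differentiability; the
  rules \<open>Ck_on_SucI\<close> and \<open>Ck_on_SucD\<close> below replace it.\<close>

declare Ck_on.simps(2) [simp del]

text \<open>As \<open>S\<close> is open, equality on \<open>S\<close> passes to the derivatives at points of \<open>S\<close>, which is what the
  recursion needs.\<close>

lemma Ck_on_cong:
  assumes "open S" "\<And>x. x \<in> S \<Longrightarrow> f x = g x"
  shows "Ck_on k S f \<longleftrightarrow> Ck_on k S g"
  using assms(2)
proof (induction k arbitrary: f g)
  case 0
  then show ?case by (auto cong: continuous_on_cong)
next
  case (Suc k)
  have "Ck_on k S (\<lambda>x. frechet_derivative f (at x) v) \<longleftrightarrow> Ck_on k S (\<lambda>x. frechet_derivative g (at x) v)" for v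
    by (rule Suc.IH) (metis frechet_derivative_cong_open[OF assms(1)] Suc.prems)
  moreover have "f differentiable (at x) \<longleftrightarrow> g differentiable (at x)" if "x \<in> S" for x
    using differentiable_cong_open[OF assms(1) that] Suc.prems by blast
  ultimately show ?case by (simp add: Ck_on.simps(2))
qed

lemma Ck_on_SucI:
  assumes "open S" "\<And>x. x \<in> S \<Longrightarrow> (f has_derivative D x) (at x)"
    and "\<And>v. Ck_on k S (\<lambda>x. D x v)"
  shows "Ck_on (Suc k) S f"
proof -
  have "Ck_on k S (\<lambda>x. frechet_derivative f (at x) v) \<longleftrightarrow> Ck_on k S (\<lambda>x. D x v)" for v
    by (rule Ck_on_cong[OF assms(1)]) (simp add: frechet_derivative_eq[OF assms(2)])
  then show ?thesis using assms by (auto simp: differentiable_def Ck_on.simps(2))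
qed

lemma Ck_on_SucD:
  assumes "Ck_on (Suc k) S f"
  shows "\<And>x. x \<in> S \<Longrightarrow> (f has_derivative frechet_derivative f (at x)) (at x)"
    "\<And>v. Ck_on k S (\<lambda>x. frechet_derivative f (at x) v)"
  using assms by (auto simp: Ck_on.simps(2) frechet_derivative_works)

lemma Ck_on_Suc_imp: "Ck_on (Suc k) S f \<Longrightarrow> Ck_on k S f"
proof (induction k arbitrary: f)
  case 0
  then show ?case
    by (auto simp: Ck_on.simps(2) intro!: continuous_at_imp_continuous_on differentiable_imp_continuous_within)
next
  case (Suc k)
  then show ?case by (metis Ck_on.simps(2))
qed

lemma Ck_on_const: "open S \<Longrightarrow> Ck_on k S (\<lambda>x. c)"
  by (induction k arbitrary: c) (auto intro!: Ck_on_SucI[where D="\<lambda>_ _. 0"])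

lemma Ck_on_linear: "open S \<Longrightarrow> bounded_linear L \<Longrightarrow> Ck_on k S L"
  by (cases k) (auto intro!: Ck_on_SucI[where D="\<lambda>_. L"] Ck_on_const bounded_linear_imp_has_derivative
      linear_continuous_on)

lemma Ck_on_compose_linear:
  assumes "open S" "bounded_linear L"
  shows "Ck_on k S f \<Longrightarrow> Ck_on k S (\<lambda>x. L (f x))"
proof (induction k arbitrary: f)
  case 0
  then show ?case using bounded_linear.continuous_on[OF assms(2)] by auto
next
  case (Suc k)
  show ?case
    by (rule Ck_on_SucI[OF assms(1) bounded_linear.has_derivative[OF assms(2) Ck_on_SucD(1)[OF Suc.prems]]];
        (assumption | intro Suc.IH Ck_on_SucD(2)[OF Suc.prems]))
qed

lemma Ck_on_add:
  assumes "open S"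
  shows "Ck_on k S f \<Longrightarrow> Ck_on k S g \<Longrightarrow> Ck_on k S (\<lambda>x. f x + g x)"
proof (induction k arbitrary: f g)
  case 0
  then show ?case by (auto intro!: continuous_intros)
next
  case (Suc k)
  show ?case
    by (rule Ck_on_SucI[OF assms(1) has_derivative_add[OF Ck_on_SucD(1)[OF Suc.prems(1)] Ck_on_SucD(1)[OF Suc.prems(2)]]];
        (assumption | intro Suc.IH Ck_on_SucD(2)[OF Suc.prems(1)] Ck_on_SucD(2)[OF Suc.prems(2)]))
qed

lemma Ck_on_sum:
  assumes "open S" "\<And>i. i \<in> I \<Longrightarrow> Ck_on k S (f i)"
  shows "Ck_on k S (\<lambda>x. \<Sum>i\<in>I. f i x)"
  using assms(2) by (induction I rule: infinite_finite_induct) (auto intro!: Ck_on_const Ck_on_add assms(1))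

text \<open>The closure properties of \<open>Ck_on\<close> share one pattern: the derivative is again an expression of the kind
  under consideration, built from functions whose order is lower by one, so induction on the order applies.\<close>

lemma Ck_on_bilinear:
  assumes "bounded_bilinear B" "open S"
  shows "Ck_on k S f \<Longrightarrow> Ck_on k S g \<Longrightarrow> Ck_on k S (\<lambda>x. B (f x) (g x))"
proof (induction k arbitrary: f g)
  case 0
  then show ?case using bounded_bilinear.continuous_on[OF assms(1)] by auto
next
  case (Suc k)
  show ?case
    by (rule Ck_on_SucI[OF assms(2) bounded_bilinear.FDERIV[OF assms(1)
            Ck_on_SucD(1)[OF Suc.prems(1)] Ck_on_SucD(1)[OF Suc.prems(2)]]];
        (assumption | intro Ck_on_add[OF assms(2)] Suc.IH Ck_on_Suc_imp[OF Suc.prems(1)] Ck_on_Suc_imp[OF Suc.prems(2)]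
        Ck_on_SucD(2)[OF Suc.prems(1)] Ck_on_SucD(2)[OF Suc.prems(2)]))
qed

lemmas Ck_on_mult = Ck_on_bilinear[OF bounded_bilinear_mult]
lemmas Ck_on_scaleR = Ck_on_bilinear[OF bounded_bilinear_scaleR]

lemma Ck_on_prod:
  fixes f :: "'i \<Rightarrow> 'a::euclidean_space \<Rightarrow> real"
  assumes "open S" "\<And>i. i \<in> I \<Longrightarrow> Ck_on k S (f i)"
  shows "Ck_on k S (\<lambda>x. \<Prod>i\<in>I. f i x)"
  using assms(2) by (induction I rule: infinite_finite_induct) (auto intro!: Ck_on_const Ck_on_mult assms(1))

lemma Ck_on_power:
  fixes f :: "'a::euclidean_space \<Rightarrow> real"
  assumes "open S" "Ck_on k S f"
  shows "Ck_on k S (\<lambda>x. f x ^ m)"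
  using Ck_on_prod[of S "{..<m}" k "\<lambda>_. f"] assms by simp

lemma Ck_on_inverse:
  fixes f :: "'a::euclidean_space \<Rightarrow> real"
  assumes "open S" "\<And>x. x \<in> S \<Longrightarrow> f x \<noteq> 0"
  shows "Ck_on k S f \<Longrightarrow> Ck_on k S (\<lambda>x. inverse (f x))"
proof (induction k)
  case 0
  then show ?case using assms by (auto intro!: continuous_intros)
next
  case (Suc k)
  have *: "((\<lambda>x. inverse (f x)) has_derivative
      (\<lambda>v. - 1 * (inverse (f x) * frechet_derivative f (at x) v * inverse (f x)))) (at x)" if "x \<in> S" for x
    using Deriv.has_derivative_inverse[OF assms(2)[OF that] Ck_on_SucD(1)[OF Suc.prems that]] by simp
  show ?case
    by (rule Ck_on_SucI[OF assms(1) *];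
        (assumption | intro Ck_on_mult[OF assms(1)] Ck_on_const[OF assms(1)] Suc.IH Ck_on_Suc_imp[OF Suc.prems] Ck_on_SucD(2)[OF Suc.prems]))
qed

lemma Ck_on_divide:
  fixes f g :: "'a::euclidean_space \<Rightarrow> real"
  assumes "open S" "\<And>x. x \<in> S \<Longrightarrow> g x \<noteq> 0" "Ck_on k S f" "Ck_on k S g"
  shows "Ck_on k S (\<lambda>x. f x / g x)"
  unfolding divide_inverse by (intro Ck_on_mult Ck_on_inverse assms)

lemma Ck_on_sqrt:
  fixes f :: "'a::euclidean_space \<Rightarrow> real"
  assumes "open S" "\<And>x. x \<in> S \<Longrightarrow> f x > 0"
  shows "Ck_on k S f \<Longrightarrow> Ck_on k S (\<lambda>x. sqrt (f x))"
proof (induction k)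
  case 0
  then show ?case using assms by (auto intro!: continuous_intros)
next
  case (Suc k)
  have *: "((\<lambda>x. sqrt (f x)) has_derivative
      (\<lambda>v. frechet_derivative f (at x) v * (inverse (sqrt (f x)) * (1/2)))) (at x)" if "x \<in> S" for x
    using has_derivative_real_sqrt[OF assms(2)[OF that] Ck_on_SucD(1)[OF Suc.prems that]]
    by (simp add: field_simps)
  show ?case
    by (rule Ck_on_SucI[OF assms(1) *];
        (assumption | intro Ck_on_mult[OF assms(1)] Ck_on_const[OF assms(1)] Ck_on_inverse[OF assms(1)] Suc.IH
        Ck_on_Suc_imp[OF Suc.prems] Ck_on_SucD(2)[OF Suc.prems], (use assms(2) in force)?))
qed

text \<open>The chain rule writes the derivative of \<open>g \<circ> f\<close> as a finite sum, over a basis of the middle space,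
  of products of components of the derivative of \<open>f\<close> with partial derivatives of \<open>g\<close> at \<open>f x\<close>; the induction
  hypothesis applies to the latter because it is stated for all outer functions.\<close>

lemma Ck_on_compose:
  fixes f :: "'a::euclidean_space \<Rightarrow> 'b::euclidean_space" and g :: "'b \<Rightarrow> 'c::real_normed_vector"
  assumes "open S" "open T" "f ` S \<subseteq> T"
  shows "Ck_on k S f \<Longrightarrow> Ck_on k T g \<Longrightarrow> Ck_on k S (\<lambda>x. g (f x))"
proof (induction k arbitrary: g)
  case 0
  then show ?case using assms continuous_on_compose2 by auto
next
  case (Suc k)
  let ?Df = "\<lambda>x. frechet_derivative f (at x)" and ?Dg = "\<lambda>y. frechet_derivative g (at y)"
  have *: "((\<lambda>x. g (f x)) has_derivative (\<lambda>v. \<Sum>b\<in>Basis. (?Df x v \<bullet> b) *\<^sub>R ?Dg (f x) b)) (at x)"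
    if "x \<in> S" for x
  proof -
    have fx: "f x \<in> T" using assms that by auto
    have D: "(g has_derivative ?Dg (f x)) (at (f x))" by (rule Ck_on_SucD(1)[OF Suc.prems(2) fx])
    have "?Dg (f x) w = (\<Sum>b\<in>Basis. (w \<bullet> b) *\<^sub>R ?Dg (f x) b)" for w
    proof -
      have "linear (?Dg (f x))" using D has_derivative_linear by blast
      have "?Dg (f x) w = ?Dg (f x) (\<Sum>b\<in>Basis. (w \<bullet> b) *\<^sub>R b)"
        by (simp only: euclidean_representation)
      also have "\<dots> = (\<Sum>b\<in>Basis. (w \<bullet> b) *\<^sub>R ?Dg (f x) b)"
        by (simp only: linear_sum[OF \<open>linear (?Dg (f x))\<close>] linear_scale[OF \<open>linear (?Dg (f x))\<close>])
      finally show ?thesis .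
    qed
    then have "(\<lambda>v. ?Dg (f x) (?Df x v)) = (\<lambda>v. \<Sum>b\<in>Basis. (?Df x v \<bullet> b) *\<^sub>R ?Dg (f x) b)"
      by blast
    then show ?thesis
      using has_derivative_compose[OF Ck_on_SucD(1)[OF Suc.prems(1) that] D] by (simp only:)
  qed
  have **: "Ck_on k S (\<lambda>x. ?Dg (f x) b)" for b
    by (rule Suc.IH[OF Ck_on_Suc_imp[OF Suc.prems(1)] Ck_on_SucD(2)[OF Suc.prems(2)]])
  show ?case
    by (rule Ck_on_SucI[OF assms(1) *];
        (assumption | intro Ck_on_sum[OF assms(1)] Ck_on_scaleR[OF assms(1)] ** Ck_on_compose_linear[OF assms(1) bounded_linear_inner_left]
         Ck_on_SucD(2)[OF Suc.prems(1)]))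
qed

lemma smooth_on_open: "smooth_on S f \<Longrightarrow> open S"
  by (simp add: smooth_on_def)

lemma smooth_on_continuous: "smooth_on S f \<Longrightarrow> continuous_on S f"
  unfolding smooth_on_def using Ck_on.simps(1) by blast

lemma smooth_on_has_derivative:
  "smooth_on S f \<Longrightarrow> x \<in> S \<Longrightarrow> (f has_derivative frechet_derivative f (at x)) (at x)"
  unfolding smooth_on_def using Ck_on_SucD(1)[of _ S f x] by blast

lemma smooth_on_derivative: "smooth_on S f \<Longrightarrow> smooth_on S (\<lambda>x. frechet_derivative f (at x) v)"
  unfolding smooth_on_def using Ck_on_SucD(2)[of _ S f v] by blast

lemma smooth_on_cong: "(\<And>x. x \<in> S \<Longrightarrow> f x = g x) \<Longrightarrow> smooth_on S f \<longleftrightarrow> smooth_on S g"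
  unfolding smooth_on_def using Ck_on_cong[of S f g] by blast

lemma smooth_on_const: "open S \<Longrightarrow> smooth_on S (\<lambda>x. c)"
  by (simp add: smooth_on_def Ck_on_const)

lemma smooth_on_linear: "open S \<Longrightarrow> bounded_linear L \<Longrightarrow> smooth_on S L"
  by (simp add: smooth_on_def Ck_on_linear)

lemma smooth_on_add: "smooth_on S f \<Longrightarrow> smooth_on S g \<Longrightarrow> smooth_on S (\<lambda>x. f x + g x)"
  by (simp add: smooth_on_def Ck_on_add)

lemma smooth_on_sum:
  "open S \<Longrightarrow> (\<And>i. i \<in> I \<Longrightarrow> smooth_on S (f i)) \<Longrightarrow> smooth_on S (\<lambda>x. \<Sum>i\<in>I. f i x)"
  by (simp add: smooth_on_def Ck_on_sum)

lemma smooth_on_prod: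
  fixes f :: "'i \<Rightarrow> 'a::euclidean_space \<Rightarrow> real"
  shows "open S \<Longrightarrow> (\<And>i. i \<in> I \<Longrightarrow> smooth_on S (f i)) \<Longrightarrow> smooth_on S (\<lambda>x. \<Prod>i\<in>I. f i x)"
  by (simp add: smooth_on_def Ck_on_prod)

lemma smooth_on_mult:
  fixes f g :: "'a::euclidean_space \<Rightarrow> real"
  shows "smooth_on S f \<Longrightarrow> smooth_on S g \<Longrightarrow> smooth_on S (\<lambda>x. f x * g x)"
  by (simp add: smooth_on_def Ck_on_mult)

lemma smooth_on_power:
  fixes f :: "'a::euclidean_space \<Rightarrow> real"
  shows "smooth_on S f \<Longrightarrow> smooth_on S (\<lambda>x. f x ^ m)"
  by (simp add: smooth_on_def Ck_on_power)

lemma smooth_on_scaleR: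
  "smooth_on S f \<Longrightarrow> smooth_on S g \<Longrightarrow> smooth_on S (\<lambda>x. f x *\<^sub>R g x)"
  by (simp add: smooth_on_def Ck_on_scaleR)

lemma smooth_on_divide:
  fixes f g :: "'a::euclidean_space \<Rightarrow> real"
  shows "smooth_on S f \<Longrightarrow> smooth_on S g \<Longrightarrow> (\<And>x. x \<in> S \<Longrightarrow> g x \<noteq> 0) \<Longrightarrow> smooth_on S (\<lambda>x. f x / g x)"
  by (simp add: smooth_on_def Ck_on_divide)

lemma smooth_on_sqrt:
  fixes f :: "'a::euclidean_space \<Rightarrow> real"
  shows "smooth_on S f \<Longrightarrow> (\<And>x. x \<in> S \<Longrightarrow> f x > 0) \<Longrightarrow> smooth_on S (\<lambda>x. sqrt (f x))"
  by (simp add: smooth_on_def Ck_on_sqrt)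

lemma smooth_on_compose:
  fixes f :: "'a::euclidean_space \<Rightarrow> 'b::euclidean_space"
  shows "smooth_on S f \<Longrightarrow> smooth_on T g \<Longrightarrow> f ` S \<subseteq> T \<Longrightarrow> smooth_on S (\<lambda>x. g (f x))"
  by (simp add: smooth_on_def Ck_on_compose[of S T f _ g])

lemma smooth_on_det:
  fixes M :: "'a::euclidean_space \<Rightarrow> real^'n^'n"
  assumes "open S" "\<And>i j. smooth_on S (\<lambda>x. M x $ i $ j)"
  shows "smooth_on S (\<lambda>x. det (M x))"
  unfolding det_def
  by (intro smooth_on_sum smooth_on_mult smooth_on_prod smooth_on_const assms)

section \<open>Change of variables for integrals of nonnegative functions\<close>

lemma borel_measurable_vec_lambda:
  assumes "\<And>i. (\<lambda>x. f x i) \<in> borel_measurable M"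
  shows "(\<lambda>x. (\<chi> i. f x i) :: real^'n::finite) \<in> borel_measurable M"
  unfolding borel_measurable_euclidean_space[where f="\<lambda>x. \<chi> i. f x i"]
  using assms by (auto simp: Basis_vec_def inner_axis)

lemma measurable_vec_nth [measurable]: "(\<lambda>x :: real^'n::finite. x $ i) \<in> borel_measurable borel"
  by (intro borel_measurable_continuous_onI continuous_intros)

text \<open>The theorem \<open>has_absolute_integral_change_of_variables\<close> concerns well-ordered index types. A copy of
  a finite type, ordered through an injection into the natural numbers, carries it over to all finite
  index types.\<close>

typedef 'n wo = "UNIV :: 'n set" morphisms of_wo to_wo by simp

lemma of_wo_inverses [simp]: "to_wo (of_wo i) = i" "of_wo (to_wo j) = j"
  by (simp_all add: of_wo_inverse to_wo_inverse)

lemma bij_of_wo: "bij of_wo" and bij_to_wo: "bij to_wo"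
  by (rule o_bij[of to_wo of_wo]; simp add: fun_eq_iff) (rule o_bij[of of_wo to_wo]; simp add: fun_eq_iff)

instance wo :: (finite) finite
proof
  show "finite (UNIV :: 'a wo set)"
    using bij_of_wo finite_imageD[of of_wo UNIV] by (metis bij_def finite)
qed

instantiation wo :: (finite) wellorder
begin

definition "i \<le> j \<longleftrightarrow> to_nat (of_wo i) \<le> to_nat (of_wo j)"
definition "i < j \<longleftrightarrow> to_nat (of_wo i) < to_nat (of_wo j)"

instance
proof
  fix P :: "'a wo \<Rightarrow> bool" and a
  assume *: "\<And>x. (\<And>y. y < x \<Longrightarrow> P y) \<Longrightarrow> P x"
  show "P a"
    by (induction a rule: measure_induct_rule[of "\<lambda>i. to_nat (of_wo i)"]) (auto intro: * simp: less_wo_def)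
qed (auto simp: less_eq_wo_def less_wo_def of_wo_inject)

end

definition vec_wo :: "real^'n \<Rightarrow> real^('n wo)" where "vec_wo y = (\<chi> i. y $ of_wo i)"
definition vec_of_wo :: "real^('n wo) \<Rightarrow> real^'n" where "vec_of_wo y = (\<chi> i. y $ to_wo i)"

lemma vec_wo_inverses [simp]: "vec_of_wo (vec_wo y) = y" "vec_wo (vec_of_wo z) = z"
  by (simp_all add: vec_wo_def vec_of_wo_def vec_eq_iff)

lemma linear_vec_wo: "linear vec_wo" and linear_vec_of_wo: "linear vec_of_wo"
  by (auto simp: vec_wo_def vec_of_wo_def vec_eq_iff intro!: linearI)

lemma bounded_linear_vec_wo:
  "bounded_linear (vec_wo :: real^'n::finite \<Rightarrow> _)"
  "bounded_linear (vec_of_wo :: _ \<Rightarrow> real^'n::finite)"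
  using linear_vec_wo linear_vec_of_wo by (auto simp: linear_conv_bounded_linear)

lemma measurable_vec_wo [measurable]:
  "(vec_wo :: real^'n::finite \<Rightarrow> _) \<in> borel_measurable borel"
  "(vec_of_wo :: _ \<Rightarrow> real^'n::finite) \<in> borel_measurable borel"
  using bounded_linear_vec_wo by (auto intro!: borel_measurable_continuous_onI linear_continuous_on)

lemma prod_Basis_vec:
  fixes f :: "real^'n::finite \<Rightarrow> 'a::comm_monoid_mult"
  shows "(\<Prod>b\<in>Basis. f b) = (\<Prod>i\<in>UNIV. f (axis i 1))"
proof -
  have "(Basis :: (real^'n) set) = (\<lambda>i. axis i 1) ` UNIV" by (auto simp: Basis_vec_def)
  moreover have "inj (\<lambda>i::'n. axis i (1::real))" by (auto simp: inj_on_def axis_eq_axis)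
  ultimately show ?thesis using prod.reindex[of "\<lambda>i::'n. axis i (1::real)" UNIV f] by (simp add: comp_def)
qed

lemma box_vec: "box l u = {x::real^'n::finite. \<forall>i. l $ i < x $ i \<and> x $ i < u $ i}"
  by (auto simp: box_def Basis_vec_def inner_axis)

lemma lborel_vec_wo: "distr lborel borel (vec_of_wo :: _ \<Rightarrow> real^'n::finite) = lborel"
proof (rule lborel_eqI[symmetric])
  fix l u :: "real^'n"
  assume le: "\<And>b. b \<in> Basis \<Longrightarrow> l \<bullet> b \<le> u \<bullet> b"
  have lei: "l $ i \<le> u $ i" for i using le[of "axis i 1"] by (simp add: inner_axis axis_in_Basis_iff)
  have "emeasure (distr lborel borel vec_of_wo) (box l u) = emeasure lborel (vec_of_wo -` box l u)"
    by (subst emeasure_distr) auto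
  also have "vec_of_wo -` box l u = box (vec_wo l) (vec_wo u)"
    by (auto simp: box_vec vec_of_wo_def vec_wo_def) (metis of_wo_inverses)+
  also have "emeasure lborel \<dots> = (\<Prod>b\<in>Basis. (vec_wo u - vec_wo l) \<bullet> b)"
    by (rule emeasure_lborel_box) (auto simp: Basis_vec_def inner_axis vec_wo_def lei)
  also have "(\<Prod>b\<in>Basis. (vec_wo u - vec_wo l) \<bullet> b) = (\<Prod>i\<in>UNIV. u $ of_wo i - l $ of_wo i)"
    by (simp add: prod_Basis_vec inner_axis vec_wo_def)
  also have "\<dots> = (\<Prod>i\<in>UNIV. u $ i - l $ i)"
    by (rule prod.reindex_bij_betw[OF bij_of_wo])
  also have "\<dots> = (\<Prod>b\<in>Basis. (u - l) \<bullet> b)"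
    by (simp add: prod_Basis_vec inner_axis)
  finally show "emeasure (distr lborel borel vec_of_wo) (box l u) = (\<Prod>b\<in>Basis. (u - l) \<bullet> b)" .
qed simp

lemma nn_integral_vec_wo:
  fixes g :: "real^'n::finite \<Rightarrow> ennreal"
  assumes [measurable]: "g \<in> borel_measurable borel"
  shows "(\<integral>\<^sup>+y. g y \<partial>lborel) = (\<integral>\<^sup>+z. g (vec_of_wo z) \<partial>lborel)"
  by (subst lborel_vec_wo[symmetric], subst nn_integral_distr) auto

lemma sign_conj_wo:
  fixes p :: "'n \<Rightarrow> 'n"
  assumes "permutation p"
  shows "sign (to_wo \<circ> p \<circ> of_wo) = sign p"
proof -
  have sw: "swapidseq n (to_wo \<circ> p \<circ> of_wo)" if "swapidseq n p" for n
    using that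
  proof (induction n p rule: swapidseq.induct)
    case id
    have "to_wo \<circ> id \<circ> of_wo = (id :: 'n wo \<Rightarrow> 'n wo)" by (rule ext) simp
    then show ?case by (simp only: swapidseq.id)
  next
    case (comp_Suc n p a b)
    have "to_wo \<circ> (Transposition.transpose a b \<circ> p) \<circ> of_wo = Transposition.transpose (to_wo a) (to_wo b) \<circ> (to_wo \<circ> p \<circ> of_wo)"
      by (auto simp: fun_eq_iff Transposition.transpose_def to_wo_inject)
    moreover have "to_wo a \<noteq> to_wo b" using comp_Suc by (simp add: to_wo_inject)
    ultimately show ?case using swapidseq.comp_Suc[OF comp_Suc.IH] by metis
  qed
  obtain n where "swapidseq n p" using assms by (auto simp: permutation_def)
  then have "evenperm p = even n" "evenperm (to_wo \<circ> p \<circ> of_wo) = even n"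
    using evenperm_unique[OF _ refl] sw by blast+
  then show ?thesis by (simp add: sign_def)
qed

text \<open>Permutations of the copy are the conjugates of permutations of the original index type, and
  conjugation preserves the sign.\<close>

lemma det_wo:
  fixes M :: "real^'n::finite^'n"
  shows "det (\<chi> i j. M $ of_wo i $ of_wo j) = det M"
proof -
  let ?c = "\<lambda>p. to_wo \<circ> p \<circ> of_wo"
  have "bij_betw ?c {p. p permutes (UNIV::'n set)} {p. p permutes (UNIV::'n wo set)}"
  proof (rule bij_betw_byWitness[where f'="\<lambda>q. of_wo \<circ> q \<circ> to_wo"])
    show "?c ` {p. p permutes (UNIV::'n set)} \<subseteq> {p. p permutes (UNIV::'n wo set)}"
      using bij_of_wo bij_to_wo by (auto intro!: bij_imp_permutes bij_comp dest: permutes_bij)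
    show "(\<lambda>q. of_wo \<circ> q \<circ> to_wo) ` {p. p permutes (UNIV::'n wo set)} \<subseteq> {p. p permutes (UNIV::'n set)}"
      using bij_of_wo bij_to_wo by (auto intro!: bij_imp_permutes bij_comp dest: permutes_bij)
  qed (auto simp: fun_eq_iff)
  then have "det (\<chi> i j. M $ of_wo i $ of_wo j) =
      (\<Sum>p | p permutes (UNIV::'n set). of_int (sign (?c p)) * (\<Prod>i\<in>UNIV. M $ of_wo i $ of_wo (?c p i)))"
    unfolding det_def by (subst sum.reindex_bij_betw[symmetric]) auto
  also have "\<dots> = (\<Sum>p | p permutes (UNIV::'n set). of_int (sign p) * (\<Prod>i\<in>UNIV. M $ i $ p i))"
  proof (rule sum.cong[OF refl])
    fix p assume "p \<in> {p. p permutes (UNIV::'n set)}"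
    then have "sign (?c p) = sign p"
      by (intro sign_conj_wo) (auto simp: permutation_permutes)
    moreover have "(\<Prod>i\<in>UNIV. M $ of_wo i $ of_wo (?c p i)) = (\<Prod>i\<in>UNIV. M $ i $ p i)"
      using prod.reindex_bij_betw[OF bij_of_wo, of "\<lambda>i. M $ i $ p i"] by simp
    ultimately show "of_int (sign (?c p)) * (\<Prod>i\<in>UNIV. M $ of_wo i $ of_wo (?c p i)) =
        of_int (sign p) * (\<Prod>i\<in>UNIV. M $ i $ p i)" by simp
  qed
  finally show ?thesis by (simp add: det_def)
qed

text \<open>The integrability of \<open>f\<close> lets the theorem on absolutely integrable functions apply. Its integrands
  are vector valued, hence the detour through \<open>real^1\<close>.\<close>

lemma nn_integral_change_of_variables_wellorder:
  fixes g :: "real^'m::{finite,wellorder} \<Rightarrow> real^'m::_" and f :: "real^'m::_ \<Rightarrow> real"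
  assumes S: "open S" and der: "\<And>x. x \<in> S \<Longrightarrow> (g has_derivative g' x) (at x)" and inj: "inj_on g S"
    and f: "integrable lborel f" "\<And>y. 0 \<le> f y"
  shows "(\<integral>\<^sup>+y. ennreal (f y) * indicator (g ` S) y \<partial>lborel) =
    (\<integral>\<^sup>+x. ennreal (\<bar>det (matrix (g' x))\<bar> * f (g x)) * indicator S x \<partial>lborel)"
proof -
  have der': "(g has_derivative g' x) (at x within S)" if "x \<in> S" for x
    using der[OF that] by (rule has_derivative_at_withinI)
  have "continuous_on S g"
    by (intro continuous_at_imp_continuous_on ballI has_derivative_continuous[OF der])
  then have "open (g ` S)" by (rule invariance_of_domain[OF _ S inj])
  have "integrable lebesgue f" using f by (simp add: integrable_completion borel_measurable_integrable)
  then have 1: "f absolutely_integrable_on (g ` S)"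
    using \<open>open (g ` S)\<close> set_integrable_subset[of lebesgue UNIV f "g ` S"] by (auto simp: set_integrable_def)
  let ?v = "\<lambda>y. vec (f y) :: real^1"
  have vec1: "?v = (\<lambda>y. f y *\<^sub>R vec 1)" by (auto simp: fun_eq_iff vec_eq_iff)
  have 2: "?v absolutely_integrable_on (g ` S)"
    unfolding vec1 by (rule absolutely_integrable_scaleR_right) (rule 1)
  have A: "(\<lambda>x. \<bar>det (matrix (g' x))\<bar> *\<^sub>R ?v (g x)) absolutely_integrable_on S \<and>
      integral S (\<lambda>x. \<bar>det (matrix (g' x))\<bar> *\<^sub>R ?v (g x)) = integral (g ` S) ?v"
    using has_absolute_integral_change_of_variables[OF _ der' inj, of ?v "integral (g ` S) ?v"] S 2
    by (simp only: lborelD borel_open sets_completionI_sets)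
  have "((\<lambda>x. \<bar>det (matrix (g' x))\<bar> *\<^sub>R ?v (g x)) has_integral integral (g ` S) ?v) S"
    using A set_lebesgue_integral_eq_integral(1) integrable_integral by force
  then have B: "((\<lambda>x. \<bar>det (matrix (g' x))\<bar> * f (g x)) has_integral (integral (g ` S) ?v $ 1)) S"
    by (drule_tac has_integral_linear[OF _ bounded_linear_vec_nth[of 1]]) (simp add: comp_def)
  have "(?v has_integral integral (g ` S) ?v) (g ` S)"
    using set_lebesgue_integral_eq_integral(1)[OF 2] by (rule integrable_integral)
  then have C: "(f has_integral (integral (g ` S) ?v $ 1)) (g ` S)"
    by (drule_tac has_integral_linear[OF _ bounded_linear_vec_nth[of 1]]) (simp add: comp_def)
  show ?thesis
    using nn_integral_has_integral_lebesgue'[OF _ B] nn_integral_has_integral_lebesgue'[OF _ C] f(2) by simp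
qed

text \<open>Reindexing coordinates preserves Lebesgue measure and Jacobian determinants, so the well-ordered case
  suffices. Measurability of the Jacobian makes the
  integrand on the right a Borel function, to which \<open>nn_integral_vec_wo\<close> applies.\<close>

theorem nn_integral_change_of_variables:
  fixes g :: "real^'n::finite \<Rightarrow> real^'n" and f :: "real^'n \<Rightarrow> real"
  assumes S: "open S" and der: "\<And>x. x \<in> S \<Longrightarrow> (g has_derivative g' x) (at x)" and inj: "inj_on g S"
    and f: "integrable lborel f" "\<And>y. 0 \<le> f y"
    and J [measurable]: "(\<lambda>x. indicator S x * det (matrix (g' x))) \<in> borel_measurable borel"
  shows "(\<integral>\<^sup>+y. ennreal (f y) * indicator (g ` S) y \<partial>lborel) =
    (\<integral>\<^sup>+x. ennreal (\<bar>det (matrix (g' x))\<bar> * f (g x)) * indicator S x \<partial>lborel)"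
proof -
  define h where "h z = vec_wo (g (vec_of_wo z))" for z :: "real^'n wo"
  define h' where "h' z v = vec_wo (g' (vec_of_wo z) (vec_of_wo v))" for z v :: "real^'n wo"
  define T where "T = vec_of_wo -` S"
  have contg: "continuous_on S g"
    by (intro continuous_at_imp_continuous_on ballI has_derivative_continuous[OF der])
  have [measurable]: "g ` S \<in> sets borel" using invariance_of_domain[OF contg S inj] by auto
  have [measurable]: "f \<in> borel_measurable borel" using borel_measurable_integrable[OF f(1)] by simp
  have [measurable]: "S \<in> sets borel" using S by auto
  have "(\<lambda>x. if x \<in> S then g x else 0) \<in> borel_measurable borel"
    by (rule borel_measurable_continuous_on_if) (auto intro: contg)
  then have "(\<lambda>x. f (if x \<in> S then g x else 0)) \<in> borel_measurable borel" by measurable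
  then have "(\<lambda>x. ennreal (\<bar>indicator S x * det (matrix (g' x))\<bar> * f (if x \<in> S then g x else 0)) * indicator S x)
      \<in> borel_measurable borel" by measurable
  also have "(\<lambda>x. ennreal (\<bar>indicator S x * det (matrix (g' x))\<bar> * f (if x \<in> S then g x else 0)) * indicator S x) =
     (\<lambda>x. ennreal (\<bar>det (matrix (g' x))\<bar> * f (g x)) * indicator S x)"
    by (auto simp: fun_eq_iff indicator_def)
  finally have meas [measurable]:
    "(\<lambda>x. ennreal (\<bar>det (matrix (g' x))\<bar> * f (g x)) * indicator S x) \<in> borel_measurable borel" .
  have openT: "open T" unfolding T_def
    by (rule open_vimage[OF S]) (auto intro: linear_continuous_on bounded_linear_vec_wo)
  have derh: "(h has_derivative h' z) (at z)" if "z \<in> T" for z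
  proof -
    have "((\<lambda>z. g (vec_of_wo z)) has_derivative (\<lambda>v. g' (vec_of_wo z) (vec_of_wo v))) (at z)"
      by (rule has_derivative_compose[OF bounded_linear_imp_has_derivative[OF bounded_linear_vec_wo(2)] der])
        (use that in \<open>auto simp: T_def\<close>)
    from bounded_linear.has_derivative[OF bounded_linear_vec_wo(1) this]
    show ?thesis unfolding h_def h'_def .
  qed
  have injh: "inj_on h T"
  proof (rule inj_onI)
    fix x y assume "x \<in> T" "y \<in> T" "h x = h y"
    then have "vec_of_wo x = vec_of_wo y" using inj unfolding T_def h_def inj_on_def
      by (metis vec_wo_inverses(1) vimageE)
    then show "x = y" by (metis vec_wo_inverses(2))
  qed
  have hT: "vec_of_wo z \<in> g ` S \<longleftrightarrow> z \<in> h ` T" for z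
    unfolding h_def T_def image_iff by (metis vec_wo_inverses vimage_eq)
  have deth: "det (matrix (h' z)) = det (matrix (g' (vec_of_wo z)))" for z
  proof -
    have "matrix (h' z) = (\<chi> i j. matrix (g' (vec_of_wo z)) $ of_wo i $ of_wo j)"
    proof -
      have ax: "vec_of_wo (axis j (1::real)) = axis (of_wo j) 1" for j
        by (auto simp: vec_of_wo_def axis_def vec_eq_iff to_wo_inject dest: arg_cong[where f=to_wo])
      show ?thesis by (simp add: matrix_def h'_def vec_wo_def ax)
    qed
    then show ?thesis by (simp add: det_wo)
  qed
  have fi: "integrable lborel (\<lambda>z. f (vec_of_wo z))"
  proof -
    have "integrable (distr lborel borel vec_of_wo) f" unfolding lborel_vec_wo by (rule f)
    then show ?thesis by (subst (asm) integrable_distr_eq) auto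
  qed
  have "(\<integral>\<^sup>+y. ennreal (f y) * indicator (g ` S) y \<partial>lborel) =
      (\<integral>\<^sup>+z. ennreal (f (vec_of_wo z)) * indicator (g ` S) (vec_of_wo z) \<partial>lborel)"
    by (rule nn_integral_vec_wo) measurable
  also have "\<dots> = (\<integral>\<^sup>+z. ennreal (f (vec_of_wo z)) * indicator (h ` T) z \<partial>lborel)"
    by (simp add: indicator_def hT)
  also have "\<dots> = (\<integral>\<^sup>+z. ennreal (\<bar>det (matrix (h' z))\<bar> * f (vec_of_wo (h z))) * indicator T z \<partial>lborel)"
    by (rule nn_integral_change_of_variables_wellorder[OF openT derh injh fi]) (auto simp: f)
  also have "\<dots> = (\<integral>\<^sup>+z. ennreal (\<bar>det (matrix (g' (vec_of_wo z)))\<bar> * f (g (vec_of_wo z))) * indicator S (vec_of_wo z) \<partial>lborel)"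
    unfolding deth by (simp add: h_def T_def indicator_def)
  also have "\<dots> = (\<integral>\<^sup>+x. ennreal (\<bar>det (matrix (g' x))\<bar> * f (g x)) * indicator S x \<partial>lborel)"
    by (rule nn_integral_vec_wo[symmetric]) measurable
  finally show ?thesis .
qed

section \<open>Lebesgue measure and a coordinate hyperplane\<close>

lemma lborel_PiM:
  "(lborel :: (real^'n::finite) measure) = distr (Pi\<^sub>M UNIV (\<lambda>_. lborel)) borel (\<lambda>z. \<chi> i. z i)"
proof (rule lborel_eqI)
  interpret product_sigma_finite "\<lambda>_::'n. lborel :: real measure" by standard
  have m [measurable]: "(\<lambda>z. \<chi> i. z i) \<in> Pi\<^sub>M UNIV (\<lambda>_::'n. lborel::real measure) \<rightarrow>\<^sub>M (borel :: (real^'n) measure)"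
    by (rule borel_measurable_vec_lambda) auto
  fix l u :: "real^'n"
  assume le: "\<And>b. b \<in> Basis \<Longrightarrow> l \<bullet> b \<le> u \<bullet> b"
  have lei: "l $ i \<le> u $ i" for i using le[of "axis i 1"] by (simp add: inner_axis axis_in_Basis_iff)
  have "(\<lambda>z. \<chi> i. z i) -` box l u = Pi\<^sub>E UNIV (\<lambda>i. {l $ i <..< u $ i})"
    by (auto simp: box_vec PiE_def)
  then have "emeasure (distr (Pi\<^sub>M UNIV (\<lambda>_. lborel)) borel (\<lambda>z. \<chi> i. z i)) (box l u) =
      emeasure (Pi\<^sub>M UNIV (\<lambda>_::'n. lborel)) (Pi\<^sub>E UNIV (\<lambda>i. {l $ i <..< u $ i}))"
    by (subst emeasure_distr[OF m]) (auto simp: space_PiM)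
  also have "\<dots> = (\<Prod>i\<in>UNIV. emeasure lborel {l $ i <..< u $ i})"
    by (subst emeasure_PiM) auto
  also have "\<dots> = (\<Prod>i\<in>UNIV. ennreal (u $ i - l $ i))" using lei by simp
  also have "\<dots> = ennreal (\<Prod>b\<in>Basis. (u - l) \<bullet> b)"
    using lei by (simp add: prod_Basis_vec inner_axis prod_ennreal)
  finally show "emeasure (distr (Pi\<^sub>M UNIV (\<lambda>_. lborel)) borel (\<lambda>z. \<chi> i. z i)) (box l u) =
    (\<Prod>b\<in>Basis. (u - l) \<bullet> b)" .
qed simp

text \<open>Fubini's theorem, splitting off the \<open>k\<close>-th coordinate.\<close>

lemma nn_integral_hyperplane:
  fixes \<Theta> :: "real^'n::finite \<Rightarrow> ennreal" and \<chi>' :: "real \<Rightarrow> ennreal"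
  assumes [measurable]: "\<Theta> \<in> borel_measurable borel" "\<chi>' \<in> borel_measurable borel"
  shows "(\<integral>\<^sup>+v. \<chi>' (v $ k) * \<Theta> (hyperproj k v) \<partial>lborel) =
    (\<integral>\<^sup>+r. \<chi>' r \<partial>lborel) * (\<integral>\<^sup>+u. \<Theta> u \<partial>hyperplane_measure k)"
proof -
  interpret product_sigma_finite "\<lambda>_::'n. lborel :: real measure" by standard
  have m [measurable]: "(\<lambda>z. \<chi> i. z i) \<in> Pi\<^sub>M UNIV (\<lambda>_::'n. lborel::real measure) \<rightarrow>\<^sub>M (borel :: (real^'n) measure)"
    by (rule borel_measurable_vec_lambda) auto
  have mh [measurable]: "hyperproj k \<in> borel_measurable borel"
    unfolding hyperproj_def by (rule borel_measurable_vec_lambda) auto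
  have mk: "(\<lambda>z. \<chi> i. if i = k then 0 else z i) \<in> Pi\<^sub>M (UNIV - {k}) (\<lambda>_::'n. lborel::real measure) \<rightarrow>\<^sub>M (borel :: (real^'n) measure)"
  proof (rule borel_measurable_vec_lambda)
    show "(\<lambda>z. if i = k then 0 else z i) \<in> borel_measurable (Pi\<^sub>M (UNIV - {k}) (\<lambda>_::'n. lborel::real measure))" for i
      by (cases "i = k") auto
  qed
  have "(\<integral>\<^sup>+v. \<chi>' (v $ k) * \<Theta> (hyperproj k v) \<partial>lborel) =
      (\<integral>\<^sup>+z. \<chi>' (z k) * \<Theta> (hyperproj k (\<chi> i. z i)) \<partial>Pi\<^sub>M (insert k (UNIV - {k})) (\<lambda>_::'n. lborel))"
    by (subst lborel_PiM, subst nn_integral_distr) (auto simp: insert_absorb)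
  also have "\<dots> = (\<integral>\<^sup>+z. \<integral>\<^sup>+r. \<chi>' r * \<Theta> (\<chi> i. if i = k then 0 else z i) \<partial>lborel \<partial>Pi\<^sub>M (UNIV - {k}) (\<lambda>_::'n. lborel))"
  proof (subst product_nn_integral_insert)
    show "(\<lambda>z. \<chi>' (z k) * \<Theta> (hyperproj k (\<chi> i. z i))) \<in> borel_measurable (Pi\<^sub>M (insert k (UNIV - {k})) (\<lambda>_::'n. lborel))"
      by (simp add: insert_absorb) measurable
    have "hyperproj k (\<chi> i. (z(k := r)) i) = (\<chi> i. if i = k then 0 else z i)" for z r
      by (auto simp: hyperproj_def vec_eq_iff)
    then show "(\<integral>\<^sup>+z. \<integral>\<^sup>+r. \<chi>' ((z(k := r)) k) * \<Theta> (hyperproj k (\<chi> i. (z(k := r)) i)) \<partial>lborel \<partial>Pi\<^sub>M (UNIV - {k}) (\<lambda>_::'n. lborel)) =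
      (\<integral>\<^sup>+z. \<integral>\<^sup>+r. \<chi>' r * \<Theta> (\<chi> i. if i = k then 0 else z i) \<partial>lborel \<partial>Pi\<^sub>M (UNIV - {k}) (\<lambda>_::'n. lborel))"
      by simp
  qed auto
  also have "\<dots> = (\<integral>\<^sup>+r. \<chi>' r \<partial>lborel) * (\<integral>\<^sup>+z. \<Theta> (\<chi> i. if i = k then 0 else z i) \<partial>Pi\<^sub>M (UNIV - {k}) (\<lambda>_::'n. lborel))"
    using measurable_compose[OF mk, of \<Theta> borel] by (simp add: nn_integral_multc nn_integral_cmult)
  also have "\<dots> = (\<integral>\<^sup>+r. \<chi>' r \<partial>lborel) * (\<integral>\<^sup>+u. \<Theta> u \<partial>hyperplane_measure k)"
    unfolding hyperplane_measure_def by (subst nn_integral_distr[OF mk]) auto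
  finally show ?thesis .
qed

section \<open>Integrals of homogeneous functions\<close>

lemma nn_integral_lborel_scale:
  fixes f :: "real^'n::finite \<Rightarrow> ennreal"
  assumes [measurable]: "f \<in> borel_measurable borel" and "c > 0"
  shows "(\<integral>\<^sup>+y. f y \<partial>lborel) = ennreal (c ^ CARD('n)) * (\<integral>\<^sup>+y. f (c *\<^sub>R y) \<partial>lborel)"
  using assms(2)
  by (subst lborel_affine[of c 0])
    (auto simp: nn_integral_density nn_integral_distr nn_integral_cmult)

text \<open>A radial density spreads unit mass, with respect to \<open>dr\<close>, along every ray \<open>r \<mapsto> e^r y\<close>.\<close>

definition radial_density :: "(real^'n::finite \<Rightarrow> ennreal) \<Rightarrow> bool" where
  "radial_density a \<longleftrightarrow> a \<in> borel_measurable borel \<and> (\<forall>y. y \<noteq> 0 \<longrightarrow> (\<integral>\<^sup>+r. a (exp r *\<^sub>R y) \<partial>lborel) = 1)"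

text \<open>Insert the factor \<open>\<integral> b(e^r y) dr = 1\<close>, exchange the integrals, and substitute \<open>y \<mapsto> e^-r y\<close>: the Jacobian
  cancels against the homogeneity of \<open>H\<close>, and now \<open>a\<close> integrates to one along rays while \<open>b\<close> remains.\<close>

lemma nn_integral_homogeneous_radial:
  fixes H :: "real^'n::finite \<Rightarrow> ennreal"
  assumes H [measurable]: "H \<in> borel_measurable borel"
    and hom: "\<And>r y. y \<noteq> 0 \<Longrightarrow> H (exp r *\<^sub>R y) * ennreal (exp r ^ CARD('n)) = H y"
    and a: "radial_density a" and b: "radial_density b"
  shows "(\<integral>\<^sup>+y. H y * a y \<partial>lborel) = (\<integral>\<^sup>+y. H y * b y \<partial>lborel)"
proof -
  have [measurable]: "a \<in> borel_measurable borel" "b \<in> borel_measurable borel"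
    using a b by (auto simp: radial_density_def)
  have nz: "AE y in lborel. y \<noteq> (0::real^'n)" by (rule AE_lborel_singleton)
  have "(\<integral>\<^sup>+y. H y * a y \<partial>lborel) = (\<integral>\<^sup>+y. H y * a y * (\<integral>\<^sup>+r. b (exp r *\<^sub>R y) \<partial>lborel) \<partial>lborel)"
    by (rule nn_integral_cong_AE) (use nz b in \<open>auto simp: radial_density_def\<close>)
  also have "\<dots> = (\<integral>\<^sup>+y. \<integral>\<^sup>+r. H y * a y * b (exp r *\<^sub>R y) \<partial>lborel \<partial>lborel)"
    by (simp add: nn_integral_cmult)
  also have "\<dots> = (\<integral>\<^sup>+r. \<integral>\<^sup>+y. H y * a y * b (exp r *\<^sub>R y) \<partial>lborel \<partial>lborel)"
    by (rule lborel_pair.Fubini'[symmetric]) measurable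
  also have "\<dots> = (\<integral>\<^sup>+r. \<integral>\<^sup>+y. H y * b y * a (exp (- r) *\<^sub>R y) \<partial>lborel \<partial>lborel)"
  proof (rule nn_integral_cong)
    fix r :: real
    have "(\<integral>\<^sup>+y. H y * b y * a (exp (- r) *\<^sub>R y) \<partial>lborel) =
        ennreal (exp r ^ CARD('n)) * (\<integral>\<^sup>+y. H (exp r *\<^sub>R y) * b (exp r *\<^sub>R y) * a y \<partial>lborel)"
      by (subst nn_integral_lborel_scale[where c="exp r"]) (auto simp: exp_minus)
    also have "\<dots> = (\<integral>\<^sup>+y. (H (exp r *\<^sub>R y) * ennreal (exp r ^ CARD('n))) * b (exp r *\<^sub>R y) * a y \<partial>lborel)"
      by (subst nn_integral_cmult[symmetric]) (auto simp: mult_ac)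
    also have "\<dots> = (\<integral>\<^sup>+y. H y * a y * b (exp r *\<^sub>R y) \<partial>lborel)"
    proof (rule nn_integral_cong_AE, use nz in eventually_elim)
      case (elim y)
      then show ?case by (simp only: hom[OF elim]) (simp add: mult_ac)
    qed
    finally show "(\<integral>\<^sup>+y. H y * a y * b (exp r *\<^sub>R y) \<partial>lborel) = (\<integral>\<^sup>+y. H y * b y * a (exp (- r) *\<^sub>R y) \<partial>lborel)" ..
  qed
  also have "\<dots> = (\<integral>\<^sup>+y. \<integral>\<^sup>+r. H y * b y * a (exp (- r) *\<^sub>R y) \<partial>lborel \<partial>lborel)"
    by (rule lborel_pair.Fubini') measurable
  also have "\<dots> = (\<integral>\<^sup>+y. H y * b y * (\<integral>\<^sup>+r. a (exp (- r) *\<^sub>R y) \<partial>lborel) \<partial>lborel)"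
    by (simp add: nn_integral_cmult)
  also have "\<dots> = (\<integral>\<^sup>+y. H y * b y * (\<integral>\<^sup>+r. a (exp r *\<^sub>R y) \<partial>lborel) \<partial>lborel)"
  proof -
    have "(\<integral>\<^sup>+r. a (exp r *\<^sub>R y) \<partial>lborel) = (\<integral>\<^sup>+r. a (exp (- r) *\<^sub>R y) \<partial>lborel)" for y
      by (subst nn_integral_real_affine[where c="-1" and t=0]) auto
    then show ?thesis by simp
  qed
  also have "\<dots> = (\<integral>\<^sup>+y. H y * b y \<partial>lborel)"
    by (rule nn_integral_cong_AE) (use nz a in \<open>auto simp: radial_density_def\<close>)
  finally show ?thesis .
qed

section \<open>A compactly supported radial density\<close>

text \<open>Up to the value at the origin this is the triangle function of \<open>ln \<bar>y\<bar>\<close>; its support is the shell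
  \<open>e^-1 \<le> \<bar>y\<bar> \<le> e\<close>.\<close>

definition tent :: "real^'n::finite \<Rightarrow> real" where
  "tent y = (if y = 0 then 0 else max 0 (1 - \<bar>ln (norm y)\<bar>))"

lemma tent_nonneg: "0 \<le> tent y" by (simp add: tent_def)

lemma tent_eq_0_small: "norm y < exp (-1) \<Longrightarrow> tent y = 0"
proof -
  assume a: "norm y < exp (-1)"
  show ?thesis
  proof (cases "y = 0")
    case False
    then have "ln (norm y) < -1" using a by (metis exp_less_cancel_iff exp_ln zero_less_norm_iff)
    then show ?thesis by (simp add: tent_def)
  qed (simp add: tent_def)
qed

lemma tent_eq_0_large: "norm y > exp 1 \<Longrightarrow> tent y = 0"
proof -
  assume a: "norm y > exp 1"
  then have "norm y > 0" using exp_gt_zero[of "1::real"] by linarith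
  then have "ln (norm y) > 1" using a by (metis exp_less_cancel_iff exp_ln)
  then show ?thesis by (simp add: tent_def)
qed

text \<open>The product extends continuously by zero over the origin of the fibre, however \<open>Q\<close> behaves there.
  The map \<open>p\<close> is the identity or the projection of a product onto the fibre.\<close>

lemma continuous_on_mult_tent:
  fixes p :: "'a::topological_space \<Rightarrow> real^'n::finite" and Q :: "'a \<Rightarrow> real"
  assumes D: "open D" and p: "continuous_on D p" and Q: "continuous_on {z\<in>D. p z \<noteq> 0} Q"
  shows "continuous_on D (\<lambda>z. Q z * tent (p z))"
proof -
  let ?A = "{z\<in>D. p z \<noteq> 0}" and ?B = "D \<inter> p -` ball 0 (exp (-1))"
  have A: "open ?A"
  proof -
    have "?A = D \<inter> p -` (- {0})" by auto
    moreover have "open (- {0::real^'n})" by (rule open_Compl) simp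
    ultimately show ?thesis using continuous_open_preimage[OF p D, of "- {0}"] by simp
  qed
  have B: "open ?B" using continuous_open_preimage[OF p D, of "ball 0 (exp (-1))"] by simp
  have "continuous_on ?A (\<lambda>z. Q z * max 0 (1 - \<bar>ln (norm (p z))\<bar>))"
    by (intro continuous_intros Q continuous_on_subset[OF p]) auto
  then have cA: "continuous_on ?A (\<lambda>z. Q z * tent (p z))"
    by (rule continuous_on_eq) (auto simp: tent_def)
  have cB: "continuous_on ?B (\<lambda>z. Q z * tent (p z))"
    by (rule continuous_on_eq[of _ "\<lambda>_. 0"]) (auto simp: tent_eq_0_small)
  have "D = ?A \<union> ?B" by auto
  then show ?thesis using continuous_on_open_Un[OF A B cA cB] by simp
qed

lemma continuous_on_mult_tent_UNIV:
  "continuous_on (UNIV - {0}) Q \<Longrightarrow> continuous_on UNIV (\<lambda>y. Q y * tent y)"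
  using continuous_on_mult_tent[of UNIV "\<lambda>y. y" Q] by (auto simp: set_diff_eq)

lemma integrable_mult_tent:
  fixes Q :: "real^'n::finite \<Rightarrow> real"
  assumes "continuous_on (UNIV - {0}) Q"
  shows "integrable lborel (\<lambda>y. Q y * tent y)"
proof -
  have "integrable lborel (\<lambda>y. indicator (cball 0 (exp 1)) y *\<^sub>R (Q y * tent y))"
    by (rule borel_integrable_compact) (auto intro: continuous_on_subset[OF continuous_on_mult_tent_UNIV[OF assms]])
  moreover have "(\<lambda>y. indicator (cball 0 (exp 1)) y *\<^sub>R (Q y * tent y)) = (\<lambda>y. Q y * tent y)"
    by (auto simp: fun_eq_iff indicator_def tent_eq_0_large not_le)
  ultimately show ?thesis by simp
qed

lemma measurable_tent [measurable]: "tent \<in> borel_measurable borel"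
  using continuous_on_mult_tent_UNIV[of "\<lambda>_. 1"] by (auto intro: borel_measurable_continuous_onI)

lemma nn_integral_triangle: "(\<integral>\<^sup>+r. ennreal (max 0 (1 - \<bar>r + c\<bar>)) \<partial>lborel) = 1"
proof -
  have "(\<integral>\<^sup>+r. ennreal (max 0 (1 - \<bar>r + c\<bar>)) \<partial>lborel) = (\<integral>\<^sup>+r. ennreal (max 0 (1 - \<bar>r\<bar>)) \<partial>lborel)"
    by (subst nn_integral_real_affine[where c=1 and t="-c"]) auto
  also have "\<dots> = 1"
  proof -
    have i1: "((\<lambda>r::real. 1 + r) has_integral 1/2) {-1..0}"
    proof -
      have "((\<lambda>r::real. r + r^2/2) has_vector_derivative (1 + r)) (at r within {-1..0})" for r
        unfolding has_real_derivative_iff_has_vector_derivative[symmetric]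
        by (auto intro!: derivative_eq_intros)
      from fundamental_theorem_of_calculus[OF _ this] show ?thesis by simp
    qed
    have i2: "((\<lambda>r::real. 1 - r) has_integral 1/2) {0..1}"
    proof -
      have "((\<lambda>r::real. r - r^2/2) has_vector_derivative (1 - r)) (at r within {0..1})" for r
        unfolding has_real_derivative_iff_has_vector_derivative[symmetric]
        by (auto intro!: derivative_eq_intros)
      from fundamental_theorem_of_calculus[OF _ this] show ?thesis by simp
    qed
    have j1: "((\<lambda>r::real. max 0 (1 - \<bar>r\<bar>)) has_integral 1/2) {-1..0}"
      by (rule has_integral_eq[OF _ i1]) auto
    have j2: "((\<lambda>r::real. max 0 (1 - \<bar>r\<bar>)) has_integral 1/2) {0..1}"
      by (rule has_integral_eq[OF _ i2]) auto
    have "((\<lambda>r::real. max 0 (1 - \<bar>r\<bar>)) has_integral 1) {-1..1}"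
      using has_integral_combine[OF _ _ j1 j2] by simp
    then have "((\<lambda>r::real. max 0 (1 - \<bar>r\<bar>)) has_integral 1) UNIV"
      by (rule has_integral_on_superset) auto
    then show ?thesis
      using nn_integral_has_integral_lborel[of "\<lambda>r::real. max 0 (1 - \<bar>r\<bar>)" 1] by simp
  qed
  finally show ?thesis .
qed

text \<open>Along a ray, \<open>tent\<close> is a translate of the triangle function, whose integral is one.\<close>

lemma radial_density_tent: "radial_density (\<lambda>y. ennreal (tent y))"
  unfolding radial_density_def
proof (intro conjI allI impI)
  fix y :: "real^'n" assume "y \<noteq> 0"
  then have "tent (exp r *\<^sub>R y) = max 0 (1 - \<bar>r + ln (norm y)\<bar>)" for r
    by (simp add: tent_def ln_mult)
  then show "(\<integral>\<^sup>+r. ennreal (tent (exp r *\<^sub>R y)) \<partial>lborel) = 1"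
    using nn_integral_triangle[of "ln (norm y)"] by simp
qed measurable

section \<open>Hypersurfaces that meet every ray once\<close>

text \<open>The property that characterises \<open>hypersurface_measure\<close>.\<close>

definition contracted_form_measure ::
  "(real^'n::finite) set \<Rightarrow> (real^'n \<Rightarrow> ('n \<Rightarrow> real^'n) \<Rightarrow> real) \<Rightarrow> (real^'n \<Rightarrow> real^'n) \<Rightarrow> (real^'n) measure \<Rightarrow> bool" where
  "contracted_form_measure S \<alpha> l \<mu> \<longleftrightarrow>
     space \<mu> = S \<and> sets \<mu> = sets (restrict_space borel S) \<and>
     (\<forall>k V s. local_param S k V s \<longrightarrow>
        (\<forall>B\<in>sets \<mu>. B \<subseteq> s ` V \<longrightarrow>
           emeasure \<mu> B =
             (\<integral>\<^sup>+ u. indicator V u * indicator B (s u) *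
                ennreal \<bar>\<alpha> (s u) ((\<lambda>i. partial i (s \<circ> hyperproj k) u)(k := l (s u)))\<bar>
              \<partial>hyperplane_measure k)))"

text \<open>Measurable subsets of a single patch have the prescribed measure; an arbitrary measurable set is cut
  along the finitely many patches of the cover.\<close>

lemma contracted_form_measure_unique:
  assumes \<mu>: "contracted_form_measure S \<alpha> l \<mu>" and \<nu>: "contracted_form_measure S \<alpha> l \<nu>"
    and fin: "finite P" and lp: "\<And>k V s. (k, V, s) \<in> P \<Longrightarrow> local_param S k V s"
    and cover: "S \<subseteq> (\<Union>(k, V, s)\<in>P. s ` V)"
  shows "\<mu> = \<nu>"
proof (rule measure_eqI)
  have sets: "sets \<mu> = sets (restrict_space borel S)" "sets \<nu> = sets (restrict_space borel S)"
    using \<mu> \<nu> by (auto simp: contracted_form_measure_def)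
  then show "sets \<mu> = sets \<nu>" by simp
  have piece: "emeasure \<mu> B = emeasure \<nu> B" if "B \<in> sets \<mu>" "B \<subseteq> s ` V" "(k, V, s) \<in> P" for B k V s
  proof -
    have "B \<in> sets \<nu>" using that sets by simp
    then show ?thesis
      using \<mu> \<nu> lp[OF that(3)] that(1,2) unfolding contracted_form_measure_def by simp
  qed
  have meas: "s ` V \<in> sets (restrict_space borel S)" if "(k, V, s) \<in> P" for k V s
  proof -
    have "openin (top_of_set S) (s ` V)" using lp[OF that] by (simp add: local_param_def)
    then obtain T where "open T" "s ` V = S \<inter> T" by (auto simp: openin_open)
    then show ?thesis by (auto simp: sets_restrict_space)
  qed
  have "emeasure \<mu> B = emeasure \<nu> B" if "B \<in> sets \<mu>" "B \<subseteq> (\<Union>(k, V, s)\<in>R. s ` V)" "R \<subseteq> P" for B R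
    using finite_subset[OF that(3) fin] that
  proof (induction R arbitrary: B rule: finite_induct)
    case (insert c R)
    obtain k V s where c: "c = (k, V, s)" by (cases c)
    have P: "(k, V, s) \<in> P" using insert c by auto
    have T: "s ` V \<in> sets \<mu>" "s ` V \<in> sets \<nu>" using meas[OF P] sets by auto
    have B: "B \<in> sets \<mu>" "B \<in> sets \<nu>" using insert.prems sets by auto
    have "emeasure \<mu> (B \<inter> s ` V) = emeasure \<nu> (B \<inter> s ` V)"
      by (rule piece[OF _ _ P]) (use B T in auto)
    moreover have "emeasure \<mu> (B - s ` V) = emeasure \<nu> (B - s ` V)"
      by (rule insert.IH) (use B T insert.prems c in auto)
    moreover have "emeasure \<mu> B = emeasure \<mu> (B \<inter> s ` V) + emeasure \<mu> (B - s ` V)"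
      using plus_emeasure[of "B \<inter> s ` V" \<mu> "B - s ` V"] B T by (force simp: Int_Diff_Un)
    moreover have "emeasure \<nu> B = emeasure \<nu> (B \<inter> s ` V) + emeasure \<nu> (B - s ` V)"
      using plus_emeasure[of "B \<inter> s ` V" \<nu> "B - s ` V"] B T by (force simp: Int_Diff_Un)
    ultimately show ?case by simp
  qed auto
  moreover have "B \<subseteq> S" if "B \<in> sets \<mu>" for B
    using that sets by (auto simp: sets_restrict_space)
  ultimately show "emeasure \<mu> B = emeasure \<nu> B" if "B \<in> sets \<mu>" for B
    using that cover by (meson order_refl order_trans)
qed

lemma hypersurface_measure_eqI:
  assumes "contracted_form_measure S \<alpha> l \<mu>"
    and "finite P" "\<And>k V s. (k, V, s) \<in> P \<Longrightarrow> local_param S k V s" "S \<subseteq> (\<Union>(k, V, s)\<in>P. s ` V)"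
  shows "hypersurface_measure S \<alpha> l = \<mu>"
  unfolding hypersurface_measure_def contracted_form_measure_def[symmetric]
proof (rule the_equality)
  show "contracted_form_measure S \<alpha> l \<mu>" by fact
  show "\<nu> = \<mu>" if "contracted_form_measure S \<alpha> l \<nu>" for \<nu>
    by (rule contracted_form_measure_unique[OF that assms])
qed

lemma hyperproj_in [simp]: "hyperproj k v \<in> hyperplane k" by (simp add: hyperproj_def hyperplane_def)
lemma hyperproj_ident: "u \<in> hyperplane k \<Longrightarrow> hyperproj k u = u"
  by (auto simp: hyperproj_def hyperplane_def vec_eq_iff)
lemma hyperproj_add_axis: "u \<in> hyperplane k \<Longrightarrow> hyperproj k (u + axis k r) = u"
  by (auto simp: hyperproj_def hyperplane_def vec_eq_iff axis_def)
lemma hyperproj_decomp: "hyperproj k v + axis k (v $ k) = v"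
  by (auto simp: hyperproj_def vec_eq_iff axis_def)
lemma bounded_linear_hyperproj: "bounded_linear (hyperproj k :: real^'n::finite \<Rightarrow> _)"
  unfolding linear_conv_bounded_linear[symmetric]
  by (rule linearI) (auto simp: hyperproj_def vec_eq_iff)
lemma hyperproj_cong_add: "hyperproj k v = hyperproj k v' \<Longrightarrow> hyperproj k (v + h) = hyperproj k (v' + h)"
  by (simp add: linear_add bounded_linear.linear[OF bounded_linear_hyperproj])

text \<open>The function \<open>s \<circ> hyperproj k\<close> is invariant under translations along the \<open>k\<close>-th axis, hence so is its
  derivative.\<close>

lemma hyperproj_has_derivative_shift:
  fixes s :: "real^'n::finite \<Rightarrow> real^'n"
  assumes "(s \<circ> hyperproj k has_derivative D) (at v)" "hyperproj k v = hyperproj k v'"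
  shows "(s \<circ> hyperproj k has_derivative D) (at v')"
proof -
  have "((\<lambda>x. x + (v - v')) has_derivative (\<lambda>h. h)) (at v')"
    by (auto intro!: derivative_eq_intros)
  then have "((\<lambda>x. (s \<circ> hyperproj k) (x + (v - v'))) has_derivative (\<lambda>h. D h)) (at v')"
    by (rule has_derivative_compose) (use assms(1) in \<open>simp add: comp_def\<close>)
  moreover have "(s \<circ> hyperproj k) (x + (v - v')) = (s \<circ> hyperproj k) x" for x
    using hyperproj_cong_add[OF assms(2), of "x - v'"] by (simp add: algebra_simps)
  ultimately show ?thesis by (simp add: comp_def)
qed

lemma hyperproj_derivative_axis:
  fixes s :: "real^'n::finite \<Rightarrow> real^'n"
  assumes "(s \<circ> hyperproj k has_derivative D) (at v)"
  shows "D (axis k 1) = 0"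
proof -
  have "((\<lambda>t::real. v + t *\<^sub>R axis k 1) has_derivative (\<lambda>t. t *\<^sub>R axis k 1)) (at 0)"
    by (auto intro!: derivative_eq_intros)
  then have "((\<lambda>t::real. (s \<circ> hyperproj k) (v + t *\<^sub>R axis k 1)) has_derivative (\<lambda>t. D (t *\<^sub>R axis k 1))) (at 0)"
    by (rule has_derivative_compose) (use assms in \<open>simp add: comp_def\<close>)
  moreover have "hyperproj k (v + t *\<^sub>R axis k 1) = hyperproj k v" for t
    by (auto simp: hyperproj_def vec_eq_iff axis_def)
  ultimately have "((\<lambda>t::real. (s \<circ> hyperproj k) v) has_derivative (\<lambda>t. D (t *\<^sub>R axis k 1))) (at 0)"
    by simp
  then have "(\<lambda>t. D (t *\<^sub>R axis k 1)) = (\<lambda>t. 0)"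
    by (rule has_derivative_unique) simp
  then show ?thesis by (metis scaleR_one)
qed

text \<open>A hypersurface \<open>f = 1\<close> for positive, positively homogeneous \<open>f\<close>, with the form
  \<open>\<rho> dy\<^sup>1/f \<and> \<dots> \<and> dy\<^sup>n/f\<close> contracted with the radial field. In the application \<open>\<rho> = \<surd>(det g)\<close>.\<close>

locale star_hypersurface =
  fixes f \<rho> :: "real^'n::finite \<Rightarrow> real"
  assumes smooth: "smooth_on (UNIV - {0}) f"
    and pos: "\<And>y. y \<noteq> 0 \<Longrightarrow> f y > 0"
    and zero: "f 0 = 0"
    and hom: "\<And>a y. a > 0 \<Longrightarrow> f (a *\<^sub>R y) = a * f y"
    and \<rho>_cont: "continuous_on (UNIV - {0}) \<rho>"
    and \<rho>_nonneg: "\<And>y. y \<noteq> 0 \<Longrightarrow> \<rho> y \<ge> 0"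
    and \<rho>_hom: "\<And>a y. a > 0 \<Longrightarrow> y \<noteq> 0 \<Longrightarrow> \<rho> (a *\<^sub>R y) = \<rho> y"
begin

text \<open>Here \<open>proj\<close> is the radial projection onto \<open>S\<close>; at the origin it takes an arbitrary value in \<open>S\<close>, which
  makes it a measurable map on the whole space. The measure \<open>\<mu>\<close> is the candidate for the hypersurface measure:
  the image under \<open>proj\<close> of the measure with density \<open>H\<close>, cut off by a radial density.\<close>

definition "S = {y. f y = 1}"
definition "\<alpha> y w = \<rho> y * det (\<chi> i j. w j $ i / f y :: real^'n^'n)"
definition "l y = (1 / f y) *\<^sub>R y"
definition "H y = (if y = 0 then 0 else \<rho> y / f y ^ CARD('n))"
definition "proj y = (if y \<in> UNIV - {0} then (1 / f y) *\<^sub>R y else (1 / f 1) *\<^sub>R 1)"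
definition "\<mu> = distr (density lborel (\<lambda>y. ennreal (H y * tent y))) (restrict_space borel S) proj"

lemma f_cont: "continuous_on (UNIV - {0}) f" by (rule smooth_on_continuous[OF smooth])

lemma S_nonzero: "y \<in> S \<Longrightarrow> y \<noteq> 0" using zero by (auto simp: S_def)

lemma f_nz: "y \<noteq> 0 \<Longrightarrow> f y \<noteq> 0" using pos[of y] by simp

lemma f_meas [measurable]: "f \<in> borel_measurable borel"
proof -
  have "(\<lambda>y. if y \<in> UNIV - {0} then f y else 0) \<in> borel_measurable borel"
    by (rule borel_measurable_continuous_on_if) (auto intro: f_cont)
  moreover have "(\<lambda>y. if y \<in> UNIV - {0} then f y else 0) = f" using zero by auto
  ultimately show ?thesis by simp
qed

lemma S_borel [measurable]: "S \<in> sets borel" unfolding S_def by measurable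

lemma H_cont: "continuous_on (UNIV - {0}) H"
proof -
  have "continuous_on (UNIV - {0}) (\<lambda>y. \<rho> y / f y ^ CARD('n))"
    by (intro continuous_intros f_cont \<rho>_cont) (use f_nz in auto)
  then show ?thesis by (rule continuous_on_eq) (auto simp: H_def)
qed

lemma H_meas [measurable]: "H \<in> borel_measurable borel"
proof -
  have "(\<lambda>y. if y \<in> UNIV - {0} then H y else 0) \<in> borel_measurable borel"
    by (rule borel_measurable_continuous_on_if) (auto intro: H_cont)
  moreover have "(\<lambda>y. if y \<in> UNIV - {0} then H y else 0) = H" by (auto simp: H_def)
  ultimately show ?thesis by simp
qed

lemma H_nonneg: "0 \<le> H y"
  using \<rho>_nonneg[of y] pos[of y] by (auto simp: H_def intro!: divide_nonneg_pos)

lemma H_scale: "a > 0 \<Longrightarrow> H (a *\<^sub>R y) * a ^ CARD('n) = H y"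
  by (simp add: H_def hom \<rho>_hom power_mult_distrib)

lemma proj_in_S: "proj y \<in> S"
proof -
  have "f ((1 / f z) *\<^sub>R z) = 1" if "z \<noteq> 0" for z using pos[OF that] by (subst hom) auto
  moreover have "(1::real^'n) \<noteq> 0" by (simp add: vec_eq_iff)
  ultimately show ?thesis by (auto simp: proj_def S_def)
qed

lemma proj_meas [measurable]: "proj \<in> borel_measurable borel"
  unfolding proj_def
  by (rule borel_measurable_continuous_on_if) (auto intro!: continuous_intros f_cont simp: f_nz)

lemma proj_meas_S: "proj \<in> borel \<rightarrow>\<^sub>M restrict_space borel S"
  by (rule measurable_restrict_space2) (auto simp: proj_in_S)

lemma proj_scale: "a > 0 \<Longrightarrow> y \<noteq> 0 \<Longrightarrow> proj (a *\<^sub>R y) = proj y"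
  by (simp add: proj_def hom)

lemma proj_S: "y \<in> S \<Longrightarrow> proj y = y"
  using S_nonzero by (auto simp: proj_def S_def)

text \<open>Along a ray, \<open>f\<close> grows like \<open>e^r\<close>, so the ray stays in the shell for a parameter interval of length one.\<close>

lemma radial_density_shell: "radial_density (\<lambda>y. indicator {y. y \<noteq> 0 \<and> 1 \<le> f y \<and> f y \<le> exp 1} y)"
  unfolding radial_density_def
proof (intro conjI allI impI)
  show "indicator {y. y \<noteq> 0 \<and> 1 \<le> f y \<and> f y \<le> exp 1} \<in> borel_measurable borel" by measurable
  fix y :: "real^'n" assume y: "y \<noteq> 0"
  have *: "1 \<le> exp r * f y \<and> exp r * f y \<le> exp 1 \<longleftrightarrow> r \<in> {- ln (f y) .. 1 - ln (f y)}" for r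
  proof -
    have "exp r * f y = exp (r + ln (f y))" using pos[OF y] by (simp add: exp_add)
    then have "1 \<le> exp r * f y \<and> exp r * f y \<le> exp 1 \<longleftrightarrow> exp 0 \<le> exp (r + ln (f y)) \<and> exp (r + ln (f y)) \<le> exp 1"
      by simp
    then show ?thesis unfolding exp_le_cancel_iff by auto
  qed
  have "indicator {y. y \<noteq> 0 \<and> 1 \<le> f y \<and> f y \<le> exp 1} (exp r *\<^sub>R y) = (indicator {- ln (f y) .. 1 - ln (f y)} r :: ennreal)" for r
    using y *[of r] by (auto simp: hom indicator_def)
  then show "(\<integral>\<^sup>+r. indicator {y. y \<noteq> 0 \<and> 1 \<le> f y \<and> f y \<le> exp 1} (exp r *\<^sub>R y) \<partial>lborel) = 1"
    by simp
qed

lemma emeasure_\<mu>: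
  assumes "B \<in> sets (restrict_space borel S)"
  shows "emeasure \<mu> B = (\<integral>\<^sup>+y. ennreal (H y) * indicator (proj -` B) y * ennreal (tent y) \<partial>lborel)"
proof -
  have "proj -` B \<in> sets borel" using measurable_sets[OF proj_meas_S assms] by simp
  then show ?thesis unfolding \<mu>_def
    by (subst emeasure_distr)
      (use proj_meas_S assms in \<open>auto simp: emeasure_density ennreal_mult H_nonneg tent_nonneg mult_ac\<close>)
qed

text \<open>A function that is homogeneous of degree zero is unchanged by \<open>proj\<close>.\<close>

lemma integral_\<mu>:
  fixes q :: "real^'n \<Rightarrow> real"
  assumes q: "continuous_on (UNIV - {0}) q" and qhom: "\<And>a y. a > 0 \<Longrightarrow> y \<noteq> 0 \<Longrightarrow> q (a *\<^sub>R y) = q y"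
  shows "(\<integral>y. q y \<partial>\<mu>) = (\<integral>y. q y * H y * tent y \<partial>lborel)"
proof -
  have qm: "q \<in> borel_measurable (restrict_space borel S)"
    by (rule borel_measurable_continuous_on_restrict) (auto intro: continuous_on_subset[OF q] dest: S_nonzero)
  have pm: "proj \<in> density lborel (\<lambda>y. ennreal (H y * tent y)) \<rightarrow>\<^sub>M restrict_space borel S"
    using proj_meas_S by simp
  have "(\<integral>y. q y \<partial>\<mu>) = (\<integral>y. q (proj y) \<partial>density lborel (\<lambda>y. ennreal (H y * tent y)))"
    unfolding \<mu>_def by (rule integral_distr[OF pm qm])
  also have "\<dots> = (\<integral>y. (H y * tent y) * q (proj y) \<partial>lborel)"
    by (subst integral_real_density)
      (use measurable_compose[OF proj_meas_S qm] in \<open>auto simp: H_nonneg tent_nonneg\<close>)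
  also have "(\<lambda>y. (H y * tent y) * q (proj y)) = (\<lambda>y. q y * H y * tent y)"
  proof
    show "(H y * tent y) * q (proj y) = q y * H y * tent y" for y
    proof (cases "y = 0")
      case False
      then have "q (proj y) = q y" using qhom[of "1 / f y" y] pos[of y] by (simp add: proj_def)
      then show ?thesis by simp
    qed (simp add: H_def)
  qed
  finally show ?thesis .
qed

text \<open>The radial graph over the hyperplane \<open>y\<^sub>k = \<epsilon>\<close>, with \<open>\<epsilon> = \<plusminus>1\<close>: it parametrises the part of \<open>S\<close> on which \<open>y\<^sub>k\<close> has
  the sign \<open>\<epsilon>\<close>, and its inverse is explicit.\<close>

definition "graph_vec k \<epsilon> u = hyperproj k u + axis k \<epsilon>"
definition "graph_map k \<epsilon> u = (1 / f (graph_vec k \<epsilon> u)) *\<^sub>R graph_vec k \<epsilon> u"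
definition "graph_inv k \<epsilon> y = hyperproj k ((1 / (\<epsilon> * y $ k)) *\<^sub>R y)"

context
  fixes k :: 'n and \<epsilon> :: real
  assumes \<epsilon>: "\<epsilon> = 1 \<or> \<epsilon> = -1"
begin

lemma \<epsilon>2: "\<epsilon> * \<epsilon> = 1" using \<epsilon> by auto

lemma graph_vec_nth: "graph_vec k \<epsilon> u $ k = \<epsilon>" by (simp add: graph_vec_def hyperproj_def)

lemma graph_vec_nonzero: "graph_vec k \<epsilon> u \<noteq> 0"
  using graph_vec_nth[of u] \<epsilon> by auto

lemma f_graph_vec_nz: "f (graph_vec k \<epsilon> u) \<noteq> 0"
  using f_nz[OF graph_vec_nonzero] .

lemma graph_map_pos: "\<epsilon> * graph_map k \<epsilon> u $ k > 0"
  using pos[OF graph_vec_nonzero] \<epsilon>2 by (simp add: graph_map_def graph_vec_nth mult.commute)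

lemma graph_map_S: "graph_map k \<epsilon> u \<in> S"
proof -
  have "f (graph_map k \<epsilon> u) = 1"
    unfolding graph_map_def by (subst hom) (auto simp: pos[OF graph_vec_nonzero] f_graph_vec_nz)
  then show ?thesis by (simp add: S_def)
qed

lemma graph_inv_map: "graph_inv k \<epsilon> (graph_map k \<epsilon> v) = hyperproj k v"
proof -
  have "(1 / (\<epsilon> * graph_map k \<epsilon> v $ k)) *\<^sub>R graph_map k \<epsilon> v = graph_vec k \<epsilon> v"
    using f_graph_vec_nz[of v] \<epsilon>2 by (simp add: graph_map_def graph_vec_nth)
  then show ?thesis by (auto simp: graph_inv_def graph_vec_def hyperproj_def vec_eq_iff axis_def)
qed

lemma graph_map_inv:
  assumes "y \<in> S" "\<epsilon> * y $ k > 0"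
  shows "graph_map k \<epsilon> (graph_inv k \<epsilon> y) = y"
proof -
  have "graph_vec k \<epsilon> (graph_inv k \<epsilon> y) = (1 / (\<epsilon> * y $ k)) *\<^sub>R y"
    using assms(2) \<epsilon> by (auto simp: graph_inv_def graph_vec_def hyperproj_def vec_eq_iff axis_def)
  moreover have "f ((1 / (\<epsilon> * y $ k)) *\<^sub>R y) = 1 / (\<epsilon> * y $ k)"
    by (subst hom) (use assms in \<open>auto simp: S_def\<close>)
  moreover have "\<epsilon> \<noteq> 0" "y $ k \<noteq> 0" using assms(2) by auto
  ultimately show ?thesis by (simp add: graph_map_def)
qed

lemma graph_image: "graph_map k \<epsilon> ` hyperplane k = S \<inter> {y. \<epsilon> * y $ k > 0}"
proof
  show "graph_map k \<epsilon> ` hyperplane k \<subseteq> S \<inter> {y. \<epsilon> * y $ k > 0}"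
    using graph_map_S graph_map_pos by auto
  show "S \<inter> {y. \<epsilon> * y $ k > 0} \<subseteq> graph_map k \<epsilon> ` hyperplane k"
  proof
    fix y assume "y \<in> S \<inter> {y. \<epsilon> * y $ k > 0}"
    then have "y = graph_map k \<epsilon> (graph_inv k \<epsilon> y)" using graph_map_inv by simp
    moreover have "graph_inv k \<epsilon> y \<in> hyperplane k" by (simp add: graph_inv_def)
    ultimately show "y \<in> graph_map k \<epsilon> ` hyperplane k" by blast
  qed
qed

lemma graph_map_smooth: "smooth_on UNIV (graph_map k \<epsilon>)"
proof -
  have v: "smooth_on UNIV (graph_vec k \<epsilon>)" unfolding graph_vec_def
    by (intro smooth_on_add smooth_on_linear smooth_on_const bounded_linear_hyperproj) auto
  have "smooth_on UNIV (\<lambda>u. f (graph_vec k \<epsilon> u))"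
    by (rule smooth_on_compose[OF v smooth]) (use graph_vec_nonzero in auto)
  then show ?thesis unfolding graph_map_def
    by (intro smooth_on_scaleR smooth_on_divide smooth_on_const v)
      (use pos[OF graph_vec_nonzero] in \<open>auto simp: less_imp_neq[symmetric]\<close>)
qed

text \<open>The graph map is an immersion because it has a differentiable left inverse: the derivative of
  \<open>graph_inv \<circ> graph_map = hyperproj\<close> fixes the vectors of the hyperplane.\<close>

lemma graph_local_param: "local_param S k (hyperplane k) (graph_map k \<epsilon>)"
  unfolding local_param_def
proof (intro conjI ballI impI)
  have comp: "graph_map k \<epsilon> \<circ> hyperproj k = graph_map k \<epsilon>"
    by (auto simp: fun_eq_iff graph_map_def graph_vec_def hyperproj_ident)
  have vim: "hyperproj k -` hyperplane k = UNIV" by auto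
  show "openin (top_of_set (hyperplane k)) (hyperplane k)" by simp
  have "open {y::real^'n. \<epsilon> * y $ k > 0}" by (intro open_Collect_less continuous_intros)
  then show "openin (top_of_set S) (graph_map k \<epsilon> ` hyperplane k)"
    unfolding graph_image by (auto simp: openin_open)
  show "smooth_on (hyperproj k -` hyperplane k) (graph_map k \<epsilon> \<circ> hyperproj k)"
    unfolding comp vim by (rule graph_map_smooth)
  have gi: "graph_inv k \<epsilon> (graph_map k \<epsilon> u) = u" if "u \<in> hyperplane k" for u
    using graph_inv_map[of u] hyperproj_ident[OF that] by simp
  have inj: "inj_on (graph_map k \<epsilon>) (hyperplane k)" by (rule inj_on_inverseI[where g="graph_inv k \<epsilon>"], rule gi)
  have hgi: "continuous_on {y. \<epsilon> * y $ k > 0} (graph_inv k \<epsilon>)"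
    unfolding graph_inv_def
    by (intro bounded_linear.continuous_on[OF bounded_linear_hyperproj] continuous_intros) auto
  have "continuous_on (graph_map k \<epsilon> ` hyperplane k) (inv_into (hyperplane k) (graph_map k \<epsilon>))"
    by (rule continuous_on_eq[OF continuous_on_subset[OF hgi]])
      (auto simp: graph_map_pos gi inv_into_f_f[OF inj])
  moreover have "continuous_on (hyperplane k) (graph_map k \<epsilon>)"
    by (rule continuous_on_subset[OF smooth_on_continuous[OF graph_map_smooth]]) simp
  ultimately show "homeomorphism (hyperplane k) (graph_map k \<epsilon> ` hyperplane k) (graph_map k \<epsilon>)
      (inv_into (hyperplane k) (graph_map k \<epsilon>))"
    unfolding homeomorphism_def inv_into_image_cancel[OF inj order_refl]
    by (intro conjI ballI inv_into_f_f[OF inj] f_inv_into_f refl)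
  fix u w :: "real^'n"
  assume "w \<in> hyperplane k" and 0: "frechet_derivative (graph_map k \<epsilon> \<circ> hyperproj k) (at u) w = 0"
  let ?D = "frechet_derivative (graph_map k \<epsilon>) (at u)" and ?y = "graph_map k \<epsilon> u"
  have D: "(graph_map k \<epsilon> has_derivative ?D) (at u)"
    by (rule smooth_on_has_derivative[OF graph_map_smooth]) simp
  have "(\<lambda>y. (1 / (\<epsilon> * y $ k)) *\<^sub>R y) differentiable (at ?y)"
    using graph_map_pos[of u] by (intro differentiable_scaleR differentiable_divide differentiable_const
        differentiable_mult differentiable_ident bounded_linear_imp_differentiable bounded_linear_vec_nth) auto
  then obtain E where E: "((\<lambda>y. (1 / (\<epsilon> * y $ k)) *\<^sub>R y) has_derivative E) (at ?y)"
    by (auto simp: differentiable_def)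
  from E have "(graph_inv k \<epsilon> has_derivative (\<lambda>h. hyperproj k (E h))) (at ?y)"
    unfolding graph_inv_def by (rule bounded_linear.has_derivative[OF bounded_linear_hyperproj])
  from has_derivative_compose[OF D this]
  have "((\<lambda>v. hyperproj k v) has_derivative (\<lambda>h. hyperproj k (E (?D h)))) (at u)"
    unfolding graph_inv_map .
  then have "hyperproj k = (\<lambda>h. hyperproj k (E (?D h)))"
    by (rule has_derivative_unique[OF bounded_linear_imp_has_derivative[OF bounded_linear_hyperproj]])
  then have "hyperproj k w = hyperproj k (E (?D w))" by (rule fun_cong)
  moreover have "?D w = 0" using 0 unfolding comp .
  moreover have "hyperproj k (E 0) = hyperproj k 0"
    by (simp add: linear_0[OF has_derivative_linear[OF E]])
  moreover have "hyperproj k (0::real^'n) = 0" by (simp add: hyperproj_def vec_eq_iff)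
  ultimately show "w = 0" using hyperproj_ident[OF \<open>w \<in> hyperplane k\<close>] by simp
qed

end

definition "graphs = (\<lambda>(k, \<epsilon>). (k, hyperplane k, graph_map k \<epsilon>)) ` (UNIV \<times> {1, -1})"

lemma graphs_finite: "finite graphs" by (simp add: graphs_def)

lemma graphs_local_param: "(k, V, s) \<in> graphs \<Longrightarrow> local_param S k V s"
  by (auto simp: graphs_def graph_local_param)

text \<open>A point of \<open>S\<close> has a nonzero coordinate, since the origin is not in \<open>S\<close>.\<close>

lemma graphs_cover: "S \<subseteq> (\<Union>(k, V, s)\<in>graphs. s ` V)"
proof
  fix y assume y: "y \<in> S"
  then obtain k where k: "y $ k \<noteq> 0" using S_nonzero[OF y] by (auto simp: vec_eq_iff)
  define \<epsilon> :: real where "\<epsilon> = (if y $ k > 0 then 1 else -1)"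
  have "\<epsilon> = 1 \<or> \<epsilon> = -1" "\<epsilon> * y $ k > 0" using k by (auto simp: \<epsilon>_def)
  then have "y \<in> graph_map k \<epsilon> ` hyperplane k" using graph_image y by auto
  moreover have "(k, hyperplane k, graph_map k \<epsilon>) \<in> graphs"
    using \<open>\<epsilon> = 1 \<or> \<epsilon> = -1\<close> by (auto simp: graphs_def)
  ultimately show "y \<in> (\<Union>(k, V, s)\<in>graphs. s ` V)" by blast
qed

end

lemma det_scaleR:
  fixes M :: "real^'n::finite^'n"
  shows "det (\<chi> i j. c * M $ i $ j) = c ^ CARD('n) * det M"
proof -
  have "(\<chi> i j. c * M $ i $ j) = (\<chi> i. c *s (M $ i))" by (simp add: vec_eq_iff)
  then show ?thesis using det_rows_mul[of "\<lambda>_. c" "\<lambda>i. M $ i"] by simp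
qed

lemma continuous_on_det:
  fixes M :: "'a::topological_space \<Rightarrow> real^'n::finite^'n"
  assumes "\<And>i j. continuous_on A (\<lambda>x. M x $ i $ j)"
  shows "continuous_on A (\<lambda>x. det (M x))"
  unfolding det_def by (intro continuous_intros assms)

context star_hypersurface
begin

lemma finite_weighted_integral: "(\<integral>\<^sup>+y. ennreal (H y) * ennreal (tent y) \<partial>lborel) < \<infinity>"
proof -
  have "integrable lborel (\<lambda>y. H y * tent y)" by (rule integrable_mult_tent[OF H_cont])
  then have "(\<integral>\<^sup>+y. ennreal (norm (H y * tent y)) \<partial>lborel) < \<infinity>" by (simp add: integrable_iff_bounded)
  then show ?thesis by (simp add: ennreal_mult H_nonneg tent_nonneg abs_mult)
qed

text \<open>Replace the tent by the shell \<open>1 \<le> f \<le> e\<close> and change variables by \<open>\<Phi>(v) = e^(v\<^sub>k) s(u)\<close>, where \<open>u\<close> is the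
  projection of \<open>v\<close> to the hyperplane. The Jacobian of \<open>\<Phi>\<close> is \<open>e^(n v\<^sub>k)\<close> times the determinant with columns
  \<open>\<partial>\<^sub>i s\<close> and \<open>s\<close> in the \<open>k\<close>-th place; the exponential cancels against the homogeneity of \<open>H\<close>, and the shell
  becomes \<open>0 \<le> v\<^sub>k \<le> 1\<close>. The integrand then is a product, and Fubini's theorem leaves the integral over
  the hyperplane.\<close>

lemma emeasure_\<mu>_local_param:
  assumes lp: "local_param S k V s" and B: "B \<in> sets (restrict_space borel S)" and BV: "B \<subseteq> s ` V"
  shows "emeasure \<mu> B = (\<integral>\<^sup>+ u. indicator V u * indicator B (s u) *
     ennreal \<bar>\<alpha> (s u) ((\<lambda>i. partial i (s \<circ> hyperproj k) u)(k := l (s u)))\<bar> \<partial>hyperplane_measure k)"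
proof -
  define \<sigma> where "\<sigma> = s \<circ> hyperproj k"
  define U where "U = hyperproj k -` V"
  define D where "D v = frechet_derivative \<sigma> (at v)" for v
  \<comment> \<open>\<open>N v\<close> has the columns \<open>\<partial>\<^sub>i \<sigma>\<close>, with \<open>\<sigma>\<close> itself in place of the vanishing column \<open>\<partial>\<^sub>k \<sigma>\<close>.\<close>
  define N :: "real^'n \<Rightarrow> real^'n^'n" where "N v = (\<chi> i j. ((\<lambda>i. partial i \<sigma> v)(k := \<sigma> v)) j $ i)" for v
  define \<Phi> where "\<Phi> v = exp (v $ k) *\<^sub>R \<sigma> v" for v
  define \<Phi>' where "\<Phi>' v h = (exp (v $ k) * h $ k) *\<^sub>R \<sigma> v + exp (v $ k) *\<^sub>R D v h" for v h
  define shell where "shell = {y. y \<noteq> 0 \<and> 1 \<le> f y \<and> f y \<le> exp 1}"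
  define g where "g y = H y * indicator (proj -` B) y * indicator shell y" for y
  from lp have V: "openin (top_of_set (hyperplane k)) V" and sV: "openin (top_of_set S) (s ` V)"
    and hom': "homeomorphism V (s ` V) s (inv_into V s)" and sm: "smooth_on U \<sigma>"
    unfolding local_param_def U_def \<sigma>_def by auto
  have Vh: "V \<subseteq> hyperplane k" using openin_subset[OF V] by simp
  have VU: "V \<subseteq> U" using Vh hyperproj_ident[of _ k] by (auto simp: U_def subset_iff)
  have \<sigma>V: "\<sigma> u = s u" if "u \<in> V" for u using hyperproj_ident[of u k] Vh that by (auto simp: \<sigma>_def)
  have sS: "s u \<in> S" if "u \<in> V" for u using openin_imp_subset[OF sV] that by auto
  have f1: "f (s u) = 1" "s u \<noteq> 0" if "u \<in> V" for u using sS[OF that] S_nonzero by (auto simp: S_def)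
  have f\<sigma>: "f (\<sigma> v) = 1" "\<sigma> v \<noteq> 0" if "v \<in> U" for v
    using f1[of "hyperproj k v"] that by (auto simp: \<sigma>_def U_def)
  have sinj: "inj_on s V"
    by (rule inj_on_inverseI[where g="inv_into V s"]) (rule homeomorphism_apply1[OF hom'])
  have U: "open U" by (rule smooth_on_open[OF sm])
  have \<sigma>D: "(\<sigma> has_derivative D v) (at v)" if "v \<in> U" for v
    unfolding D_def by (rule smooth_on_has_derivative[OF sm that])
  have \<Phi>D: "(\<Phi> has_derivative \<Phi>' v) (at v)" if "v \<in> U" for v
  proof -
    have "((\<lambda>v. exp (v $ k)) has_derivative (\<lambda>h. exp (v $ k) * h $ k)) (at v)"
      by (auto intro!: derivative_eq_intros bounded_linear_imp_has_derivative bounded_linear_vec_nth)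
    from has_derivative_scaleR[OF this \<sigma>D[OF that]]
    show ?thesis unfolding \<Phi>_def \<Phi>'_def by (simp add: add.commute)
  qed
  have f\<Phi>: "f (\<Phi> v) = exp (v $ k)" if "v \<in> U" for v
    using f\<sigma>[OF that] by (simp add: \<Phi>_def hom)
  have inj: "inj_on \<Phi> U"
  proof (rule inj_onI)
    fix v w assume vw: "v \<in> U" "w \<in> U" "\<Phi> v = \<Phi> w"
    then have "exp (v $ k) = exp (w $ k)" using f\<Phi>[OF vw(1)] f\<Phi>[OF vw(2)] by simp
    then have k: "v $ k = w $ k" by simp
    then have "\<sigma> v = \<sigma> w" using vw(3) by (simp add: \<Phi>_def)
    then have "hyperproj k v = hyperproj k w"
      using vw inj_onD[OF sinj, of "hyperproj k v" "hyperproj k w"] by (simp add: \<sigma>_def U_def)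
    have "v = hyperproj k v + axis k (v $ k)" by (rule hyperproj_decomp[symmetric])
    also have "\<dots> = hyperproj k w + axis k (w $ k)" by (simp only: k \<open>hyperproj k v = _\<close>)
    also have "\<dots> = w" by (rule hyperproj_decomp)
    finally show "v = w" .
  qed
  have det\<Phi>: "det (matrix (\<Phi>' v)) = exp (v $ k) ^ CARD('n) * det (N v)" if "v \<in> U" for v
  proof -
    have "D v (axis k 1) = 0" using \<sigma>D[OF that] unfolding \<sigma>_def by (rule hyperproj_derivative_axis)
    then have "\<Phi>' v (axis j 1) = exp (v $ k) *\<^sub>R ((\<lambda>i. partial i \<sigma> v)(k := \<sigma> v)) j" for j
      by (auto simp: \<Phi>'_def partial_def D_def axis_def)
    then have "matrix (\<Phi>' v) = (\<chi> i j. exp (v $ k) * N v $ i $ j)"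
      by (simp add: matrix_def N_def)
    then show ?thesis using det_scaleR[of "exp (v $ k)" "N v"] by simp
  qed
  have N_shift: "N v = N (hyperproj k v)" if "v \<in> U" for v
  proof -
    have "(\<sigma> has_derivative D v) (at (hyperproj k v))" unfolding \<sigma>_def
      by (rule hyperproj_has_derivative_shift[OF \<sigma>D[OF that, unfolded \<sigma>_def]]) (simp add: hyperproj_ident)
    then have "frechet_derivative \<sigma> (at (hyperproj k v)) = D v" by (rule frechet_derivative_eq)
    moreover have "\<sigma> (hyperproj k v) = \<sigma> v" by (simp add: \<sigma>_def hyperproj_ident)
    ultimately show ?thesis by (simp add: N_def partial_def D_def)
  qed
  have N_cont: "continuous_on U (\<lambda>v. det (N v))"
  proof (rule continuous_on_det)
    fix i j
    have "continuous_on U (\<lambda>v. ((\<lambda>i. partial i \<sigma> v)(k := \<sigma> v)) j)"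
      by (cases "j = k") (auto simp: partial_def intro: smooth_on_continuous smooth_on_derivative sm)
    then show "continuous_on U (\<lambda>v. N v $ i $ j)"
      unfolding N_def by (simp add: continuous_on_component)
  qed
  have [measurable]: "U \<in> sets borel" using U by simp
  have pB [measurable]: "proj -` B \<in> sets borel" using measurable_sets[OF proj_meas_S B] by simp
  have [measurable]: "shell \<in> sets borel" unfolding shell_def by measurable
  have J: "(\<lambda>v. indicator U v * det (matrix (\<Phi>' v))) \<in> borel_measurable borel"
  proof -
    have "continuous_on U (\<lambda>v. exp (v $ k) ^ CARD('n) * det (N v))"
      by (intro continuous_intros N_cont)
    then have "continuous_on U (\<lambda>v. det (matrix (\<Phi>' v)))"
      by (rule continuous_on_eq) (simp add: det\<Phi>)
    then show ?thesis using borel_measurable_continuous_on_indicator[of U "\<lambda>v. det (matrix (\<Phi>' v))"] U by simp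
  qed
  have gm [measurable]: "g \<in> borel_measurable borel" unfolding g_def by measurable
  have g0: "0 \<le> g y" for y by (simp add: g_def H_nonneg)
  let ?HB = "\<lambda>y. ennreal (H y) * indicator (proj -` B) y"
  have HBhom: "?HB (exp r *\<^sub>R y) * ennreal (exp r ^ CARD('n)) = ?HB y" if "y \<noteq> 0" for r y
  proof -
    have "indicator (proj -` B) (exp r *\<^sub>R y) = (indicator (proj -` B) y :: ennreal)"
      using proj_scale[of "exp r" y] that by (auto simp: indicator_def)
    moreover have "ennreal (H (exp r *\<^sub>R y)) * ennreal (exp r ^ CARD('n)) = ennreal (H y)"
      using H_scale[of "exp r" y] by (simp add: ennreal_mult[symmetric] H_nonneg)
    ultimately show ?thesis by (metis mult.assoc mult.commute)
  qed
  have shell_rd: "radial_density (\<lambda>y. indicator shell y)" unfolding shell_def by (rule radial_density_shell)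
  have eq1: "emeasure \<mu> B = (\<integral>\<^sup>+y. ?HB y * ennreal (tent y) \<partial>lborel)"
    by (rule emeasure_\<mu>[OF B])
  have eq2: "\<dots> = (\<integral>\<^sup>+y. ?HB y * indicator shell y \<partial>lborel)"
    by (rule nn_integral_homogeneous_radial[OF _ HBhom radial_density_tent shell_rd]) measurable
  have eq3: "\<dots> = (\<integral>\<^sup>+y. ennreal (g y) \<partial>lborel)"
    by (rule nn_integral_cong) (auto simp: g_def indicator_def)
  have gint: "integrable lborel g"
  proof -
    have "(\<integral>\<^sup>+y. ?HB y * ennreal (tent y) \<partial>lborel) \<le> (\<integral>\<^sup>+y. ennreal (H y) * ennreal (tent y) \<partial>lborel)"
      by (rule nn_integral_mono) (auto simp: indicator_def)
    also have "\<dots> < \<infinity>" by (rule finite_weighted_integral)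
    finally have "(\<integral>\<^sup>+y. ennreal (g y) \<partial>lborel) < \<infinity>" using eq2 eq3 by simp
    then show ?thesis using g0 by (simp add: integrable_iff_bounded)
  qed
  \<comment> \<open>As \<open>B\<close> lies in the patch, the polar coordinates cover the cone over \<open>B\<close>.\<close>
  have supp: "y \<in> \<Phi> ` U" if "g y \<noteq> 0" for y
  proof -
    have y: "y \<noteq> 0" "proj y \<in> B" using that by (auto simp: g_def shell_def indicator_def split: if_splits)
    then obtain u where u: "u \<in> V" "proj y = s u" using BV by auto
    have "f y > 0" by (rule pos[OF y(1)])
    define v where "v = u + axis k (ln (f y))"
    have uh: "u \<in> hyperplane k" using u Vh by auto
    have "hyperproj k v = u" unfolding v_def by (rule hyperproj_add_axis[OF uh])
    moreover have "v $ k = ln (f y)" using uh by (simp add: v_def hyperplane_def)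
    ultimately have "\<Phi> v = y" "v \<in> U"
      using u y \<open>f y > 0\<close> by (auto simp: \<Phi>_def \<sigma>_def U_def proj_def u(2)[symmetric])
    then show ?thesis by blast
  qed
  have eq4: "(\<integral>\<^sup>+y. ennreal (g y) \<partial>lborel) = (\<integral>\<^sup>+y. ennreal (g y) * indicator (\<Phi> ` U) y \<partial>lborel)"
  proof (rule nn_integral_cong)
    show "ennreal (g y) = ennreal (g y) * indicator (\<Phi> ` U) y" for y
      using supp[of y] by (cases "g y = 0") auto
  qed
  have eq5: "\<dots> = (\<integral>\<^sup>+v. ennreal (\<bar>det (matrix (\<Phi>' v))\<bar> * g (\<Phi> v)) * indicator U v \<partial>lborel)"
    by (rule nn_integral_change_of_variables[OF U \<Phi>D inj gint g0 J])
  define \<Theta> where "\<Theta> u = indicator V u * indicator B (s u) * ennreal \<bar>\<rho> (s u) * det (N u)\<bar>" for u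
  have eq6: "ennreal (\<bar>det (matrix (\<Phi>' v))\<bar> * g (\<Phi> v)) * indicator U v = indicator {0..1} (v $ k) * \<Theta> (hyperproj k v)" for v
  proof (cases "v \<in> U")
    case False
    then show ?thesis by (auto simp: \<Theta>_def U_def)
  next
    case True
    then have uV: "hyperproj k v \<in> V" by (simp add: U_def)
    have p: "proj (\<Phi> v) = \<sigma> v"
      using f\<sigma>[OF True] by (simp add: \<Phi>_def proj_scale proj_S S_def)
    have "\<Phi> v \<noteq> 0" using f\<sigma>[OF True] by (simp add: \<Phi>_def)
    then have sh: "indicator shell (\<Phi> v) = (indicator {0..1} (v $ k) :: real)"
      using f\<Phi>[OF True] by (auto simp: shell_def indicator_def)
    have "exp (v $ k) ^ CARD('n) * H (\<Phi> v) = \<rho> (\<sigma> v)"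
      using H_scale[of "exp (v $ k)" "\<sigma> v"] f\<sigma>[OF True] by (simp add: \<Phi>_def H_def mult.commute)
    moreover have "\<rho> (\<sigma> v) \<ge> 0" using \<rho>_nonneg f\<sigma>[OF True] by simp
    ultimately have "\<bar>det (matrix (\<Phi>' v))\<bar> * g (\<Phi> v) =
        \<bar>\<rho> (\<sigma> v) * det (N v)\<bar> * indicator B (\<sigma> v) * indicator {0..1} (v $ k)"
      unfolding g_def sh det\<Phi>[OF True] using p by (auto simp: abs_mult indicator_def mult_ac)
    moreover have "\<sigma> v = s (hyperproj k v)" by (simp add: \<sigma>_def)
    ultimately show ?thesis using True uV N_shift[OF True] by (auto simp: \<Theta>_def indicator_def)
  qed
  have \<Theta>m: "\<Theta> \<in> borel_measurable borel"
  proof -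
    have Vb [measurable]: "V \<in> sets borel"
    proof -
      obtain T where "open T" "V = hyperplane k \<inter> T" using V by (auto simp: openin_open)
      moreover have "hyperplane k \<in> sets borel" unfolding hyperplane_def by measurable
      ultimately show ?thesis by auto
    qed
    have sc: "continuous_on V s" using hom' by (simp add: homeomorphism_def)
    have m1: "(\<lambda>u. if u \<in> V then s u else 0) \<in> borel_measurable borel"
      by (rule borel_measurable_continuous_on_if) (auto intro: sc)
    have "continuous_on V (\<lambda>u. \<rho> (s u))"
      by (rule continuous_on_compose2[OF \<rho>_cont sc]) (use f1 in auto)
    then have "continuous_on V (\<lambda>u. \<rho> (s u) * det (N u))"
      by (intro continuous_intros continuous_on_subset[OF N_cont VU])
    then have m2 [measurable]: "(\<lambda>u. indicator V u *\<^sub>R (\<rho> (s u) * det (N u))) \<in> borel_measurable borel"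
      by (rule borel_measurable_continuous_on_indicator[OF Vb])
    have "B \<in> sets borel" using B by (auto simp: sets_restrict_space)
    then have m3 [measurable]: "(\<lambda>u. indicator B (if u \<in> V then s u else 0) :: ennreal) \<in> borel_measurable borel"
      using measurable_compose[OF m1, of "indicator B" borel] by simp
    have "\<Theta> = (\<lambda>u. indicator V u * indicator B (if u \<in> V then s u else 0) * ennreal \<bar>indicator V u *\<^sub>R (\<rho> (s u) * det (N u))\<bar>)"
      by (auto simp: \<Theta>_def indicator_def fun_eq_iff)
    moreover have "(\<lambda>u. indicator V u * indicator B (if u \<in> V then s u else 0) * ennreal \<bar>indicator V u *\<^sub>R (\<rho> (s u) * det (N u))\<bar>) \<in> borel_measurable borel"
      by (intro borel_measurable_times_ennreal m3 measurable_compose[OF m2 borel_measurable_abs, THEN measurable_compose[OF _ measurable_ennreal]]) measurable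
    ultimately show ?thesis by simp
  qed
  have "emeasure \<mu> B = (\<integral>\<^sup>+v. indicator {0..1} (v $ k) * \<Theta> (hyperproj k v) \<partial>lborel)"
    unfolding eq1 eq2 eq3 eq4 eq5 eq6 ..
  also have "\<dots> = (\<integral>\<^sup>+u. \<Theta> u \<partial>hyperplane_measure k)"
    using nn_integral_hyperplane[OF \<Theta>m, of "indicator {0..1}" k] by simp
  also have "\<Theta> = (\<lambda>u. indicator V u * indicator B (s u) *
     ennreal \<bar>\<alpha> (s u) ((\<lambda>i. partial i (s \<circ> hyperproj k) u)(k := l (s u)))\<bar>)"
  proof
    fix u
    show "\<Theta> u = indicator V u * indicator B (s u) *
     ennreal \<bar>\<alpha> (s u) ((\<lambda>i. partial i (s \<circ> hyperproj k) u)(k := l (s u)))\<bar>"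
    proof (cases "u \<in> V")
      case True
      have "(\<lambda>i. partial i (s \<circ> hyperproj k) u)(k := l (s u)) = (\<lambda>i. partial i \<sigma> u)(k := \<sigma> u)"
        using True f1 \<sigma>V by (simp add: l_def \<sigma>_def)
      then show ?thesis using True f1 by (simp add: \<Theta>_def \<alpha>_def N_def)
    qed (simp add: \<Theta>_def)
  qed
  finally show ?thesis .
qed

theorem hypersurface_measure_eq: "hypersurface_measure S \<alpha> l = \<mu>"
proof (rule hypersurface_measure_eqI[OF _ graphs_finite graphs_local_param graphs_cover])
  have sets: "sets \<mu> = sets (restrict_space borel S)" and space: "space \<mu> = S"
    by (auto simp: \<mu>_def space_restrict_space)
  show "contracted_form_measure S \<alpha> l \<mu>"
    unfolding contracted_form_measure_def sets space
    using emeasure_\<mu>_local_param by blast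
qed

end

section \<open>Second derivatives\<close>

definition second_derivative :: "('a::euclidean_space \<Rightarrow> real) \<Rightarrow> 'a \<Rightarrow> 'a \<Rightarrow> 'a \<Rightarrow> real" where
  "second_derivative E y u v = frechet_derivative (\<lambda>z. frechet_derivative E (at z) v) (at y) u"

lemma line_has_derivative:
  fixes E :: "'a::euclidean_space \<Rightarrow> real"
  assumes "(E has_derivative D) (at (y + t *\<^sub>R u))"
  shows "((\<lambda>t. E (y + t *\<^sub>R u)) has_real_derivative D u) (at t)"
proof -
  have "((\<lambda>t. y + t *\<^sub>R u) has_derivative (\<lambda>t. t *\<^sub>R u)) (at t)"
    by (auto intro!: derivative_eq_intros)
  from has_derivative_compose[OF this assms]
  have "((\<lambda>t. E (y + t *\<^sub>R u)) has_derivative (\<lambda>h. D (h *\<^sub>R u))) (at t)" .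
  moreover have "D (h *\<^sub>R u) = D u * h" for h
    using linear_scale[OF has_derivative_linear[OF assms]] by simp
  ultimately show ?thesis by (simp add: has_field_derivative_def)
qed

text \<open>The mean value theorem, once in each direction.\<close>

lemma second_difference:
  fixes E :: "'a::euclidean_space \<Rightarrow> real"
  assumes E: "smooth_on S E" and h: "h > 0"
    and inS: "\<And>s t. 0 \<le> s \<Longrightarrow> s \<le> h \<Longrightarrow> 0 \<le> t \<Longrightarrow> t \<le> h \<Longrightarrow> y + s *\<^sub>R u + t *\<^sub>R v \<in> S"
  shows "\<exists>s t. 0 < s \<and> s < h \<and> 0 < t \<and> t < h \<and>
    E (y + h *\<^sub>R u + h *\<^sub>R v) - E (y + h *\<^sub>R u) - E (y + h *\<^sub>R v) + E y =
      h^2 * second_derivative E (y + s *\<^sub>R u + t *\<^sub>R v) v u"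
proof -
  let ?D = "\<lambda>z. frechet_derivative E (at z)"
  have d1: "((\<lambda>s. E (y + s *\<^sub>R u + t *\<^sub>R v)) has_real_derivative ?D (y + s *\<^sub>R u + t *\<^sub>R v) u) (at s)"
    if "0 \<le> s" "s \<le> h" "0 \<le> t" "t \<le> h" for s t
    using line_has_derivative[of E "?D (y + s *\<^sub>R u + t *\<^sub>R v)" "y + t *\<^sub>R v" s u]
      smooth_on_has_derivative[OF E inS[OF that]] by (simp add: algebra_simps)
  have d2: "((\<lambda>t. ?D (y + s *\<^sub>R u + t *\<^sub>R v) u) has_real_derivative second_derivative E (y + s *\<^sub>R u + t *\<^sub>R v) v u) (at t)"
    if "0 \<le> s" "s \<le> h" "0 \<le> t" "t \<le> h" for s t
    unfolding second_derivative_def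
    by (rule line_has_derivative) (rule smooth_on_has_derivative[OF smooth_on_derivative[OF E] inS[OF that]])
  have "\<exists>s. 0 < s \<and> s < h \<and> (E (y + h *\<^sub>R u + h *\<^sub>R v) - E (y + h *\<^sub>R u + 0 *\<^sub>R v)) - (E (y + 0 *\<^sub>R u + h *\<^sub>R v) - E (y + 0 *\<^sub>R u + 0 *\<^sub>R v))
      = (h - 0) * (?D (y + s *\<^sub>R u + h *\<^sub>R v) u - ?D (y + s *\<^sub>R u + 0 *\<^sub>R v) u)"
    by (rule MVT2[OF h]) (use h in \<open>auto intro!: DERIV_diff d1 d1[where t=0, simplified]\<close>)
  then obtain s where s: "0 < s" "s < h" and es: "(E (y + h *\<^sub>R u + h *\<^sub>R v) - E (y + h *\<^sub>R u + 0 *\<^sub>R v)) - (E (y + 0 *\<^sub>R u + h *\<^sub>R v) - E (y + 0 *\<^sub>R u + 0 *\<^sub>R v))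
      = (h - 0) * (?D (y + s *\<^sub>R u + h *\<^sub>R v) u - ?D (y + s *\<^sub>R u + 0 *\<^sub>R v) u)" by blast
  have "\<exists>t. 0 < t \<and> t < h \<and> ?D (y + s *\<^sub>R u + h *\<^sub>R v) u - ?D (y + s *\<^sub>R u + 0 *\<^sub>R v) u
      = (h - 0) * second_derivative E (y + s *\<^sub>R u + t *\<^sub>R v) v u"
    by (rule MVT2[OF h]) (use s in \<open>auto intro!: d2 d2[where t=0, simplified]\<close>)
  then obtain t where t: "0 < t" "t < h" and et: "?D (y + s *\<^sub>R u + h *\<^sub>R v) u - ?D (y + s *\<^sub>R u + 0 *\<^sub>R v) u
      = (h - 0) * second_derivative E (y + s *\<^sub>R u + t *\<^sub>R v) v u" by blast
  have "E (y + h *\<^sub>R u + h *\<^sub>R v) - E (y + h *\<^sub>R u) - E (y + h *\<^sub>R v) + E y =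
      h^2 * second_derivative E (y + s *\<^sub>R u + t *\<^sub>R v) v u"
    using es unfolding et by (simp add: power2_eq_square algebra_simps)
  with s t show ?thesis by blast
qed

text \<open>The second difference is symmetric in \<open>u\<close> and \<open>v\<close>, so by \<open>second_difference\<close> the two mixed derivatives agree at
  some pair of points arbitrarily close to \<open>y\<close>; continuity gives equality at \<open>y\<close>.\<close>

lemma second_derivative_commute:
  fixes E :: "'a::euclidean_space \<Rightarrow> real"
  assumes E: "smooth_on S E" and y: "y \<in> S"
  shows "second_derivative E y u v = second_derivative E y v u"
proof (rule ccontr)
  assume ne: "second_derivative E y u v \<noteq> second_derivative E y v u"
  define e where "e = \<bar>second_derivative E y u v - second_derivative E y v u\<bar> / 2"
  have e: "e > 0" using ne by (simp add: e_def)
  have "open S" by (rule smooth_on_open[OF E])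
  have cont: "\<exists>d>0. \<forall>z. dist z y < d \<longrightarrow> dist (second_derivative E z a b) (second_derivative E y a b) < e" for a b
  proof -
    have "continuous_on S (\<lambda>z. second_derivative E z a b)"
      unfolding second_derivative_def by (intro smooth_on_continuous smooth_on_derivative E)
    then have "isCont (\<lambda>z. second_derivative E z a b) y"
      using \<open>open S\<close> y by (simp add: continuous_on_eq_continuous_at)
    then show ?thesis using e unfolding continuous_at_eps_delta by blast
  qed
  obtain d1 where d1: "d1 > 0" "\<And>z. dist z y < d1 \<Longrightarrow> dist (second_derivative E z u v) (second_derivative E y u v) < e"
    using cont by blast
  obtain d2 where d2: "d2 > 0" "\<And>z. dist z y < d2 \<Longrightarrow> dist (second_derivative E z v u) (second_derivative E y v u) < e"
    using cont by blast
  obtain d3 where d3: "d3 > 0" "ball y d3 \<subseteq> S" using \<open>open S\<close> y by (meson open_contains_ball)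
  define d where "d = min d1 (min d2 d3)"
  have d: "d > 0" using d1 d2 d3 by (simp add: d_def)
  define M where "M = norm u + norm v + 1"
  \<comment> \<open>Small enough for the parallelogram with sides \<open>h u\<close> and \<open>h v\<close> to stay within distance \<open>d\<close> of \<open>y\<close>.\<close>
  define h where "h = d / (2 * M)"
  have N: "M > 0" unfolding M_def by (smt (verit) norm_ge_zero)
  have h: "h > 0" using d N by (simp add: h_def)
  have near: "dist (y + s *\<^sub>R a + t *\<^sub>R b) y < d" if "0 \<le> s" "s \<le> h" "0 \<le> t" "t \<le> h" "(a, b) = (u, v) \<or> (a, b) = (v, u)" for s t a b
  proof -
    have "dist (y + s *\<^sub>R a + t *\<^sub>R b) y = norm (s *\<^sub>R a + t *\<^sub>R b)" by (simp add: dist_norm algebra_simps)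
    also have "\<dots> \<le> s * norm a + t * norm b" using norm_triangle_ineq[of "s *\<^sub>R a" "t *\<^sub>R b"] that by simp
    also have "\<dots> \<le> h * norm a + h * norm b" using that by (intro add_mono mult_right_mono) auto
    also have "\<dots> \<le> h * M" using that(5) h by (auto simp: algebra_simps M_def)
    also have "\<dots> = d / 2" using N by (simp add: h_def)
    also have "\<dots> < d" using d by simp
    finally show ?thesis .
  qed
  have inS: "y + s *\<^sub>R a + t *\<^sub>R b \<in> S" if "0 \<le> s" "s \<le> h" "0 \<le> t" "t \<le> h" "(a, b) = (u, v) \<or> (a, b) = (v, u)" for s t a b
    using near[OF that] d3 by (auto simp: d_def dist_commute subset_iff)
  obtain s t where st: "0 < s" "s < h" "0 < t" "t < h"
    "E (y + h *\<^sub>R u + h *\<^sub>R v) - E (y + h *\<^sub>R u) - E (y + h *\<^sub>R v) + E y = h^2 * second_derivative E (y + s *\<^sub>R u + t *\<^sub>R v) v u"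
    using second_difference[OF E h, of y u v] inS by blast
  obtain s' t' where st': "0 < s'" "s' < h" "0 < t'" "t' < h"
    "E (y + h *\<^sub>R v + h *\<^sub>R u) - E (y + h *\<^sub>R v) - E (y + h *\<^sub>R u) + E y = h^2 * second_derivative E (y + s' *\<^sub>R v + t' *\<^sub>R u) u v"
    using second_difference[OF E h, of y v u] inS by blast
  have "E (y + h *\<^sub>R v + h *\<^sub>R u) = E (y + h *\<^sub>R u + h *\<^sub>R v)" by (simp add: add_ac)
  then have "h^2 * second_derivative E (y + s *\<^sub>R u + t *\<^sub>R v) v u = h^2 * second_derivative E (y + s' *\<^sub>R v + t' *\<^sub>R u) u v"
    using st(5) st'(5) by linarith
  then have eq: "second_derivative E (y + s *\<^sub>R u + t *\<^sub>R v) v u = second_derivative E (y + s' *\<^sub>R v + t' *\<^sub>R u) u v"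
    using h by simp
  have "dist (second_derivative E (y + s *\<^sub>R u + t *\<^sub>R v) v u) (second_derivative E y v u) < e"
    using near[of s t u v] st by (intro d2) (auto simp: d_def)
  moreover have "dist (second_derivative E (y + s' *\<^sub>R v + t' *\<^sub>R u) u v) (second_derivative E y u v) < e"
    using near[of s' t' v u] st' by (intro d1) (auto simp: d_def)
  ultimately show False using eq by (auto simp: dist_real_def e_def abs_if split: if_splits)
qed

lemma frechet_derivative_linear_smooth:
  "smooth_on S E \<Longrightarrow> z \<in> S \<Longrightarrow> linear (frechet_derivative E (at z))"
  using smooth_on_has_derivative has_derivative_linear by blast

lemma second_derivative_linear_left:
  fixes E :: "'a::euclidean_space \<Rightarrow> real"
  assumes E: "smooth_on S E" and y: "y \<in> S"
  shows "linear (\<lambda>u. second_derivative E y u v)"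
  unfolding second_derivative_def
  by (rule frechet_derivative_linear_smooth[OF smooth_on_derivative[OF E] y])

lemma second_derivative_linear_right:
  fixes E :: "'a::euclidean_space \<Rightarrow> real"
  assumes E: "smooth_on S E" and y: "y \<in> S"
  shows "linear (\<lambda>v. second_derivative E y u v)"
  unfolding second_derivative_commute[OF assms, of u] by (rule second_derivative_linear_left[OF assms])

section \<open>Homogeneous functions\<close>

text \<open>Differentiate the homogeneity relation in \<open>y\<close>.\<close>

lemma frechet_derivative_homogeneous:
  fixes E :: "'a::euclidean_space \<Rightarrow> real"
  assumes E: "smooth_on (UNIV - {0}) E" and hom: "\<And>a y. a > 0 \<Longrightarrow> y \<noteq> 0 \<Longrightarrow> E (a *\<^sub>R y) = a ^ Suc m * E y"
    and "a > 0" "y \<noteq> 0"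
  shows "frechet_derivative E (at (a *\<^sub>R y)) v = a ^ m * frechet_derivative E (at y) v"
proof -
  let ?D = "\<lambda>y. frechet_derivative E (at y)"
  have D: "(E has_derivative ?D z) (at z)" if "z \<noteq> 0" for z
    by (rule smooth_on_has_derivative[OF E]) (use that in auto)
  have "((\<lambda>z. a *\<^sub>R z) has_derivative (\<lambda>h. a *\<^sub>R h)) (at y)" by (auto intro!: derivative_eq_intros)
  then have 1: "((\<lambda>z. E (a *\<^sub>R z)) has_derivative (\<lambda>h. ?D (a *\<^sub>R y) (a *\<^sub>R h))) (at y)"
    by (rule has_derivative_compose) (rule D, use assms in auto)
  have "((\<lambda>z. a ^ Suc m * E z) has_derivative (\<lambda>h. a ^ Suc m * ?D y h)) (at y)"
    by (intro has_derivative_mult_right D assms)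
  then have 2: "((\<lambda>z. E (a *\<^sub>R z)) has_derivative (\<lambda>h. a ^ Suc m * ?D y h)) (at y)"
    by (rule has_derivative_transform_within_open[of _ _ _ _ "UNIV - {0}"]) (use assms in auto)
  have "?D (a *\<^sub>R y) (a *\<^sub>R v) = a ^ Suc m * ?D y v"
    by (rule fun_cong[OF has_derivative_unique[OF 1 2]])
  moreover have "?D (a *\<^sub>R y) (a *\<^sub>R v) = a * ?D (a *\<^sub>R y) v"
    using linear_scale[OF has_derivative_linear[OF D]] assms by simp
  ultimately show ?thesis using \<open>a > 0\<close> by simp
qed

text \<open>Differentiate the homogeneity relation in \<open>a\<close> at \<open>a = 1\<close>.\<close>

lemma euler_homogeneous:
  fixes E :: "'a::euclidean_space \<Rightarrow> real"
  assumes E: "smooth_on (UNIV - {0}) E" and hom: "\<And>a y. a > 0 \<Longrightarrow> y \<noteq> 0 \<Longrightarrow> E (a *\<^sub>R y) = a ^ m * E y"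
    and y: "y \<noteq> 0"
  shows "frechet_derivative E (at y) y = real m * E y"
proof -
  have "(E has_derivative frechet_derivative E (at y)) (at (0 + 1 *\<^sub>R y))"
    using smooth_on_has_derivative[OF E, of y] y by simp
  from line_has_derivative[OF this]
  have 1: "((\<lambda>t. E (t *\<^sub>R y)) has_real_derivative frechet_derivative E (at y) y) (at 1)" by simp
  have "((\<lambda>t. t ^ m * E y) has_real_derivative real m * E y) (at 1)"
    by (auto intro!: derivative_eq_intros)
  then have 2: "((\<lambda>t. E (t *\<^sub>R y)) has_real_derivative real m * E y) (at 1)"
    by (rule has_field_derivative_transform_within_open[of _ _ _ "{0<..}"]) (use hom y in auto)
  show ?thesis by (rule DERIV_unique[OF 1 2])
qed

section \<open>Integrals depending on a parameter\<close>

lemma Ck_on_imp_continuous: "Ck_on k S f \<Longrightarrow> continuous_on S f"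
proof (induction k)
  case (Suc k) then show ?case using Ck_on_Suc_imp by blast
qed simp

context
  fixes U :: "'a::euclidean_space set" and a b :: "real^'n::finite"
  assumes U: "open U"
begin

private definition "par_int \<Psi> x = integral (cbox a b) (\<lambda>y. \<Psi> (x, y) * tent y)"

private lemma cont_tent:
  assumes "continuous_on (U \<times> (UNIV - {0})) (\<Psi> :: 'a \<times> (real^'n) \<Rightarrow> real)"
  shows "continuous_on (U \<times> UNIV) (\<lambda>z. \<Psi> z * tent (snd z))"
proof (rule continuous_on_mult_tent)
  show "open (U \<times> (UNIV :: (real^'n) set))" by (intro open_Times U) auto
  have "{z \<in> U \<times> UNIV. snd z \<noteq> 0} = U \<times> (UNIV - {0::real^'n})" by auto
  then show "continuous_on {z \<in> U \<times> UNIV. snd z \<noteq> 0} \<Psi>" using assms by simp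
qed (intro continuous_intros)

text \<open>Leibniz' rule on a small ball around the parameter. The derivative of the integrand in the direction
  of the parameter is continuous up to the origin of the fibre thanks to the factor \<open>tent\<close>.\<close>

private lemma par_int_has_derivative:
  assumes \<Psi>: "Ck_on (Suc k) (U \<times> (UNIV - {0})) \<Psi>" and x0: "x0 \<in> U"
  shows "(par_int \<Psi> has_derivative (\<lambda>v. par_int (\<lambda>z. frechet_derivative \<Psi> (at z) (v, 0)) x0)) (at x0)"
proof -
  let ?D = "\<lambda>z. frechet_derivative \<Psi> (at z)"
  obtain r where r: "r > 0" "ball x0 r \<subseteq> U" using U x0 by (meson open_contains_ball)
  define fx where "fx x t = Blinfun (\<lambda>v. ?D (x, t) (v, 0) * tent t)" for x t
  have D\<Psi>: "((\<lambda>x. \<Psi> (x, t)) has_derivative (\<lambda>v. ?D (x, t) (v, 0))) (at x)" if "x \<in> U" "t \<noteq> 0" for x t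
  proof -
    have "((\<lambda>x. (x, t)) has_derivative (\<lambda>v. (v, 0))) (at x)" by (auto intro!: derivative_eq_intros)
    then show ?thesis
      by (rule has_derivative_compose) (rule Ck_on_SucD(1)[OF \<Psi>], use that in auto)
  qed
  have D: "((\<lambda>x. \<Psi> (x, t) * tent t) has_derivative (\<lambda>v. ?D (x, t) (v, 0) * tent t)) (at x)" if "x \<in> U" for x t
  proof (cases "t = 0")
    case False
    then show ?thesis using D\<Psi>[OF that] by (intro has_derivative_mult_left) 
  qed (simp add: tent_def)
  have fx: "blinfun_apply (fx x t) = (\<lambda>v. ?D (x, t) (v, 0) * tent t)" if "x \<in> U" for x t
    unfolding fx_def using has_derivative_bounded_linear[OF D[OF that]] by (rule bounded_linear_Blinfun_apply)
  have cont_i: "continuous_on (U \<times> UNIV) (\<lambda>z. ?D z (i, 0) * tent (snd z))" for i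
    by (rule cont_tent) (rule Ck_on_imp_continuous[OF Ck_on_SucD(2)[OF \<Psi>]])
  have cont_fx: "continuous_on (U \<times> UNIV) (\<lambda>(x, t). fx x t)"
  proof (rule continuous_on_blinfun_componentwise)
    fix i :: 'a
    show "continuous_on (U \<times> UNIV) (\<lambda>z. blinfun_apply (case z of (x, t) \<Rightarrow> fx x t) i)"
      by (rule continuous_on_eq[OF cont_i[of i]]) (auto simp: fx)
  qed
  have c\<Psi>: "continuous_on (U \<times> UNIV) (\<lambda>z. \<Psi> z * tent (snd z))"
    by (rule cont_tent) (rule Ck_on_imp_continuous[OF \<Psi>])
  have "((\<lambda>x. integral (cbox a b) (\<lambda>y. \<Psi> (x, y) * tent y)) has_derivative integral (cbox a b) (fx x0)) (at x0 within ball x0 r)"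
  proof (rule leibniz_rule)
    show "((\<lambda>x. \<Psi> (x, t) * tent t) has_derivative blinfun_apply (fx x t)) (at x within ball x0 r)"
      if "x \<in> ball x0 r" for x t
    proof -
      have "x \<in> U" using r that by blast
      then show ?thesis using D[of x t] fx[of x t] by (auto intro: has_derivative_at_withinI)
    qed
    show "(\<lambda>y. \<Psi> (x, y) * tent y) integrable_on cbox a b" if "x \<in> ball x0 r" for x
      by (rule integrable_continuous, rule continuous_on_compose2[OF c\<Psi>, of _ "\<lambda>y. (x, y)", simplified])
        (use that r in \<open>auto intro!: continuous_intros\<close>)
    show "continuous_on (ball x0 r \<times> cbox a b) (\<lambda>(x, t). fx x t)"
      by (rule continuous_on_subset[OF cont_fx]) (use r in auto)
  qed (use r in auto)
  moreover have "at x0 within ball x0 r = at x0" using r by (intro at_within_open) auto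
  moreover have "blinfun_apply (integral (cbox a b) (fx x0)) = (\<lambda>v. par_int (\<lambda>z. ?D z (v, 0)) x0)"
  proof
    fix v
    have "continuous_on (cbox a b) (fx x0)"
      by (rule continuous_on_compose2[OF cont_fx, of _ "\<lambda>y. (x0, y)", simplified])
        (use x0 in \<open>auto intro!: continuous_intros\<close>)
    then have "fx x0 integrable_on cbox a b" by (rule integrable_continuous)
    from integral_linear[OF this blinfun.bounded_linear_left[of v]]
    show "blinfun_apply (integral (cbox a b) (fx x0)) v = par_int (\<lambda>z. ?D z (v, 0)) x0"
      by (simp add: par_int_def comp_def fx[OF x0])
  qed
  ultimately show ?thesis by (simp add: par_int_def[abs_def])
qed

text \<open>A derivative of a parametric integral is a parametric integral of the same kind, so the induction closes.\<close>

private lemma par_int_Ck_on: "Ck_on k (U \<times> (UNIV - {0})) \<Psi> \<Longrightarrow> Ck_on k U (par_int \<Psi>)"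
proof (induction k arbitrary: \<Psi>)
  case 0
  then have "continuous_on (U \<times> UNIV) (\<lambda>z. \<Psi> z * tent (snd z))" by (intro cont_tent) simp
  then have "continuous_on (U \<times> cbox a b) (\<lambda>(x, y). \<Psi> (x, y) * tent y)"
    by (rule continuous_on_eq[OF continuous_on_subset]) auto
  from integral_continuous_on_param[OF this] show ?case by (simp add: par_int_def[abs_def])
next
  case (Suc k)
  show ?case
    by (rule Ck_on_SucI[OF U par_int_has_derivative[OF Suc.prems]];
        (assumption | rule Suc.IH[OF Ck_on_SucD(2)[OF Suc.prems]]))
qed

lemma smooth_on_integral_cbox:
  assumes "smooth_on (U \<times> (UNIV - {0})) \<Psi>"
  shows "smooth_on U (\<lambda>x. integral (cbox a b) (\<lambda>y. \<Psi> (x, y) * tent y))"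
  using assms par_int_Ck_on U unfolding smooth_on_def par_int_def[abs_def] by blast

end

text \<open>The support of \<open>tent\<close> fits into one box, independently of the parameter.\<close>

theorem smooth_on_integral_tent:
  fixes \<Psi> :: "'a::euclidean_space \<times> (real^'n::finite) \<Rightarrow> real"
  assumes U: "open U" and \<Psi>: "smooth_on (U \<times> (UNIV - {0})) \<Psi>"
  shows "smooth_on U (\<lambda>x. \<integral>y. \<Psi> (x, y) * tent y \<partial>lborel)"
proof -
  obtain a :: "real^'n" where a: "cball 0 (exp 1) \<subseteq> cbox (-a) a"
    using bounded_subset_cbox_symmetric[OF bounded_cball] by blast
  have "(\<integral>y. \<Psi> (x, y) * tent y \<partial>lborel) = integral (cbox (-a) a) (\<lambda>y. \<Psi> (x, y) * tent y)" if "x \<in> U" for x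
  proof -
    have "continuous_on (UNIV - {0}) (\<lambda>y. \<Psi> (x, y))"
      by (rule continuous_on_compose2[OF smooth_on_continuous[OF \<Psi>]])
        (use that in \<open>auto intro!: continuous_intros\<close>)
    then have "integrable lborel (\<lambda>y. \<Psi> (x, y) * tent y)" by (rule integrable_mult_tent)
    then have "((\<lambda>y. \<Psi> (x, y) * tent y) has_integral (\<integral>y. \<Psi> (x, y) * tent y \<partial>lborel)) UNIV"
      by (rule has_integral_integral_lborel)
    moreover
    have "\<Psi> (x, y) * tent y = 0" if "y \<notin> cbox (-a) a" for y
    proof -
      have "norm y > exp 1" using that a by (auto simp: subset_iff not_le)
      then show ?thesis by (simp add: tent_eq_0_large)
    qed
    then have "(\<lambda>y. if y \<in> cbox (-a) a then \<Psi> (x, y) * tent y else 0) = (\<lambda>y. \<Psi> (x, y) * tent y)"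
      by (intro ext) (simp split: if_split)
    ultimately have "((\<lambda>y. \<Psi> (x, y) * tent y) has_integral (\<integral>y. \<Psi> (x, y) * tent y \<partial>lborel)) (cbox (-a) a)"
      by (subst has_integral_restrict_UNIV[symmetric]) simp
    then show ?thesis by (simp add: integral_unique)
  qed
  then show ?thesis using smooth_on_integral_cbox[OF U \<Psi>, of "-a" a] by (subst smooth_on_cong) auto
qed

section \<open>Linear changes of variables\<close>

text \<open>Linear isomorphisms map rays to rays with the same parameter.\<close>

lemma radial_density_tent_linear:
  assumes "linear L" "inj L"
  shows "radial_density (\<lambda>y :: real^'n::finite. ennreal (tent (L y :: real^'n)))"
proof -
  have Lm: "L \<in> borel_measurable borel"
    by (intro borel_measurable_continuous_onI linear_continuous_on) (simp add: linear_conv_bounded_linear[symmetric] assms)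
  have "L y \<noteq> 0" if "y \<noteq> 0" for y using that assms linear_injective_0 by blast
  then show ?thesis
    using radial_density_tent measurable_compose[OF Lm, of "\<lambda>y. ennreal (tent y)" borel]
    by (auto simp: radial_density_def linear_scale[OF assms(1)])
qed

text \<open>After the substitution \<open>z = L y\<close> the cutoff is \<open>tent \<circ> L\<close> inverse, a different radial density, which may be
  exchanged for \<open>tent\<close> because \<open>P\<close> is homogeneous of degree \<open>-n\<close>.\<close>

lemma integral_linear_change_nonneg:
  fixes P :: "real^'n::finite \<Rightarrow> real" and L :: "real^'n \<Rightarrow> real^'n"
  assumes P: "continuous_on (UNIV - {0}) P" "\<And>y. 0 \<le> P y" "P 0 = 0"
    and hom: "\<And>a y. a > 0 \<Longrightarrow> y \<noteq> 0 \<Longrightarrow> P (a *\<^sub>R y) * a ^ CARD('n) = P y"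
    and L: "linear L" "inj L"
  shows "(\<integral>y. \<bar>det (matrix L)\<bar> * P (L y) * tent y \<partial>lborel) = (\<integral>y. P y * tent y \<partial>lborel)"
proof -
  obtain K where K: "linear K" "\<And>y. K (L y) = y" "\<And>y. L (K y) = y"
    using linear_injective_isomorphism[OF L] by blast
  have "inj K" by (rule inj_on_inverseI[where g=L]) (rule K)
  have LK [measurable]: "L \<in> borel_measurable borel" "K \<in> borel_measurable borel"
    by (intro borel_measurable_continuous_onI linear_continuous_on; simp add: linear_conv_bounded_linear[symmetric] L K)+
  have Pm [measurable]: "P \<in> borel_measurable borel"
  proof -
    have "(\<lambda>y. if y \<in> UNIV - {0} then P y else 0) \<in> borel_measurable borel"
      by (rule borel_measurable_continuous_on_if) (auto intro: P)
    moreover have "(\<lambda>y. if y \<in> UNIV - {0} then P y else 0) = P" using P by auto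
    ultimately show ?thesis by simp
  qed
  have eP: "ennreal (P (exp r *\<^sub>R y)) * ennreal (exp r ^ CARD('n)) = ennreal (P y)" if "y \<noteq> 0" for r y
    using hom[of "exp r" y] that by (simp add: ennreal_mult[symmetric] P)
  have fin: "(\<integral>\<^sup>+y. ennreal (P y) * ennreal (tent y) \<partial>lborel) < \<infinity>"
    using integrable_mult_tent[OF P(1)] by (simp add: integrable_iff_bounded abs_mult P tent_nonneg ennreal_mult)
  have eq: "(\<integral>\<^sup>+y. ennreal (P y) * ennreal (tent (K y)) \<partial>lborel) = (\<integral>\<^sup>+y. ennreal (P y) * ennreal (tent y) \<partial>lborel)"
    by (rule nn_integral_homogeneous_radial[OF _ eP radial_density_tent_linear[OF K(1) \<open>inj K\<close>] radial_density_tent]) measurable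
  have int: "integrable lborel (\<lambda>y. P y * tent (K y))"
    using fin eq by (simp add: integrable_iff_bounded abs_mult P tent_nonneg ennreal_mult)
  have surj: "L ` UNIV = UNIV" using K(3) by (metis surjI)
  have "(\<integral>\<^sup>+y. ennreal (P y * tent (K y)) * indicator (L ` UNIV) y \<partial>lborel) =
      (\<integral>\<^sup>+y. ennreal (\<bar>det (matrix L)\<bar> * (P (L y) * tent (K (L y)))) * indicator UNIV y \<partial>lborel)"
    by (rule nn_integral_change_of_variables[OF open_UNIV _ L(2) int])
      (auto simp: P tent_nonneg linear_imp_has_derivative[OF L(1)])
  then have "(\<integral>\<^sup>+y. ennreal (P y * tent (K y)) \<partial>lborel) = (\<integral>\<^sup>+y. ennreal (\<bar>det (matrix L)\<bar> * P (L y) * tent y) \<partial>lborel)"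
    by (simp add: surj K mult.assoc)
  moreover have "(\<integral>\<^sup>+y. ennreal (P y * tent (K y)) \<partial>lborel) = (\<integral>\<^sup>+y. ennreal (P y * tent y) \<partial>lborel)"
    using eq by (simp add: ennreal_mult P tent_nonneg)
  moreover have "(\<integral>y. \<bar>det (matrix L)\<bar> * P (L y) * tent y \<partial>lborel) = enn2real (\<integral>\<^sup>+y. ennreal (\<bar>det (matrix L)\<bar> * P (L y) * tent y) \<partial>lborel)"
    by (rule integral_eq_nn_integral) (auto simp: P tent_nonneg)
  moreover have "(\<integral>y. P y * tent y \<partial>lborel) = enn2real (\<integral>\<^sup>+y. ennreal (P y * tent y) \<partial>lborel)"
    by (rule integral_eq_nn_integral) (auto simp: P tent_nonneg)
  ultimately show ?thesis by simp
qed

text \<open>Positive and negative part are homogeneous of the same degree.\<close>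

lemma integral_linear_change:
  fixes P :: "real^'n::finite \<Rightarrow> real" and L :: "real^'n \<Rightarrow> real^'n"
  assumes P: "continuous_on (UNIV - {0}) P" "P 0 = 0"
    and hom: "\<And>a y. a > 0 \<Longrightarrow> y \<noteq> 0 \<Longrightarrow> P (a *\<^sub>R y) * a ^ CARD('n) = P y"
    and L: "linear L" "inj L"
  shows "(\<integral>y. \<bar>det (matrix L)\<bar> * P (L y) * tent y \<partial>lborel) = (\<integral>y. P y * tent y \<partial>lborel)"
proof -
  define P1 where "P1 y = max (P y) 0" for y
  define P2 where "P2 y = max (- P y) 0" for y
  have P12: "P y = P1 y - P2 y" for y by (simp add: P1_def P2_def)
  have c: "continuous_on (UNIV - {0}) P1" "continuous_on (UNIV - {0}) P2"
    unfolding P1_def P2_def by (intro continuous_intros P)+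
  have mx: "max (x * t) 0 = max x 0 * t" if "t > 0" for x t :: real
    using that by (auto simp: max_def mult_le_0_iff zero_le_mult_iff)
  have h: "P1 (a *\<^sub>R y) * a ^ CARD('n) = P1 y" "P2 (a *\<^sub>R y) * a ^ CARD('n) = P2 y" if "a > 0" "y \<noteq> 0" for a y
  proof -
    have a: "a ^ CARD('n) > 0" using that by simp
    show "P1 (a *\<^sub>R y) * a ^ CARD('n) = P1 y" "P2 (a *\<^sub>R y) * a ^ CARD('n) = P2 y"
      unfolding P1_def P2_def mx[OF a, symmetric] mult_minus_left hom[OF that] by (rule refl)+
  qed
  have z: "0 \<le> P1 y" "0 \<le> P2 y" "P1 0 = 0" "P2 0 = 0" for y by (auto simp: P1_def P2_def P)
  have e1: "(\<integral>y. \<bar>det (matrix L)\<bar> * P1 (L y) * tent y \<partial>lborel) = (\<integral>y. P1 y * tent y \<partial>lborel)"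
    by (rule integral_linear_change_nonneg[OF c(1) z(1,3) h(1) L])
  have e2: "(\<integral>y. \<bar>det (matrix L)\<bar> * P2 (L y) * tent y \<partial>lborel) = (\<integral>y. P2 y * tent y \<partial>lborel)"
    by (rule integral_linear_change_nonneg[OF c(2) z(2,4) h(2) L])
  have cL: "continuous_on (UNIV - {0}) (\<lambda>y. \<bar>det (matrix L)\<bar> * P1 (L y))" "continuous_on (UNIV - {0}) (\<lambda>y. \<bar>det (matrix L)\<bar> * P2 (L y))"
  proof -
    have Lc: "continuous_on (UNIV - {0}) L" by (intro linear_continuous_on) (simp add: linear_conv_bounded_linear[symmetric] L)
    have "L y \<noteq> 0" if "y \<noteq> 0" for y using linear_injective_0[OF L(1)] L(2) that by blast
    then have LU: "L ` (UNIV - {0}) \<subseteq> UNIV - {0}" by auto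
    show "continuous_on (UNIV - {0}) (\<lambda>y. \<bar>det (matrix L)\<bar> * P1 (L y))"
      by (rule continuous_on_mult_left[OF continuous_on_compose2[OF c(1) Lc LU]])
    show "continuous_on (UNIV - {0}) (\<lambda>y. \<bar>det (matrix L)\<bar> * P2 (L y))"
      by (rule continuous_on_mult_left[OF continuous_on_compose2[OF c(2) Lc LU]])
  qed
  have "(\<integral>y. \<bar>det (matrix L)\<bar> * P (L y) * tent y \<partial>lborel) =
      (\<integral>y. \<bar>det (matrix L)\<bar> * P1 (L y) * tent y - \<bar>det (matrix L)\<bar> * P2 (L y) * tent y \<partial>lborel)"
    by (rule Bochner_Integration.integral_cong[OF refl]) (simp only: P12 right_diff_distrib left_diff_distrib)
  also have "\<dots> = (\<integral>y. P1 y * tent y \<partial>lborel) - (\<integral>y. P2 y * tent y \<partial>lborel)"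
    by (simp only: Bochner_Integration.integral_diff[OF integrable_mult_tent[OF cL(1)] integrable_mult_tent[OF cL(2)]] e1 e2)
  also have "\<dots> = (\<integral>y. P1 y * tent y - P2 y * tent y \<partial>lborel)"
    by (rule Bochner_Integration.integral_diff[OF integrable_mult_tent[OF c(1)] integrable_mult_tent[OF c(2)], symmetric])
  also have "\<dots> = (\<integral>y. P y * tent y \<partial>lborel)"
    by (rule Bochner_Integration.integral_cong[OF refl]) (simp only: P12 left_diff_distrib)
  finally show ?thesis .
qed

lemma integral_tent_pos:
  fixes P :: "real^'n::finite \<Rightarrow> real"
  assumes P: "continuous_on (UNIV - {0}) P" "\<And>y. y \<noteq> 0 \<Longrightarrow> P y > 0"
  shows "(\<integral>y. P y * tent y \<partial>lborel) > 0"
proof -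
  let ?g = "\<lambda>y. P y * tent y"
  have int: "integrable lborel ?g" by (rule integrable_mult_tent[OF P(1)])
  have nn: "0 \<le> ?g y" for y using P(2)[of y] by (cases "y = 0") (auto simp: tent_def)
  have "(\<integral>y. ?g y \<partial>lborel) \<noteq> 0"
  proof
    assume "(\<integral>y. ?g y \<partial>lborel) = 0"
    then have ae: "AE y in lborel. ?g y = 0"
      using integral_nonneg_eq_0_iff_AE[OF int] nn by auto
    \<comment> \<open>The interior of the support of \<open>tent\<close>.\<close>
    let ?O = "ball 0 (exp 1) - cball 0 (exp (-1)) :: (real^'n) set"
    have gO: "?g y \<noteq> 0" if "y \<in> ?O" for y
    proof -
      have n: "exp (-1) < norm y" "norm y < exp 1" using that by auto
      then have "y \<noteq> 0" by (metis exp_gt_zero less_asym norm_zero)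
      then have "exp (ln (norm y)) = norm y" by simp
      then have "-1 < ln (norm y)" "ln (norm y) < 1" using n by (metis exp_less_cancel_iff)+
      then show ?thesis using P(2)[OF \<open>y \<noteq> 0\<close>] \<open>y \<noteq> 0\<close> by (simp add: tent_def)
    qed
    have O: "open ?O" by (intro open_Diff) auto
    have "AE y in lborel. y \<notin> ?O" using ae by (rule eventually_mono) (use gO in auto)
    then have "?O \<in> null_sets lborel" using O by (subst (asm) AE_iff_null_sets[symmetric]) auto
    then have "negligible ?O" by (simp add: negligible_iff_null_sets null_sets_completionI)
    moreover have "(\<Sum>i\<in>{undefined}. axis i 1 :: real^'n) \<in> ?O" by (simp add: norm_axis_1)
    ultimately show False using open_not_negligible[OF O] by blast
  qed
  moreover have "0 \<le> (\<integral>y. ?g y \<partial>lborel)" by (intro Bochner_Integration.integral_nonneg nn)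
  ultimately show ?thesis by simp
qed

section \<open>Positive definite matrices\<close>

text \<open>The segment from the identity matrix to \<open>M\<close> consists of positive definite, hence invertible, matrices, so
  the determinant keeps its sign along it.\<close>

lemma det_pos_of_positive_definite:
  fixes M :: "real^'n::finite^'n"
  assumes "\<And>w. w \<noteq> 0 \<Longrightarrow> w \<bullet> (M *v w) > 0"
  shows "det M > 0"
proof -
  define G where "G t = (\<chi> i j. (1 - t) * (if i = j then 1 else 0) + t * M $ i $ j)" for t
  have Gv: "G t *v w = (1 - t) *\<^sub>R w + t *\<^sub>R (M *v w)" for t w
    by (simp add: vec_eq_iff G_def matrix_vector_mult_def distrib_right sum.distrib sum_distrib_left
        if_distrib[of "\<lambda>x. x * _"] if_distrib[of "\<lambda>x. (1-t) * x"] mult.assoc cong: if_cong)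
  have nz: "det (G t) \<noteq> 0" if "0 \<le> t" "t \<le> 1" for t
  proof -
    have "w = 0" if "G t *v w = 0" for w
    proof (rule ccontr)
      assume w: "w \<noteq> 0"
      have "w \<bullet> (G t *v w) = (1 - t) * (w \<bullet> w) + t * (w \<bullet> (M *v w))"
        by (simp add: Gv inner_add_right)
      moreover have "(1 - t) * (w \<bullet> w) + t * (w \<bullet> (M *v w)) > 0"
      proof (cases "t = 1")
        case True then show ?thesis using assms[OF w] by simp
      next
        case False
        then show ?thesis using assms[OF w] w \<open>0 \<le> t\<close> \<open>t \<le> 1\<close> by (intro add_pos_nonneg) auto
      qed
      ultimately show False using that by simp
    qed
    then have "invertible (G t)" using invertible_left_inverse matrix_left_invertible_ker by blast
    then show ?thesis by (simp add: invertible_det_nz)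
  qed
  have cont: "continuous_on {0..1} (\<lambda>t. det (G t))"
    by (rule continuous_on_det) (auto simp: G_def intro!: continuous_intros)
  have "G 0 = mat 1" "G 1 = M" by (auto simp: G_def mat_def vec_eq_iff)
  then have d: "det (G 0) = 1" "det (G 1) = det M" by auto
  show ?thesis
  proof (rule ccontr)
    assume "\<not> det M > 0"
    then obtain t where "0 \<le> t" "t \<le> 1" "det (G t) = 0"
      using IVT2'[of "\<lambda>t. det (G t)" 1 0 0] d cont by auto
    then show False using nz by blast
  qed
qed

lemma matrix_eq_bilinear:
  fixes M N :: "real^'n::finite^'n"
  assumes "\<And>u v. u \<bullet> (M *v v) = u \<bullet> (N *v v)"
  shows "M = N"
proof -
  have "M *v v = N *v v" for v
    using assms vector_eq_ldot[of "M *v v" "N *v v"] by simp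
  then show ?thesis by (simp add: matrix_eq)
qed

section \<open>Fundamental tensors of a single fibre\<close>

text \<open>The Hessian of \<open>f\<^sup>2 / 2\<close>: the fundamental tensor of one fibre.\<close>

definition energy_tensor :: "(real^'n::finite \<Rightarrow> real) \<Rightarrow> real^'n \<Rightarrow> real^'n^'n" where
  "energy_tensor f y = (\<chi> i j. 1/2 * partial i (partial j (\<lambda>z. (f z)\<^sup>2)) y)"

locale minkowski_norm =
  fixes f :: "real^'n::finite \<Rightarrow> real"
  assumes smooth: "smooth_on (UNIV - {0}) f"
    and nonneg: "\<And>y. f y \<ge> 0"
    and hom: "\<And>a y. a \<ge> 0 \<Longrightarrow> f (a *\<^sub>R y) = a * f y"
    and pd: "\<And>y w. y \<noteq> 0 \<Longrightarrow> w \<noteq> 0 \<Longrightarrow> w \<bullet> (energy_tensor f y *v w) > 0"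
begin

abbreviation "E \<equiv> \<lambda>z. (f z)\<^sup>2"
abbreviation "g \<equiv> energy_tensor f"

lemma E_smooth: "smooth_on (UNIV - {0}) E" by (rule smooth_on_power[OF smooth])

lemma E_hom: "a > 0 \<Longrightarrow> y \<noteq> 0 \<Longrightarrow> E (a *\<^sub>R y) = a ^ Suc 1 * E y"
  by (simp add: hom power_mult_distrib power2_eq_square)

lemma g_bilinear:
  assumes "y \<noteq> 0"
  shows "u \<bullet> (g y *v v) = 1/2 * second_derivative E y u v"
proof -
  have y: "y \<in> UNIV - {0}" using assms by simp
  have gij: "g y $ i $ j = 1/2 * second_derivative E y (axis i 1) (axis j 1)" for i j
    by (simp add: energy_tensor_def second_derivative_def partial_def[abs_def])
  have ax: "w = (\<Sum>i\<in>UNIV. w $ i *\<^sub>R axis i 1)" for w :: "real^'n"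
    by (simp add: basis_expansion scalar_mult_eq_scaleR[symmetric])
  have "second_derivative E y u v = second_derivative E y (\<Sum>i\<in>UNIV. u $ i *\<^sub>R axis i 1) v"
    using ax[of u] by simp
  also have "\<dots> = (\<Sum>i\<in>UNIV. u $ i * second_derivative E y (axis i 1) v)"
    by (simp add: linear_sum[OF second_derivative_linear_left[OF E_smooth y]]
        linear_scale[OF second_derivative_linear_left[OF E_smooth y]])
  also have "\<dots> = (\<Sum>i\<in>UNIV. u $ i * (\<Sum>j\<in>UNIV. v $ j * second_derivative E y (axis i 1) (axis j 1)))"
  proof -
    have "second_derivative E y w v = (\<Sum>j\<in>UNIV. v $ j * second_derivative E y w (axis j 1))" for w
    proof -
      have "second_derivative E y w v = second_derivative E y w (\<Sum>j\<in>UNIV. v $ j *\<^sub>R axis j 1)"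
        using ax[of v] by simp
      also have "\<dots> = (\<Sum>j\<in>UNIV. v $ j * second_derivative E y w (axis j 1))"
        by (simp add: linear_sum[OF second_derivative_linear_right[OF E_smooth y]]
            linear_scale[OF second_derivative_linear_right[OF E_smooth y]])
      finally show ?thesis .
    qed
    then show ?thesis by simp
  qed
  finally show ?thesis
    by (simp add: inner_vec_def matrix_vector_mult_def gij sum_distrib_left mult_ac)
qed

lemma g_sym: "y \<noteq> 0 \<Longrightarrow> g y $ i $ j = g y $ j $ i"
  using second_derivative_commute[OF E_smooth, of y "axis i 1" "axis j 1"]
  by (simp add: energy_tensor_def second_derivative_def partial_def[abs_def])

lemma DE_hom: "a > 0 \<Longrightarrow> y \<noteq> 0 \<Longrightarrow> frechet_derivative E (at (a *\<^sub>R y)) v = a ^ 1 * frechet_derivative E (at y) v"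
  by (rule frechet_derivative_homogeneous[OF E_smooth E_hom])

lemma second_derivative_E_hom:
  assumes "a > 0" "y \<noteq> 0"
  shows "second_derivative E (a *\<^sub>R y) u v = second_derivative E y u v"
  unfolding second_derivative_def
  using frechet_derivative_homogeneous[OF smooth_on_derivative[OF E_smooth, of v], of 0 a y u] DE_hom assms by simp

lemma g_hom: "a > 0 \<Longrightarrow> y \<noteq> 0 \<Longrightarrow> g (a *\<^sub>R y) = g y"
  by (rule matrix_eq_bilinear) (simp add: g_bilinear second_derivative_E_hom)

text \<open>Euler's relation for \<open>E\<close>, of degree two, and for its derivatives, of degree one.\<close>

lemma g_radial: "y \<noteq> 0 \<Longrightarrow> y \<bullet> (g y *v y) = E y"
proof -
  assume y: "y \<noteq> 0"
  have "second_derivative E y y y = real 1 * frechet_derivative E (at y) y" unfolding second_derivative_def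
    by (rule euler_homogeneous[OF smooth_on_derivative[OF E_smooth] DE_hom y])
  also have "frechet_derivative E (at y) y = real 2 * E y"
    by (rule euler_homogeneous[OF E_smooth _ y]) (simp add: hom power_mult_distrib)
  finally show ?thesis using g_bilinear[OF y, of y y] by simp
qed

text \<open>By \<open>g_radial\<close>, \<open>f\<close> cannot vanish where \<open>g\<close> is positive definite.\<close>

lemma f_pos: "y \<noteq> 0 \<Longrightarrow> f y > 0"
  using pd[of y y] g_radial[of y] nonneg[of y] by (cases "f y = 0") auto

lemma det_g_pos: "y \<noteq> 0 \<Longrightarrow> det (g y) > 0"
  by (rule det_pos_of_positive_definite) (rule pd)

lemma g_smooth: "smooth_on (UNIV - {0}) (\<lambda>y. g y $ i $ j)"
proof -
  have "smooth_on (UNIV - {0}) (\<lambda>y. 1/2 * frechet_derivative (\<lambda>z. frechet_derivative E (at z) (axis j 1)) (at y) (axis i 1))"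
    by (intro smooth_on_mult smooth_on_const smooth_on_derivative E_smooth) auto
  then show ?thesis by (simp add: energy_tensor_def partial_def[abs_def])
qed

lemma sqrt_det_cont: "continuous_on (UNIV - {0}) (\<lambda>y. sqrt (det (g y)))"
  by (intro continuous_intros continuous_on_det smooth_on_continuous[OF g_smooth])

sublocale star_hypersurface f "\<lambda>y. sqrt (det (g y))"
  by standard
    (use smooth f_pos hom[of 0 0] hom sqrt_det_cont det_g_pos g_hom in \<open>auto simp: less_imp_le\<close>)

lemma g_linear:
  assumes L: "linear L" "inj L" and fL: "\<And>y. f' y = f (L y)" and y: "y \<noteq> 0"
  shows "second_derivative (\<lambda>z. (f' z)\<^sup>2) y u v = second_derivative E (L y) (L u) (L v)"
proof -
  have bl: "bounded_linear L" using L by (simp add: linear_conv_bounded_linear)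
  have Lnz: "L z \<in> UNIV - {0}" if "z \<noteq> 0" for z using that L linear_injective_0 by blast
  have ch: "((\<lambda>z. e (L z)) has_derivative (\<lambda>h. frechet_derivative e (at (L z)) (L h))) (at z)"
    if "smooth_on (UNIV - {0}) e" "z \<noteq> 0" for e :: "real^'n \<Rightarrow> real" and z
    by (rule has_derivative_compose[OF bounded_linear_imp_has_derivative[OF bl] smooth_on_has_derivative[OF that(1) Lnz[OF that(2)]]])
  have 1: "frechet_derivative (\<lambda>z. (f' z)\<^sup>2) (at z) v = frechet_derivative E (at (L z)) (L v)" if "z \<noteq> 0" for z
    using frechet_derivative_eq[OF ch[OF E_smooth that]] by (simp add: fL)
  have "frechet_derivative (\<lambda>z. frechet_derivative (\<lambda>z. (f' z)\<^sup>2) (at z) v) (at y) =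
      frechet_derivative (\<lambda>z. frechet_derivative E (at (L z)) (L v)) (at y)"
    by (rule frechet_derivative_cong_open[of "UNIV - {0}"]) (use y 1 in auto)
  also have "\<dots> = (\<lambda>h. frechet_derivative (\<lambda>z. frechet_derivative E (at z) (L v)) (at (L y)) (L h))"
    by (rule frechet_derivative_eq[OF ch[OF smooth_on_derivative[OF E_smooth] y]])
  finally show ?thesis by (simp add: second_derivative_def)
qed

end

lemma continuous_on_inner_matrix:
  fixes M :: "'a::topological_space \<Rightarrow> real^'n::finite^'n"
  assumes "\<And>i j. continuous_on S (\<lambda>y. M y $ i $ j)"
  shows "continuous_on S (\<lambda>y. u \<bullet> (M y *v v))"
  by (simp add: inner_vec_def matrix_vector_mult_def, intro continuous_intros assms)

section \<open>Charts and tangent vectors\<close>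

text \<open>The Jacobian at \<open>p\<close> of the change of charts from \<open>c\<close> to \<open>d\<close>.\<close>

abbreviation trans_deriv :: "('m, 'n::finite) chart \<Rightarrow> ('m, 'n) chart \<Rightarrow> 'm \<Rightarrow> real^'n \<Rightarrow> real^'n" where
  "trans_deriv c d p \<equiv> frechet_derivative (trans_map c d) (at (coord c p))"

locale smooth_atlas =
  fixes X :: "'m topology" and A :: "('m, 'n::finite) chart set"
  assumes manifold: "smooth_manifold X A"
begin

lemma dom_topspace: "c \<in> A \<Longrightarrow> p \<in> dom_of c \<Longrightarrow> p \<in> topspace X"
  using manifold by (auto simp: smooth_manifold_def)

lemma chart_at: "p \<in> topspace X \<Longrightarrow> \<exists>c\<in>A. p \<in> dom_of c"
  using manifold unfolding smooth_manifold_def by blast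

lemma chart_is_chart: "c \<in> A \<Longrightarrow> is_chart X c"
  using manifold by (auto simp: smooth_manifold_def)

lemma img_open: "c \<in> A \<Longrightarrow> open (img_of c)"
  using chart_is_chart by (auto simp: is_chart_def)

lemma coord_inj: "c \<in> A \<Longrightarrow> inj_on (coord c) (dom_of c)"
proof -
  assume c: "c \<in> A"
  then have h: "homeomorphic_map (subtopology X (dom_of c)) (top_of_set (img_of c)) (coord c)"
    and o: "openin X (dom_of c)" using chart_is_chart by (auto simp: is_chart_def)
  have "topspace (subtopology X (dom_of c)) = dom_of c"
    using openin_subset[OF o] by auto
  then show ?thesis using homeomorphic_imp_injective_map[OF h] by simp
qed

lemma point_coord [simp]: "c \<in> A \<Longrightarrow> p \<in> dom_of c \<Longrightarrow> point c (coord c p) = p"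
  unfolding point_def by (rule inv_into_f_f[OF coord_inj])

lemma trans_map_coord: "c \<in> A \<Longrightarrow> p \<in> dom_of c \<Longrightarrow> trans_map c d (coord c p) = coord d p"
  by (simp add: trans_map_def)

lemma trans_smooth: "c \<in> A \<Longrightarrow> d \<in> A \<Longrightarrow> smooth_on (coord c ` (dom_of c \<inter> dom_of d)) (trans_map c d)"
  using manifold by (auto simp: smooth_manifold_def)

lemma trans_has_derivative:
  "c \<in> A \<Longrightarrow> d \<in> A \<Longrightarrow> p \<in> dom_of c \<Longrightarrow> p \<in> dom_of d \<Longrightarrow>
    (trans_map c d has_derivative trans_deriv c d p) (at (coord c p))"
  by (rule smooth_on_has_derivative[OF trans_smooth]) auto

lemma trans_deriv_linear:
  "c \<in> A \<Longrightarrow> d \<in> A \<Longrightarrow> p \<in> dom_of c \<Longrightarrow> p \<in> dom_of d \<Longrightarrow> linear (trans_deriv c d p)"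
  using trans_has_derivative has_derivative_linear by blast

lemma trans_deriv_self: "c \<in> A \<Longrightarrow> p \<in> dom_of c \<Longrightarrow> trans_deriv c c p y = y"
proof -
  assume c: "c \<in> A" "p \<in> dom_of c"
  have "frechet_derivative (trans_map c c) (at (coord c p)) = frechet_derivative (\<lambda>x. x) (at (coord c p))"
    by (rule frechet_derivative_cong_open[OF img_open[OF c(1)]]) (use c in \<open>auto simp: trans_map_def\<close>)
  also have "\<dots> = (\<lambda>h. h)" by (rule frechet_derivative_eq) simp
  finally show ?thesis by simp
qed

text \<open>The cocycle identity. Near \<open>coord c p\<close> the change of charts from \<open>c\<close> to \<open>e\<close> factors through \<open>d\<close>; injectivity of
  \<open>coord c\<close> makes the overlap an intersection of two sets known to be open.\<close>

lemma trans_deriv_comp: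
  assumes "c \<in> A" "d \<in> A" "e \<in> A" "p \<in> dom_of c" "p \<in> dom_of d" "p \<in> dom_of e"
  shows "trans_deriv d e p (trans_deriv c d p y) = trans_deriv c e p y"
proof -
  let ?O = "coord c ` (dom_of c \<inter> dom_of d) \<inter> coord c ` (dom_of c \<inter> dom_of e)"
  have O: "open ?O" using smooth_on_open[OF trans_smooth] assms by (intro open_Int) auto
  have "((\<lambda>x. trans_map d e (trans_map c d x)) has_derivative (\<lambda>h. trans_deriv d e p (trans_deriv c d p h))) (at (coord c p))"
    by (rule has_derivative_compose[OF trans_has_derivative])
      (use assms in \<open>auto simp: trans_map_coord intro!: trans_has_derivative\<close>)
  then have "((trans_map c e) has_derivative (\<lambda>h. trans_deriv d e p (trans_deriv c d p h))) (at (coord c p))"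
  proof (rule has_derivative_transform_within_open[OF _ O])
    show "coord c p \<in> ?O" using assms by auto
    fix x assume "x \<in> ?O"
    then obtain q r where q: "q \<in> dom_of c" "q \<in> dom_of d" "x = coord c q" and r: "r \<in> dom_of c" "r \<in> dom_of e" "x = coord c r"
      by auto
    then have "q = r" using coord_inj[OF assms(1)] by (auto dest: inj_onD)
    then show "trans_map d e (trans_map c d x) = trans_map c e x"
      using q r assms by (simp add: trans_map_coord)
  qed
  from frechet_derivative_eq[OF this] show ?thesis by simp
qed

lemma trans_deriv_inj:
  assumes "c \<in> A" "d \<in> A" "p \<in> dom_of c" "p \<in> dom_of d"
  shows "inj (trans_deriv c d p)"
  by (rule inj_on_inverseI[where g="trans_deriv d c p"]) (use assms in \<open>simp add: trans_deriv_comp trans_deriv_self\<close>)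

lemma tvec_in: "c \<in> A \<Longrightarrow> p \<in> dom_of c \<Longrightarrow> tvec A c p y \<in> tangent_space A p"
  by (auto simp: tangent_space_def tvec_def trans_deriv_comp)

lemma tvec_self: "c \<in> A \<Longrightarrow> p \<in> dom_of c \<Longrightarrow> tvec A c p y c = y"
  by (simp add: tvec_def trans_deriv_self)

lemma tvec_trans:
  "c \<in> A \<Longrightarrow> d \<in> A \<Longrightarrow> p \<in> dom_of c \<Longrightarrow> p \<in> dom_of d \<Longrightarrow> tvec A d p (trans_deriv c d p y) = tvec A c p y"
  by (auto simp: tvec_def trans_deriv_comp)

lemma tangent_component:
  "v \<in> tangent_space A p \<Longrightarrow> c \<in> A \<Longrightarrow> d \<in> A \<Longrightarrow> p \<in> dom_of c \<Longrightarrow> p \<in> dom_of d \<Longrightarrow> v d = trans_deriv c d p (v c)"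
  unfolding tangent_space_def by blast

lemma tvec_nonzero: "c \<in> A \<Longrightarrow> p \<in> dom_of c \<Longrightarrow> y \<noteq> 0 \<Longrightarrow> tvec A c p y \<noteq> tzero"
  using tvec_self[of c p y] by (auto simp: tzero_def)

lemma tvec_scale: "c \<in> A \<Longrightarrow> p \<in> dom_of c \<Longrightarrow> tvec A c p (a *\<^sub>R y) = tscale a (tvec A c p y)"
  unfolding tvec_def tscale_def
  by (rule ext) (simp add: linear_scale[OF trans_deriv_linear] del: split_paired_All)

lemma tangent_nonzero:
  assumes "v \<in> tangent_space A p" "v \<noteq> tzero" "c \<in> A" "p \<in> dom_of c"
  shows "v c \<noteq> 0"
proof
  assume "v c = 0"
  have "v d = 0" for d
  proof (cases "d \<in> A \<and> p \<in> dom_of d")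
    case True
    then have "v d = trans_deriv c d p 0"
      using tangent_component[OF assms(1,3), of d] assms(4) \<open>v c = 0\<close> by simp
    then show ?thesis using linear_0[OF trans_deriv_linear[of c d p]] assms(3,4) True by simp
  next
    case False
    then show ?thesis using assms(1) unfolding tangent_space_def by blast
  qed
  then show False using assms(2) by (auto simp: tzero_def)
qed

lemma smooth_on_slit_fibre:
  assumes "smooth_on_slit A G" "c \<in> A" "p \<in> dom_of c"
  shows "smooth_on (UNIV - {0}) (\<lambda>y. G p (tvec A c p y))"
proof -
  have G: "smooth_on (img_of c \<times> (UNIV - {0})) (\<lambda>(x, y). G (point c x) (tvec A c (point c x) y))"
    using assms by (auto simp: smooth_on_slit_def)
  have "smooth_on (UNIV - {0}) (\<lambda>y. (coord c p, 0) + (0, y))"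
    by (intro smooth_on_add smooth_on_const smooth_on_linear bounded_linear_Pair bounded_linear_zero bounded_linear_ident) auto
  then have "smooth_on (UNIV - {0}) (\<lambda>y. case (coord c p, 0) + (0, y) of (x, y) \<Rightarrow> G (point c x) (tvec A c (point c x) y))"
    by (rule smooth_on_compose[OF _ G]) (use assms in auto)
  then show ?thesis using assms by simp
qed

end

section \<open>The averaged metric\<close>

locale weighted_finsler =
  fixes X :: "'m topology" and A :: "('m, 'n::finite) chart set" and F W :: "'m \<Rightarrow> ('m, 'n) tvector \<Rightarrow> real"
  assumes finsler: "finsler_space X A F" and weight: "weight_function X A W"
begin

sublocale smooth_atlas X A
  by standard (use finsler in \<open>simp add: finsler_space_def\<close>)

abbreviation "fc \<equiv> finsler_coord A F"
abbreviation "gc \<equiv> fundamental_tensor A F"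
abbreviation "wc c p y \<equiv> W p (tvec A c p y)"

lemma gc_energy: "gc c p = energy_tensor (fc c p)"
  by (auto simp: fun_eq_iff fundamental_tensor_def energy_tensor_def)

lemma fc_minkowski: "c \<in> A \<Longrightarrow> p \<in> dom_of c \<Longrightarrow> minkowski_norm (fc c p)"
proof
  assume c: "c \<in> A" "p \<in> dom_of c"
  have p: "p \<in> topspace X" by (rule dom_topspace[OF c])
  have "smooth_on_slit A F" using finsler by (simp add: finsler_space_def)
  then show "smooth_on (UNIV - {0}) (fc c p)"
    using smooth_on_slit_fibre[OF _ c] by (simp add: finsler_coord_def[abs_def])
  show "0 \<le> fc c p y" for y
    using finsler p tvec_in[OF c] by (auto simp: finsler_space_def finsler_coord_def)
  show "fc c p (a *\<^sub>R y) = a * fc c p y" if "0 \<le> a" for a y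
    using finsler p tvec_in[OF c] that by (auto simp: finsler_space_def finsler_coord_def tvec_scale[OF c])
  show "w \<bullet> (energy_tensor (fc c p) y *v w) > 0" if "y \<noteq> 0" "w \<noteq> 0" for y w
    using finsler c that by (auto simp: finsler_space_def gc_energy)
qed

lemma wc_pos: "c \<in> A \<Longrightarrow> p \<in> dom_of c \<Longrightarrow> y \<noteq> 0 \<Longrightarrow> wc c p y > 0"
  using weight dom_topspace tvec_in tvec_nonzero unfolding weight_function_def by blast

lemma wc_hom: "c \<in> A \<Longrightarrow> p \<in> dom_of c \<Longrightarrow> y \<noteq> 0 \<Longrightarrow> a > 0 \<Longrightarrow> wc c p (a *\<^sub>R y) = wc c p y"
  using weight dom_topspace tvec_in tvec_nonzero by (simp add: weight_function_def tvec_scale)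

lemma wc_smooth: "c \<in> A \<Longrightarrow> p \<in> dom_of c \<Longrightarrow> smooth_on (UNIV - {0}) (wc c p)"
  using weight by (intro smooth_on_slit_fibre) (auto simp: weight_function_def)

text \<open>The density \<open>H\<close> of the fibre over \<open>p\<close>. By \<open>integral_dvol\<close> below, \<open>fibre_integral\<close> is integration
  over the indicatrix, and \<open>averaged_form\<close> is the bilinear form with matrix \<open>h\<^sub>i\<^sub>j\<close>.\<close>

definition "fibre_density c p y = (if y = 0 then 0 else sqrt (det (gc c p y)) / fc c p y ^ CARD('n))"
definition "averaged_form c p u v = (\<Sum>i\<in>UNIV. \<Sum>j\<in>UNIV. averaged_metric A F W c p i j * (u $ i) * (v $ j))"

definition "fibre_integral c p Q = (\<integral>y. Q y * fibre_density c p y * tent y \<partial>lborel)"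

context
  fixes c :: "('m, 'n) chart" and p :: 'm
  assumes c: "c \<in> A" "p \<in> dom_of c"
begin

interpretation minkowski_norm "fc c p" by (rule fc_minkowski[OF c])

lemma fibre_density_eq_H: "fibre_density c p = H"
  by (auto simp: fun_eq_iff fibre_density_def H_def gc_energy)

lemma fibre_density_cont: "continuous_on (UNIV - {0}) (fibre_density c p)"
  unfolding fibre_density_eq_H by (rule H_cont)

lemma fibre_density_scale: "a > 0 \<Longrightarrow> fibre_density c p (a *\<^sub>R y) * a ^ CARD('n) = fibre_density c p y"
  unfolding fibre_density_eq_H by (rule H_scale)

lemma fibre_density_pos: "y \<noteq> 0 \<Longrightarrow> fibre_density c p y > 0"
  using det_g_pos[of y] f_pos[of y] by (simp add: fibre_density_def gc_energy)

lemma dvol_eq: "dvol A F c p = \<mu>"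
proof -
  have "dvol A F c p = hypersurface_measure S \<alpha> l"
  proof -
    have "indicatrix A F c p = S" by (simp add: indicatrix_def S_def)
    moreover have "fibre_form A F c p = \<alpha>"
      by (auto simp: fun_eq_iff fibre_form_def \<alpha>_def gc_energy)
    moreover have "(\<lambda>y. (1 / fc c p y) *\<^sub>R y) = l" by (auto simp: fun_eq_iff l_def)
    ultimately show ?thesis by (simp add: dvol_def)
  qed
  then show ?thesis by (simp add: hypersurface_measure_eq)
qed

lemma integral_dvol:
  assumes "continuous_on (UNIV - {0}) Q" "\<And>a y. a > 0 \<Longrightarrow> y \<noteq> 0 \<Longrightarrow> Q (a *\<^sub>R y) = Q y"
  shows "(\<integral>y. Q y \<partial>dvol A F c p) = fibre_integral c p Q"
  unfolding dvol_eq fibre_integral_def fibre_density_eq_H by (rule integral_\<mu>[OF assms])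

lemma wc_cont: "continuous_on (UNIV - {0}) (wc c p)"
  by (rule smooth_on_continuous[OF wc_smooth[OF c]])

lemma gc_cont: "continuous_on (UNIV - {0}) (\<lambda>y. gc c p y $ i $ j)"
  unfolding gc_energy by (rule smooth_on_continuous[OF g_smooth])

lemma gc_hom: "a > 0 \<Longrightarrow> y \<noteq> 0 \<Longrightarrow> gc c p (a *\<^sub>R y) = gc c p y"
  unfolding gc_energy by (rule g_hom)

lemma vol_eq: "vol A F W c p = fibre_integral c p (wc c p)"
  unfolding vol_def by (rule integral_dvol) (use wc_cont wc_hom[OF c] in auto)

lemma vol_pos: "vol A F W c p > 0"
  unfolding vol_eq fibre_integral_def
  by (rule integral_tent_pos) (use wc_cont fibre_density_cont wc_pos[OF c] fibre_density_pos in \<open>auto intro!: continuous_intros\<close>)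

lemma averaged_metric_eq:
  "averaged_metric A F W c p i j = fibre_integral c p (\<lambda>y. wc c p y * gc c p y $ i $ j) / vol A F W c p"
proof -
  have "(\<integral>y. wc c p y * gc c p y $ i $ j \<partial>dvol A F c p) = fibre_integral c p (\<lambda>y. wc c p y * gc c p y $ i $ j)"
    by (rule integral_dvol[OF continuous_on_mult[OF wc_cont gc_cont]]) (simp add: wc_hom[OF c] gc_hom)
  then show ?thesis by (simp add: averaged_metric_def average_def)
qed

text \<open>Averaging commutes with evaluating the tensor on fixed vectors. In this form no indices refer to the
  chart, which is what the comparison of charts needs.\<close>

lemma averaged_form_eq: "averaged_form c p u v = fibre_integral c p (\<lambda>y. wc c p y * (u \<bullet> (gc c p y *v v))) / vol A F W c p"
proof -
  have int: "integrable lborel (\<lambda>y. wc c p y * gc c p y $ i $ j * fibre_density c p y * tent y)" for i j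
    by (rule integrable_mult_tent) (intro continuous_intros wc_cont gc_cont fibre_density_cont)
  have "fibre_integral c p (\<lambda>y. wc c p y * (u \<bullet> (gc c p y *v v))) =
      (\<integral>y. (\<Sum>i\<in>UNIV. \<Sum>j\<in>UNIV. (u $ i * v $ j) * (wc c p y * gc c p y $ i $ j * fibre_density c p y * tent y)) \<partial>lborel)"
    unfolding fibre_integral_def
    by (rule Bochner_Integration.integral_cong[OF refl])
      (simp add: inner_vec_def matrix_vector_mult_def sum_distrib_left sum_distrib_right mult_ac)
  also have "\<dots> = (\<Sum>i\<in>UNIV. \<Sum>j\<in>UNIV. (u $ i * v $ j) * fibre_integral c p (\<lambda>y. wc c p y * gc c p y $ i $ j))"
    unfolding fibre_integral_def
    by (simp add: Bochner_Integration.integral_sum int integrable_mult_right Bochner_Integration.integrable_sum)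
  finally have "fibre_integral c p (\<lambda>y. wc c p y * (u \<bullet> (gc c p y *v v))) =
    (\<Sum>i\<in>UNIV. \<Sum>j\<in>UNIV. (u $ i * v $ j) * fibre_integral c p (\<lambda>y. wc c p y * gc c p y $ i $ j))" .
  then show ?thesis
    by (simp add: averaged_form_def averaged_metric_eq sum_divide_distrib mult_ac)
qed

lemma averaged_metric_sym: "averaged_metric A F W c p i j = averaged_metric A F W c p j i"
proof -
  have "fibre_integral c p (\<lambda>y. wc c p y * gc c p y $ i $ j) = fibre_integral c p (\<lambda>y. wc c p y * gc c p y $ j $ i)"
    unfolding fibre_integral_def
  proof (rule Bochner_Integration.integral_cong[OF refl])
    show "wc c p y * gc c p y $ i $ j * fibre_density c p y * tent y = wc c p y * gc c p y $ j $ i * fibre_density c p y * tent y" for y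
      by (cases "y = 0") (simp add: fibre_density_def, simp add: gc_energy g_sym[of y i j])
  qed
  then show ?thesis by (simp add: averaged_metric_eq)
qed

lemma averaged_form_sym: "averaged_form c p u v = averaged_form c p v u"
proof -
  have "averaged_form c p u v = (\<Sum>j\<in>UNIV. \<Sum>i\<in>UNIV. averaged_metric A F W c p i j * (u $ i) * (v $ j))"
    unfolding averaged_form_def by (rule sum.swap)
  also have "\<dots> = averaged_form c p v u"
    unfolding averaged_form_def by (intro sum.cong refl) (simp add: averaged_metric_sym mult_ac)
  finally show ?thesis .
qed

lemma averaged_form_pos: "u \<noteq> 0 \<Longrightarrow> averaged_form c p u u > 0"
proof -
  assume u: "u \<noteq> 0"
  have "continuous_on (UNIV - {0}) (\<lambda>y. u \<bullet> (gc c p y *v u))"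
    by (rule continuous_on_inner_matrix[OF gc_cont])
  then have "fibre_integral c p (\<lambda>y. wc c p y * (u \<bullet> (gc c p y *v u))) > 0"
    unfolding fibre_integral_def
    by (intro integral_tent_pos continuous_on_mult wc_cont fibre_density_cont mult_pos_pos wc_pos[OF c] fibre_density_pos)
      (auto simp: gc_energy pd u)
  then show ?thesis using vol_pos by (simp add: averaged_form_eq)
qed

lemma averaged_form_add: "averaged_form c p (u + v) w = averaged_form c p u w + averaged_form c p v w"
  by (simp add: averaged_form_def algebra_simps sum.distrib)

lemma averaged_form_scale: "averaged_form c p (a *\<^sub>R u) w = a * averaged_form c p u w"
  by (simp add: averaged_form_def sum_distrib_left mult_ac)

lemma averaged_form_axis: "averaged_form c p (axis i 1) (axis j 1) = averaged_metric A F W c p i j"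
proof -
  have "averaged_form c p (axis i 1) (axis j 1) = (\<Sum>k\<in>UNIV. \<Sum>l\<in>UNIV. if k = i then (if l = j then averaged_metric A F W c p k l else 0) else 0)"
    unfolding averaged_form_def by (intro sum.cong refl) (auto simp: axis_def)
  also have "\<dots> = averaged_metric A F W c p i j"
  proof -
    have "(\<Sum>l\<in>UNIV. if k = i then (if l = j then averaged_metric A F W c p k l else 0) else 0) =
        (if k = i then averaged_metric A F W c p k j else 0)" for k
      by (cases "k = i") (simp_all add: sum.delta)
    then show ?thesis by (simp add: sum.delta)
  qed
  finally show ?thesis .
qed

end

text \<open>In the two charts the norms of the fibre differ by the linear map \<open>L = trans_deriv c d p\<close>, and second
  derivatives are tensorial under linear maps.\<close>

lemma gc_chart:
  assumes c: "c \<in> A" "p \<in> dom_of c" and d: "d \<in> A" "p \<in> dom_of d" and y: "y \<noteq> 0"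
  shows "u \<bullet> (gc c p y *v v) = trans_deriv c d p u \<bullet> (gc d p (trans_deriv c d p y) *v trans_deriv c d p v)"
proof -
  let ?L = "trans_deriv c d p"
  have L: "linear ?L" "inj ?L" using trans_deriv_linear trans_deriv_inj c d by auto
  have Lnz: "?L y \<noteq> 0" using linear_injective_0[OF L(1)] L(2) y by blast
  interpret C: minkowski_norm "fc c p" by (rule fc_minkowski[OF c])
  interpret D: minkowski_norm "fc d p" by (rule fc_minkowski[OF d])
  have f: "fc c p y = fc d p (?L y)" for y
    using tvec_trans[OF c(1) d(1) c(2) d(2)] by (simp add: finsler_coord_def)
  show ?thesis
    unfolding gc_energy C.g_bilinear[OF y] D.g_bilinear[OF Lnz] D.g_linear[OF L f y] ..
qed

text \<open>Since \<open>g\<close> transforms as a tensor, \<open>det g\<close> acquires the factor \<open>(det L)\<^sup>2\<close> and the density the factor \<open>\<bar>det L\<bar>\<close>,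
  which is the Jacobian of the linear change of variables.\<close>

lemma fibre_integral_chart:
  assumes c: "c \<in> A" "p \<in> dom_of c" and d: "d \<in> A" "p \<in> dom_of d"
    and Q: "continuous_on (UNIV - {0}) Q" "\<And>a y. a > 0 \<Longrightarrow> y \<noteq> 0 \<Longrightarrow> Q (a *\<^sub>R y) = Q y"
    and Q': "\<And>y. y \<noteq> 0 \<Longrightarrow> Q' y = Q (trans_deriv c d p y)"
  shows "fibre_integral c p Q' = fibre_integral d p Q"
proof -
  let ?L = "trans_deriv c d p"
  have L: "linear ?L" "inj ?L" using trans_deriv_linear trans_deriv_inj c d by auto
  have Lnz: "?L y \<noteq> 0" if "y \<noteq> 0" for y using linear_injective_0[OF L(1)] L(2) that by blast
  have f: "fc c p y = fc d p (?L y)" for y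
    using tvec_trans[OF c(1) d(1) c(2) d(2)] by (simp add: finsler_coord_def)
  have Lm: "matrix ?L *v w = ?L w" for w by (rule matrix_works) (use L(1) in \<open>simp add: linear_def scalar_mult_eq_scaleR[abs_def]\<close>)
  \<comment> \<open>The matrix form of \<open>gc_chart\<close>, to take determinants.\<close>
  have gm: "gc c p y = transpose (matrix ?L) ** gc d p (?L y) ** matrix ?L" if "y \<noteq> 0" for y
  proof (rule matrix_eq_bilinear)
    fix u v
    have "u \<bullet> ((transpose (matrix ?L) ** gc d p (?L y) ** matrix ?L) *v v) =
        u \<bullet> (transpose (matrix ?L) *v (gc d p (?L y) *v ?L v))"
      by (simp add: matrix_vector_mul_assoc[symmetric] Lm)
    also have "\<dots> = (u v* transpose (matrix ?L)) \<bullet> (gc d p (?L y) *v ?L v)"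
      by (rule dot_lmul_matrix[symmetric])
    also have "u v* transpose (matrix ?L) = ?L u" by (simp add: vector_transpose_matrix Lm)
    finally show "u \<bullet> (gc c p y *v v) = u \<bullet> ((transpose (matrix ?L) ** gc d p (?L y) ** matrix ?L) *v v)"
      using gc_chart[OF c d that] by simp
  qed
  have fibre_density: "fibre_density c p y = \<bar>det (matrix ?L)\<bar> * fibre_density d p (?L y)" if "y \<noteq> 0" for y
  proof -
    have "det (gc c p y) = (det (matrix ?L))\<^sup>2 * det (gc d p (?L y))"
      unfolding gm[OF that] by (simp add: det_mul power2_eq_square)
    then show ?thesis using that Lnz[OF that] f by (simp add: fibre_density_def real_sqrt_mult)
  qed
  let ?P = "\<lambda>y. Q y * fibre_density d p y"
  have "fibre_integral c p Q' = (\<integral>y. \<bar>det (matrix ?L)\<bar> * ?P (?L y) * tent y \<partial>lborel)"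
    unfolding fibre_integral_def
  proof (rule Bochner_Integration.integral_cong[OF refl])
    show "Q' y * fibre_density c p y * tent y = \<bar>det (matrix ?L)\<bar> * ?P (?L y) * tent y" for y
      by (cases "y = 0") (simp add: tent_def, simp add: fibre_density Q')
  qed
  also have "\<dots> = (\<integral>y. ?P y * tent y \<partial>lborel)"
  proof (rule integral_linear_change[OF _ _ _ L])
    show "continuous_on (UNIV - {0}) ?P" by (intro continuous_intros Q fibre_density_cont[OF d])
    show "?P 0 = 0" by (simp add: fibre_density_def)
    show "?P (a *\<^sub>R y) * a ^ CARD('n) = ?P y" if "a > 0" "y \<noteq> 0" for a y
      using Q(2)[OF that] fibre_density_scale[OF d that(1), of y] by (simp add: mult.assoc)
  qed
  finally show "fibre_integral c p Q' = fibre_integral d p Q" by (simp add: fibre_integral_def)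
qed

lemma averaged_form_chart:
  assumes c: "c \<in> A" "p \<in> dom_of c" and d: "d \<in> A" "p \<in> dom_of d"
  shows "averaged_form c p u v = averaged_form d p (trans_deriv c d p u) (trans_deriv c d p v)"
proof -
  let ?L = "trans_deriv c d p"
  have w: "wc c p y = wc d p (?L y)" for y
    using tvec_trans[OF c(1) d(1) c(2) d(2)] by simp
  have v: "vol A F W c p = vol A F W d p"
    unfolding vol_eq[OF c] vol_eq[OF d]
    by (rule fibre_integral_chart[OF c d]) (use wc_cont[OF d] wc_hom[OF d] w in auto)
  have "continuous_on (UNIV - {0}) (\<lambda>y. ?L u \<bullet> (gc d p y *v ?L v))"
    by (rule continuous_on_inner_matrix[OF gc_cont[OF d]])
  then have "fibre_integral c p (\<lambda>y. wc c p y * (u \<bullet> (gc c p y *v v))) = fibre_integral d p (\<lambda>y. wc d p y * (?L u \<bullet> (gc d p y *v ?L v)))"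
    by (intro fibre_integral_chart[OF c d] continuous_on_mult wc_cont[OF d])
      (auto simp: wc_hom[OF d] gc_hom[OF d] w gc_chart[OF c d])
  then show ?thesis by (simp add: averaged_form_eq[OF c] averaged_form_eq[OF d] v)
qed

end

lemma frechet_derivative_fibre:
  fixes G :: "('a::euclidean_space) \<times> ('b::euclidean_space) \<Rightarrow> 'c::real_normed_vector"
  assumes "smooth_on D G" "(x, y) \<in> D"
  shows "frechet_derivative (\<lambda>z. G (x, z)) (at y) v = frechet_derivative G (at (x, y)) (0, v)"
proof -
  have "((\<lambda>z. (x, z)) has_derivative (\<lambda>v. (0, v))) (at y)" by (auto intro!: derivative_eq_intros)
  from has_derivative_compose[OF this smooth_on_has_derivative[OF assms]]
  show ?thesis by (simp add: frechet_derivative_eq)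
qed

context weighted_finsler
begin

context
  fixes c :: "('m, 'n) chart"
  assumes c: "c \<in> A"
begin

lemma slit_chart_open: "open (img_of c \<times> (UNIV - {0::real^'n}))"
  by (intro open_Times img_open[OF c]) auto

lemma point_in: "x \<in> img_of c \<Longrightarrow> point c x \<in> dom_of c"
  using point_coord[OF c] by auto

lemma smooth_on_slit_joint:
  "smooth_on_slit A G \<Longrightarrow>
    smooth_on (img_of c \<times> (UNIV - {0})) (\<lambda>z. G (point c (fst z)) (tvec A c (point c (fst z)) (snd z)))"
  using c unfolding smooth_on_slit_def case_prod_beta' by blast

lemma fc_joint_smooth: "smooth_on (img_of c \<times> (UNIV - {0})) (\<lambda>z. fc c (point c (fst z)) (snd z))"
  using finsler smooth_on_slit_joint unfolding finsler_space_def finsler_coord_def by blast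

lemma wc_joint_smooth: "smooth_on (img_of c \<times> (UNIV - {0})) (\<lambda>z. wc c (point c (fst z)) (snd z))"
  using weight smooth_on_slit_joint unfolding weight_function_def by blast

text \<open>Derivatives of the restriction to a fibre are derivatives of the joint function in vertical directions,
  which are smooth in all variables.\<close>

lemma gc_joint_smooth: "smooth_on (img_of c \<times> (UNIV - {0})) (\<lambda>z. gc c (point c (fst z)) (snd z) $ i $ j)"
proof -
  let ?D = "img_of c \<times> (UNIV - {0::real^'n})"
  let ?G = "\<lambda>z. (fc c (point c (fst z)) (snd z))\<^sup>2"
  let ?H = "\<lambda>z. frechet_derivative ?G (at z) (0, axis j 1)"
  have G: "smooth_on ?D ?G" by (rule smooth_on_power[OF fc_joint_smooth])
  have H: "smooth_on ?D ?H" by (rule smooth_on_derivative[OF G])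
  have e: "gc c (point c x) y $ i $ j = 1/2 * frechet_derivative ?H (at (x, y)) (0, axis i 1)"
    if xy: "x \<in> img_of c" "y \<noteq> 0" for x y
  proof -
    have "partial i (partial j (\<lambda>z. ?G (x, z))) y = partial i (\<lambda>z. ?H (x, z)) y"
      unfolding partial_def
    proof (rule arg_cong[where f="\<lambda>D. D (axis i 1)"], rule frechet_derivative_cong_open[of "UNIV - {0}"])
      show "frechet_derivative (\<lambda>z. ?G (x, z)) (at w) (axis j 1) = ?H (x, w)" if "w \<in> UNIV - {0}" for w
        by (rule frechet_derivative_fibre[OF G]) (use xy that in auto)
    qed (use xy in auto)
    also have "\<dots> = frechet_derivative ?H (at (x, y)) (0, axis i 1)"
      unfolding partial_def by (rule frechet_derivative_fibre[OF H]) (use xy in auto)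
    finally show ?thesis by (simp add: fundamental_tensor_def)
  qed
  have e': "gc c (point c (fst z)) (snd z) $ i $ j = 1/2 * frechet_derivative ?H (at z) (0, axis i 1)" if "z \<in> ?D" for z
    using e[of "fst z" "snd z"] that by (simp add: mem_Times_iff)
  have "smooth_on ?D (\<lambda>z. 1/2 * frechet_derivative ?H (at z) (0, axis i 1))"
    by (intro smooth_on_mult smooth_on_const smooth_on_derivative[OF H] slit_chart_open)
  also have "smooth_on ?D (\<lambda>z. 1/2 * frechet_derivative ?H (at z) (0, axis i 1)) =
      smooth_on ?D (\<lambda>z. gc c (point c (fst z)) (snd z) $ i $ j)"
    by (rule smooth_on_cong[symmetric]) (rule e')
  finally show ?thesis .
qed

lemma fibre_integral_smooth:
  assumes Q: "smooth_on (img_of c \<times> (UNIV - {0})) Q"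
  shows "smooth_on (img_of c) (\<lambda>x. fibre_integral c (point c x) (\<lambda>y. Q (x, y)))"
proof -
  let ?D = "img_of c \<times> (UNIV - {0::real^'n})"
  let ?d = "\<lambda>z. sqrt (det (gc c (point c (fst z)) (snd z))) / fc c (point c (fst z)) (snd z) ^ CARD('n)"
  have pos: "det (gc c (point c x) y) > 0" "fc c (point c x) y > 0" if "x \<in> img_of c" "y \<noteq> 0" for x y
    using minkowski_norm.det_g_pos[OF fc_minkowski[OF c point_in[OF that(1)]] that(2)]
      minkowski_norm.f_pos[OF fc_minkowski[OF c point_in[OF that(1)]] that(2)] by (simp_all add: gc_energy)
  have "smooth_on ?D ?d"
  proof (intro smooth_on_divide smooth_on_sqrt smooth_on_det smooth_on_power fc_joint_smooth gc_joint_smooth slit_chart_open)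
    fix z assume "z \<in> ?D"
    then have z: "fst z \<in> img_of c" "snd z \<noteq> 0" by auto
    show "0 < det (gc c (point c (fst z)) (snd z))" by (rule pos(1)[OF z])
    show "fc c (point c (fst z)) (snd z) ^ CARD('n) \<noteq> 0" using pos(2)[OF z] by simp
  qed
  then have "smooth_on ?D (\<lambda>z. Q z * ?d z)" by (rule smooth_on_mult[OF Q])
  from smooth_on_integral_tent[OF img_open[OF c] this]
  have "smooth_on (img_of c) (\<lambda>x. \<integral>y. Q (x, y) * ?d (x, y) * tent y \<partial>lborel)" .
  moreover have "fibre_integral c (point c x) (\<lambda>y. Q (x, y)) = (\<integral>y. Q (x, y) * ?d (x, y) * tent y \<partial>lborel)" for x
    unfolding fibre_integral_def
  proof (rule Bochner_Integration.integral_cong[OF refl])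
    show "Q (x, y) * fibre_density c (point c x) y * tent y = Q (x, y) * ?d (x, y) * tent y" for y
      by (cases "y = 0") (simp add: tent_def, simp add: fibre_density_def)
  qed
  ultimately show ?thesis by simp
qed

lemma averaged_metric_smooth: "smooth_on (img_of c) (\<lambda>x. averaged_metric A F W c (point c x) i j)"
proof -
  have 1: "smooth_on (img_of c) (\<lambda>x. fibre_integral c (point c x) (\<lambda>y. wc c (point c x) y * gc c (point c x) y $ i $ j))"
    using fibre_integral_smooth[OF smooth_on_mult[OF wc_joint_smooth gc_joint_smooth]] by simp
  have 2: "smooth_on (img_of c) (\<lambda>x. fibre_integral c (point c x) (wc c (point c x)))"
    using fibre_integral_smooth[OF wc_joint_smooth] by simp
  have "smooth_on (img_of c) (\<lambda>x. fibre_integral c (point c x) (\<lambda>y. wc c (point c x) y * gc c (point c x) y $ i $ j) /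
      fibre_integral c (point c x) (wc c (point c x)))"
    by (rule smooth_on_divide[OF 1 2])
      (use vol_pos[OF c point_in] vol_eq[OF c point_in] in \<open>auto simp: less_imp_neq[symmetric]\<close>)
  then show ?thesis
    by (subst smooth_on_cong) (auto simp: averaged_metric_eq[OF c point_in] vol_eq[OF c point_in])
qed

end

text \<open>By \<open>averaged_form_chart\<close> the choice of the chart does not matter.\<close>

definition "base_chart p = (SOME c. c \<in> A \<and> p \<in> dom_of c)"
definition "avg_metric p u v = averaged_form (base_chart p) p (u (base_chart p)) (v (base_chart p))"

lemma base_chart: "p \<in> topspace X \<Longrightarrow> base_chart p \<in> A \<and> p \<in> dom_of (base_chart p)"
  unfolding base_chart_def by (rule someI_ex) (use chart_at in blast)

lemma avg_metric_eq:
  assumes c: "c \<in> A" "p \<in> dom_of c" and uv: "u \<in> tangent_space A p" "v \<in> tangent_space A p"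
  shows "avg_metric p u v = averaged_form c p (u c) (v c)"
proof -
  have b: "base_chart p \<in> A" "p \<in> dom_of (base_chart p)" using base_chart[OF dom_topspace[OF c]] by blast+
  show ?thesis unfolding avg_metric_def
    using averaged_form_chart[OF c b] tangent_component[OF uv(1) c(1) b(1) c(2) b(2)]
      tangent_component[OF uv(2) c(1) b(1) c(2) b(2)] by simp
qed

lemma avg_metric_riemannian: "riemannian_metric X A avg_metric"
  unfolding riemannian_metric_def
proof (intro conjI ballI allI impI)
  fix p u v assume p: "p \<in> topspace X" and u: "u \<in> tangent_space A p"
  have b: "base_chart p \<in> A" "p \<in> dom_of (base_chart p)" using base_chart[OF p] by blast+
  show "avg_metric p u v = avg_metric p v u" unfolding avg_metric_def by (rule averaged_form_sym[OF b])
  show "avg_metric p (tadd u v) w = avg_metric p u w + avg_metric p v w" for w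
    unfolding avg_metric_def tadd_def by (rule averaged_form_add[OF b])
  show "avg_metric p (tscale a u) v = a * avg_metric p u v" for a
    unfolding avg_metric_def tscale_def by (rule averaged_form_scale[OF b])
  show "0 < avg_metric p u u" if "u \<noteq> tzero"
    unfolding avg_metric_def by (rule averaged_form_pos[OF b tangent_nonzero[OF u that b]])
next
  fix c i j assume c: "c \<in> A"
  have "avg_metric (point c x) (tvec A c (point c x) (axis i 1)) (tvec A c (point c x) (axis j 1)) =
      averaged_metric A F W c (point c x) i j" if "x \<in> img_of c" for x
    using avg_metric_eq[OF c point_in[OF c that] tvec_in tvec_in] point_in[OF c that] c
    by (simp add: tvec_self averaged_form_axis)
  then show "smooth_on (img_of c) (\<lambda>x. avg_metric (point c x) (tvec A c (point c x) (axis i 1)) (tvec A c (point c x) (axis j 1)))"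
    using averaged_metric_smooth[OF c] by (subst smooth_on_cong) auto
qed

end

theorem proposition3p1:
  fixes X :: "'m topology"
    and A :: "('m, 'n::finite) chart set"
    and F W :: "'m \<Rightarrow> ('m, 'n) tvector \<Rightarrow> real"
  assumes "finsler_space X A F"
    and "weight_function X A W"
  shows "\<exists>h. riemannian_metric X A h \<and>
    (\<forall>c\<in>A. \<forall>p\<in>dom_of c. \<forall>u\<in>tangent_space A p. \<forall>v\<in>tangent_space A p.
       h p u v = (\<Sum>i\<in>UNIV. \<Sum>j\<in>UNIV. averaged_metric A F W c p i j * (u c $ i) * (v c $ j)))"
proof -
  interpret weighted_finsler X A F W by (rule weighted_finsler.intro[OF assms])
  show ?thesis
    by (intro exI[of _ avg_metric] conjI ballI avg_metric_riemannian) (simp add: avg_metric_eq averaged_form_def)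
qed

end
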